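(* Assume that $0<\alpha,\beta<n$, $0<\mu<n-2\lambda$, $0<p_0,q_0<\infty$. If $(u,v)\in L^{p_0+1}(\partial\mathbb{R}^n_+)\times L^{q_0+1}(\mathbb{R}^n_+)$ is a pair of positive solutions of the integral system $$\begin{cases}u(y)=\displaystyle\int_{\mathbb{R}^{n}_{+}}|x|^{-\beta}P_{\lambda}(x,y,\mu)v^{q_{0}}(x)|y|^{-\alpha}\,dx, & y\in\partial\mathbb{R}^{n}_{+},\\[2mm] v(x)=\displaystyle\int_{\partial\mathbb{R}^{n}_{+}}|y|^{-\alpha}P_{\lambda}(x,y,\mu)u^{p_{0}}(y)|x|^{-\beta}\,dy, & x\in\mathbb{R}^{n}_{+},\end{cases}$$ where $p_0$ and $q_0$ satisfy $\frac{n-1}{n}\frac{1}{p_0+1}+\frac{1}{q_0+1}=\frac{\alpha+\beta+\mu-\lambda}{n}$, then $u(y)$ and $v(x)|_{\partial\mathbb{R}^n_+}$ must be radially symmetric and monotone decreasing about some point $y_0\in\partial\mathbb{R}^n_+$.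
   Context: $n\ge 3$, $\lambda\ge 0$. $\mathbb{R}^n_+=\{x=(x',x_n)\in\mathbb{R}^{n-1}\times\mathbb{R}: x_n>0\}$, with boundary $\partial\mathbb{R}^n_+$ identified with $\mathbb{R}^{n-1}$. The kernel is $$P_{\lambda}(x,y,\mu)=\frac{x_{n}^{\lambda}}{\left(|x'-y|^{2}+x_{n}^{2}\right)^{\mu/2}},\qquad x=(x',x_n)\in\mathbb{R}^n_+,\ y\in\partial\mathbb{R}^n_+.$$ *)

theory Defs
  imports "HOL-Analysis.Analysis"
begin

text \<open>
  The half space of dimension $n$ is modelled in the product \<open>real^'m \<times> real\<close> with
  \<open>CARD('m) = n - 1\<close>; its norm is the Euclidean norm of $(x', x_n)$, and the boundary is
  \<open>real^'m\<close>.

  Functions take values in $[0,\infty]$. Since $|y|^{-\alpha}$ is infinite at the origin, so is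
  the right-hand side of the first equation there; with extended values the system can be
  required at every point, without exception. Membership in $L^p$ makes solutions finite almost
  everywhere.
\<close>

definition half_space :: "((real^'m) \<times> real) set" where
  "half_space = {x. snd x > 0}"

definition poisson_kernel :: "real \<Rightarrow> (real^'m) \<times> real \<Rightarrow> real^'m \<Rightarrow> real \<Rightarrow> real" where
  "poisson_kernel lam x y \<mu> =
     snd x powr lam / ((norm (fst x - y))\<^sup>2 + (snd x)\<^sup>2) powr (\<mu> / 2)"

text \<open>The weight $|x|^{-a}$, with value \<open>\<infinity>\<close> at the origin when $a > 0$.\<close>

definition singular_weight :: "real \<Rightarrow> 'a::real_normed_vector \<Rightarrow> ennreal" where
  "singular_weight a x = inverse (ennreal (norm x powr a))"

text \<open>Real powers on $[0,\infty]$; only meant for exponents \<open>p > 0\<close>.\<close>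

definition ennreal_powr :: "ennreal \<Rightarrow> real \<Rightarrow> ennreal" where
  "ennreal_powr a p = (if a = \<infinity> then \<infinity> else ennreal (enn2real a powr p))"

definition in_Lp :: "real \<Rightarrow> 'a measure \<Rightarrow> ('a \<Rightarrow> ennreal) \<Rightarrow> bool" where
  "in_Lp p M f \<longleftrightarrow> f \<in> borel_measurable M \<and> (\<integral>\<^sup>+ x. ennreal_powr (f x) p \<partial>M) < \<infinity>"

text \<open>
  A solution \<open>v\<close> lives on the open half space, so its restriction to the boundary is the limit
  as $x_n$ tends to $0$ from above. The lower limit is used so that the value is defined in all
  cases; it is the limit whenever that exists in $[0,\infty]$. For $\lambda = 0$ the limit always
  exists, by monotone convergence, and is the second integral formula evaluated at $x_n = 0$.
\<close>

definition boundary_restriction :: "((real^'m) \<times> real \<Rightarrow> ennreal) \<Rightarrow> real^'m \<Rightarrow> ennreal" where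
  "boundary_restriction v z = Liminf (at_right 0) (\<lambda>t. v (z, t))"

definition radially_symmetric_about :: "'a::real_normed_vector \<Rightarrow> ('a \<Rightarrow> ennreal) \<Rightarrow> bool" where
  "radially_symmetric_about c f \<longleftrightarrow> (\<forall>y z. norm (y - c) = norm (z - c) \<longrightarrow> f y = f z)"

definition monotone_decreasing_about :: "'a::real_normed_vector \<Rightarrow> ('a \<Rightarrow> ennreal) \<Rightarrow> bool" where
  "monotone_decreasing_about c f \<longleftrightarrow> (\<forall>y z. norm (y - c) \<le> norm (z - c) \<longrightarrow> f z \<le> f y)"

end

theory Submission
  imports Defs
begin

text \<open>
  The proof is a moving plane argument in integral form. The only possible centre is the origin,
  where the weight makes \<open>u\<close> infinite, so it suffices to show $v \le v_\sigma$ on the side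
  $\{x \cdot e < \sigma\}$ of every mirror with $\sigma \le 0$, where $v_\sigma$ is the reflected function;
  the inequality for \<open>u\<close>, and then the strict one for \<open>v\<close>, follow pointwise from the integral
  formulas and the monotonicity of the weights.

  If $p_0 q_0 > 1$, the relative defects $\rho = (u - u_\sigma)^+/u$ and $\tau = (v - v_\sigma)^+/v$ satisfy
  linearised inequalities whose kernels are weighted by the solution itself. Jensen's inequality bounds
  \<open>\<tau>\<close> by \<open>\<rho>\<close> in $L^{p_0+1}$ of these weights, and a Schur test with power weights (a Stein--Weiss
  inequality for the exponents that the integrability of \<open>u\<close> forces) bounds \<open>\<rho>\<close> by \<open>\<tau>\<close> with a
  factor that is small when the set $\{v > v_\sigma\}$ carries little mass. Hence the set of admissible
  $\sigma < 0$ is nonempty, open and closed.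

  If $p_0 q_0 \le 1$, no planes need to be moved: taking the larger one of the values at mirror points
  on the side of the origin gives a subsolution above \<open>(u, v)\<close>, and Jensen's inequality forces
  equality, which the strict monotonicity of the weights excludes unless $v \le v_\sigma$.
\<close>

subsection \<open>Powers of extended nonnegative reals\<close>

text \<open>The threshold is \<open>p * q = 1\<close> because 1 - 1/(p+1) - 1/(q+1) = (pq -
  1)/((p+1)(q+1)): exactly for pq > 1 a positive Hoelder exponent is left over, and that exponent
  carries the mass of the set where v exceeds its reflection. Defects are taken relative to the
  solution for two reasons. First, a^s - b^s is at most max(1,s) a^s (a-b)/a for every s > 0, so
  exponents below and above 1 are treated alike. Second, if G denotes the kernel with both weights,
  the equations say that G v^q and G u^p have total mass u and v, so Jensen's inequality applies
  with these masses and needs no estimate of G. The criticality relation enters through scaling: it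
  allows one power weight to make both Schur integrals homogeneous of degree 0. Almost everywhere
  statements about v become pointwise because v is finite and continuous in the open half space. The
  weight is strictly increased by reflection only if the mirror misses the origin, so \<sigma> = 0
  is reached as a limit of \<sigma> < 0.\<close>

lemma ennreal_powr_zero [simp]: "ennreal_powr 0 p = 0"
  by (simp add: ennreal_powr_def)

lemma ennreal_powr_top [simp]: "ennreal_powr top p = top"
  by (simp add: ennreal_powr_def)

lemma ennreal_powr_ennreal: "0 \<le> x \<Longrightarrow> ennreal_powr (ennreal x) p = ennreal (x powr p)"
  by (simp add: ennreal_powr_def)

lemma ennreal_powr_ennreal_powr [simp]: "ennreal_powr (ennreal_powr a p) r = ennreal_powr a (p * r)"
  by (cases a) (simp_all add: ennreal_powr_ennreal powr_powr)

lemma ennreal_powr_1 [simp]: "ennreal_powr a 1 = a"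
  by (cases a) (simp_all add: ennreal_powr_ennreal)

lemma ennreal_powr_one [simp]: "ennreal_powr 1 p = 1"
  by (simp add: ennreal_powr_def)

lemma ennreal_powr_eq_0_iff [simp]: "ennreal_powr a p = 0 \<longleftrightarrow> a = 0"
  by (cases a) (simp_all add: ennreal_powr_ennreal)

lemma ennreal_powr_pos_iff [simp]: "0 < ennreal_powr a p \<longleftrightarrow> 0 < a"
  by (simp add: zero_less_iff_neq_zero)

lemma ennreal_powr_eq_top_iff [simp]: "ennreal_powr a p = top \<longleftrightarrow> a = top"
  by (simp add: ennreal_powr_def)

lemma ennreal_powr_less_top_iff [simp]: "ennreal_powr a p < top \<longleftrightarrow> a < top"
  by (metis ennreal_powr_eq_top_iff less_top)

lemma ennreal_powr_mult: "0 < p \<Longrightarrow> ennreal_powr (a * b) p = ennreal_powr a p * ennreal_powr b p"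
  by (cases "a = 0 \<or> b = 0"; cases a; cases b)
     (auto simp: ennreal_powr_ennreal powr_mult ennreal_mult_top ennreal_top_mult simp flip: ennreal_mult)

lemma ennreal_powr_add: "ennreal_powr a (p + r) = ennreal_powr a p * ennreal_powr a r"
  by (cases a) (simp_all add: ennreal_powr_ennreal powr_add ennreal_mult)

lemma ennreal_powr_mono: "a \<le> b \<Longrightarrow> 0 \<le> p \<Longrightarrow> ennreal_powr a p \<le> ennreal_powr b p"
  by (cases b; cases a) (auto simp: ennreal_powr_ennreal powr_mono2 top_unique)

lemma ennreal_powr_strict_mono: "a < b \<Longrightarrow> 0 < p \<Longrightarrow> ennreal_powr a p < ennreal_powr b p"
  by (cases b; cases a) (auto simp: ennreal_powr_ennreal powr_less_mono2 ennreal_less_iff)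

lemma ennreal_powr_eq_iff: "0 < p \<Longrightarrow> ennreal_powr a p = ennreal_powr b p \<longleftrightarrow> a = b"
  by (metis ennreal_powr_strict_mono linorder_neq_iff)

lemma ennreal_powr_exponent_mono: "1 \<le> a \<Longrightarrow> p \<le> r \<Longrightarrow> ennreal_powr a p \<le> ennreal_powr a r"
  by (cases a) (auto simp: ennreal_powr_ennreal powr_mono simp flip: ennreal_1)

lemma measurable_ennreal_powr [measurable]:
  "f \<in> borel_measurable M \<Longrightarrow> (\<lambda>x. ennreal_powr (f x) p) \<in> borel_measurable M"
proof (rule measurable_compose[where g="\<lambda>a. ennreal_powr a p"])
  show "(\<lambda>a. ennreal_powr a p) \<in> borel_measurable borel"
    unfolding ennreal_powr_def
    by (intro measurable_If measurable_compose[OF _ measurable_ennreal] powr_real_measurable) measurable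
qed

subsection \<open>The inequalities of Hoelder and Jensen\<close>

lemma Youngs_inequality_ennreal:
  assumes "0 < \<theta>" "\<theta> < 1"
  shows "ennreal_powr a \<theta> * ennreal_powr b (1 - \<theta>) \<le> ennreal \<theta> * a + ennreal (1 - \<theta>) * b"
proof (cases "a = 0 \<or> b = 0 \<or> a = top \<or> b = top")
  case True
  then show ?thesis
    using assms by (auto simp: ennreal_mult_top)
next
  case False
  then obtain x y where "a = ennreal x" "b = ennreal y" "0 < x" "0 < y"
    by (cases a; cases b) (auto simp: less_le)
  then show ?thesis
    using assms Youngs_inequality_0[of \<theta> "1 - \<theta>" x y]
    by (simp add: ennreal_powr_ennreal flip: ennreal_mult ennreal_plus)
qed

text \<open>Written with powers \<theta> and 1 - \<theta> of the integrands instead of conjugate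
  norms, so that exponents can be collected directly. Once both integrals are scaled to 1, Young's
  inequality integrates to \<theta> + (1 - \<theta>) = 1; zero and infinite integrals are treated
  before.\<close>

lemma nn_integral_Hoelder:
  assumes [measurable]: "f \<in> borel_measurable M" "g \<in> borel_measurable M" and \<theta>: "0 < \<theta>" "\<theta> < 1"
  shows "(\<integral>\<^sup>+x. ennreal_powr (f x) \<theta> * ennreal_powr (g x) (1 - \<theta>) \<partial>M)
    \<le> ennreal_powr (\<integral>\<^sup>+x. f x \<partial>M) \<theta> * ennreal_powr (\<integral>\<^sup>+x. g x \<partial>M) (1 - \<theta>)"
    (is "?L \<le> ennreal_powr ?F _ * ennreal_powr ?G _")
proof -
  consider "?F = 0 \<or> ?G = 0" | "?F \<noteq> 0" "?G \<noteq> 0" "?F = top \<or> ?G = top"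
    | "?F \<noteq> 0" "?F \<noteq> top" "?G \<noteq> 0" "?G \<noteq> top"
    by blast
  then show ?thesis
  proof cases
    case 1
    then have "(AE x in M. f x = 0) \<or> (AE x in M. g x = 0)"
      by (auto simp: nn_integral_0_iff_AE)
    then have "AE x in M. ennreal_powr (f x) \<theta> * ennreal_powr (g x) (1 - \<theta>) = 0"
      by auto
    then have "?L = 0"
      by (simp add: nn_integral_0_iff_AE)
    then show ?thesis by simp
  next
    case 2
    then show ?thesis by (auto simp: ennreal_mult_top ennreal_top_mult)
  next
    case 3
    then obtain F G where FG: "?F = ennreal F" "?G = ennreal G" "0 < F" "0 < G"
      by (cases ?F; cases ?G) (auto simp: less_le)
    define c d where "c = inverse (ennreal F)" and "d = inverse (ennreal G)"
    have cF: "ennreal F * c = 1" "ennreal G * d = 1"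
      using FG by (simp_all add: c_def d_def inverse_ennreal flip: ennreal_mult)
    have eq: "ennreal_powr (f x) \<theta> * ennreal_powr (g x) (1 - \<theta>) =
        ennreal_powr ?F \<theta> * ennreal_powr ?G (1 - \<theta>) *
        (ennreal_powr (c * f x) \<theta> * ennreal_powr (d * g x) (1 - \<theta>))" for x
    proof -
      have "f x = ?F * (c * f x)" "g x = ?G * (d * g x)"
        using cF FG by (simp_all flip: mult.assoc)
      then have "ennreal_powr (f x) \<theta> = ennreal_powr ?F \<theta> * ennreal_powr (c * f x) \<theta>"
        "ennreal_powr (g x) (1 - \<theta>) = ennreal_powr ?G (1 - \<theta>) * ennreal_powr (d * g x) (1 - \<theta>)"
        using \<theta> by (metis ennreal_powr_mult, metis ennreal_powr_mult diff_gt_0_iff_gt)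
      then show ?thesis by (simp add: mult_ac)
    qed
    have "?L = ennreal_powr ?F \<theta> * ennreal_powr ?G (1 - \<theta>) *
        (\<integral>\<^sup>+x. ennreal_powr (c * f x) \<theta> * ennreal_powr (d * g x) (1 - \<theta>) \<partial>M)"
      by (subst eq) (rule nn_integral_cmult, measurable)
    also have "(\<integral>\<^sup>+x. ennreal_powr (c * f x) \<theta> * ennreal_powr (d * g x) (1 - \<theta>) \<partial>M)
        \<le> (\<integral>\<^sup>+x. ennreal \<theta> * (c * f x) + ennreal (1 - \<theta>) * (d * g x) \<partial>M)"
      using \<theta> by (intro nn_integral_mono Youngs_inequality_ennreal)
    also have "\<dots> = ennreal \<theta> * (c * ?F) + ennreal (1 - \<theta>) * (d * ?G)"
      by (simp add: nn_integral_add nn_integral_cmult)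
    also have "\<dots> = 1"
      using cF FG \<theta> by (simp add: mult.commute flip: ennreal_plus)
    finally show ?thesis
      by (simp add: mult_left_mono)
  qed
qed

lemma nn_integral_Hoelder3:
  assumes [measurable]: "f \<in> borel_measurable M" "g \<in> borel_measurable M" "h \<in> borel_measurable M"
    and pos: "0 < \<theta>1" "0 < \<theta>2" "0 < \<theta>3" and sum: "\<theta>1 + \<theta>2 + \<theta>3 = 1"
  shows "(\<integral>\<^sup>+x. ennreal_powr (f x) \<theta>1 * (ennreal_powr (g x) \<theta>2 * ennreal_powr (h x) \<theta>3) \<partial>M)
    \<le> ennreal_powr (\<integral>\<^sup>+x. f x \<partial>M) \<theta>1 *
      (ennreal_powr (\<integral>\<^sup>+x. g x \<partial>M) \<theta>2 * ennreal_powr (\<integral>\<^sup>+x. h x \<partial>M) \<theta>3)"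
proof -
  \<comment> \<open>The share of \<open>\<theta>2\<close> in the exponent 1 - \<theta>1 = \<theta>2
    + \<theta>3 that remains after the first application of Hoelder's inequality.\<close>
  define \<eta> where "\<eta> = \<theta>2 / (1 - \<theta>1)"
  have \<theta>1: "0 < \<theta>1" "\<theta>1 < 1" and \<eta>: "0 < \<eta>" "\<eta> < 1"
    and e: "\<eta> * (1 - \<theta>1) = \<theta>2" "(1 - \<eta>) * (1 - \<theta>1) = \<theta>3"
  proof -
    have d: "1 - \<theta>1 = \<theta>2 + \<theta>3"
      using sum by simp
    show "0 < \<theta>1" "\<theta>1 < 1"
      using pos sum by auto
    show "0 < \<eta>" "\<eta> < 1" "\<eta> * (1 - \<theta>1) = \<theta>2" "(1 - \<eta>) * (1 - \<theta>1) = \<theta>3"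
      using pos unfolding \<eta>_def d by (auto simp: field_simps)
  qed
  let ?k = "\<lambda>x. ennreal_powr (g x) \<eta> * ennreal_powr (h x) (1 - \<eta>)"
  have "(\<integral>\<^sup>+x. ennreal_powr (f x) \<theta>1 * (ennreal_powr (g x) \<theta>2 * ennreal_powr (h x) \<theta>3) \<partial>M)
      = (\<integral>\<^sup>+x. ennreal_powr (f x) \<theta>1 * ennreal_powr (?k x) (1 - \<theta>1) \<partial>M)"
    using \<theta>1 by (simp add: ennreal_powr_mult e)
  also have "\<dots> \<le> ennreal_powr (\<integral>\<^sup>+x. f x \<partial>M) \<theta>1 * ennreal_powr (\<integral>\<^sup>+x. ?k x \<partial>M) (1 - \<theta>1)"
    using \<theta>1 by (intro nn_integral_Hoelder) auto
  also have "ennreal_powr (\<integral>\<^sup>+x. ?k x \<partial>M) (1 - \<theta>1) \<le> ennreal_powr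
      (ennreal_powr (\<integral>\<^sup>+x. g x \<partial>M) \<eta> * ennreal_powr (\<integral>\<^sup>+x. h x \<partial>M) (1 - \<eta>)) (1 - \<theta>1)"
    using \<theta>1 \<eta> by (intro ennreal_powr_mono nn_integral_Hoelder) auto
  also have "\<dots> = ennreal_powr (\<integral>\<^sup>+x. g x \<partial>M) \<theta>2 * ennreal_powr (\<integral>\<^sup>+x. h x \<partial>M) \<theta>3"
    using \<theta>1 by (simp add: ennreal_powr_mult e)
  finally show ?thesis
    by (simp add: mult_left_mono)
qed

text \<open>Jensen's inequality for t^(s+1) and the probability density w / W, where W is the mass
  of w, multiplied by W^(s+1). In this form no normalisation is required and W may be 0 or infinite.
  It is Hoelder's inequality with \<theta> = 1/(s+1).\<close>

lemma nn_integral_Jensen_powr: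
  assumes [measurable]: "w \<in> borel_measurable M" "f \<in> borel_measurable M" and s: "0 < s"
  shows "ennreal_powr (\<integral>\<^sup>+x. w x * f x \<partial>M) (s + 1)
    \<le> ennreal_powr (\<integral>\<^sup>+x. w x \<partial>M) s * (\<integral>\<^sup>+x. w x * ennreal_powr (f x) (s + 1) \<partial>M)"
proof -
  define \<theta> where "\<theta> = 1 / (s + 1)"
  have \<theta>: "0 < \<theta>" "\<theta> < 1" "(s + 1) * \<theta> = 1" "\<theta> * (s + 1) = 1" "(1 - \<theta>) * (s + 1) = s"
    using s by (auto simp: \<theta>_def field_simps)
  have "w x * f x = ennreal_powr (w x * ennreal_powr (f x) (s + 1)) \<theta> * ennreal_powr (w x) (1 - \<theta>)" for x
  proof -
    have "w x = ennreal_powr (w x) \<theta> * ennreal_powr (w x) (1 - \<theta>)"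
      using ennreal_powr_add[of "w x" \<theta> "1 - \<theta>"] by simp
    then show ?thesis
      using \<theta> by (simp add: ennreal_powr_mult mult_ac)
  qed
  then have "(\<integral>\<^sup>+x. w x * f x \<partial>M) \<le> ennreal_powr (\<integral>\<^sup>+x. w x * ennreal_powr (f x) (s + 1) \<partial>M) \<theta> *
      ennreal_powr (\<integral>\<^sup>+x. w x \<partial>M) (1 - \<theta>)"
    using nn_integral_Hoelder[of "\<lambda>x. w x * ennreal_powr (f x) (s + 1)" M w \<theta>] \<theta> by simp
  then have "ennreal_powr (\<integral>\<^sup>+x. w x * f x \<partial>M) (s + 1) \<le> ennreal_powr (ennreal_powr
      (\<integral>\<^sup>+x. w x * ennreal_powr (f x) (s + 1) \<partial>M) \<theta> * ennreal_powr (\<integral>\<^sup>+x. w x \<partial>M) (1 - \<theta>)) (s + 1)"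
    using s by (intro ennreal_powr_mono) auto
  also have "\<dots> = ennreal_powr (\<integral>\<^sup>+x. w x \<partial>M) s * (\<integral>\<^sup>+x. w x * ennreal_powr (f x) (s + 1) \<partial>M)"
    using s by (simp add: ennreal_powr_mult \<theta> mult.commute)
  finally show ?thesis .
qed

subsection \<open>Dual pairs of integral equations\<close>

lemma nn_integral_eq_imp_AE_eq:
  assumes [measurable]: "f \<in> borel_measurable M" "g \<in> borel_measurable M"
    and le: "AE x in M. f x \<le> g x" and int: "(\<integral>\<^sup>+x. g x \<partial>M) \<le> (\<integral>\<^sup>+x. f x \<partial>M)"
    and fin: "(\<integral>\<^sup>+x. f x \<partial>M) < top"
  shows "AE x in M. f x = g x"
proof -
  have "(\<integral>\<^sup>+x. g x - f x \<partial>M) = (\<integral>\<^sup>+x. g x \<partial>M) - (\<integral>\<^sup>+x. f x \<partial>M)"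
    using le fin by (intro nn_integral_diff) (auto simp: less_top)
  also have "\<dots> = 0"
    using int fin by (simp add: diff_eq_0_iff_ennreal)
  finally have "AE x in M. g x - f x = 0"
    by (subst (asm) nn_integral_0_iff_AE) auto
  then show ?thesis
    using le by eventually_elim (auto simp: ennreal_minus_eq_0 antisym)
qed

locale dual_system = pair_sigma_finite M N
  for M :: "'a measure" and N :: "'b measure" +
  fixes G :: "'a \<Rightarrow> 'b \<Rightarrow> ennreal" and u :: "'b \<Rightarrow> ennreal" and v :: "'a \<Rightarrow> ennreal" and p q :: real
  assumes measurable_G [measurable]: "case_prod G \<in> borel_measurable (M \<Otimes>\<^sub>M N)"
    and measurable_u [measurable]: "u \<in> borel_measurable N"
    and measurable_v [measurable]: "v \<in> borel_measurable M"
    and p_pos: "0 < p" and q_pos: "0 < q"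
    and u_eq: "AE y in N. u y = (\<integral>\<^sup>+x. G x y * ennreal_powr (v x) q \<partial>M)"
    and v_eq: "AE x in M. v x = (\<integral>\<^sup>+y. G x y * ennreal_powr (u y) p \<partial>N)"
begin

lemma measurable_G_swap [measurable]: "(\<lambda>(y, x). G x y) \<in> borel_measurable (N \<Otimes>\<^sub>M M)"
  using measurable_compose[OF measurable_pair_swap' measurable_G] by (simp add: split_beta)

text \<open>The two equations are interchangeable, so each result of the locale is also available
  with the roles of \<open>u\<close> and \<open>v\<close> exchanged, through the interpretations
  named \<open>D\<close>.\<close>

lemma dual: "dual_system N M (\<lambda>y x. G x y) v u q p"
proof -
  interpret P: pair_sigma_finite N M ..
  show ?thesis
    using p_pos q_pos u_eq v_eq by unfold_locales (auto simp: measurable_G_swap)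
qed

lemma nn_integral_swap:
  assumes [measurable]: "a \<in> borel_measurable N" "b \<in> borel_measurable M"
  shows "(\<integral>\<^sup>+y. a y * (\<integral>\<^sup>+x. G x y * b x \<partial>M) \<partial>N) = (\<integral>\<^sup>+x. b x * (\<integral>\<^sup>+y. G x y * a y \<partial>N) \<partial>M)"
proof -
  have "(\<integral>\<^sup>+y. a y * (\<integral>\<^sup>+x. G x y * b x \<partial>M) \<partial>N) = (\<integral>\<^sup>+y. (\<integral>\<^sup>+x. a y * (G x y * b x) \<partial>M) \<partial>N)"
    by (intro nn_integral_cong nn_integral_cmult[symmetric]) measurable
  also have "\<dots> = (\<integral>\<^sup>+x. (\<integral>\<^sup>+y. a y * (G x y * b x) \<partial>N) \<partial>M)"
    by (rule Fubini') measurable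
  also have "\<dots> = (\<integral>\<^sup>+x. (\<integral>\<^sup>+y. b x * (G x y * a y) \<partial>N) \<partial>M)"
    by (simp add: mult_ac)
  also have "\<dots> = (\<integral>\<^sup>+x. b x * (\<integral>\<^sup>+y. G x y * a y \<partial>N) \<partial>M)"
    by (intro nn_integral_cong nn_integral_cmult) measurable
  finally show ?thesis .
qed

text \<open>By the first equation the weight G(x,y) v(x)^q has mass u(y) in x, which supplies the
  factor u^s.\<close>

lemma Jensen_u:
  assumes [measurable]: "f \<in> borel_measurable M" and s: "0 < s"
  shows "AE y in N. ennreal_powr (\<integral>\<^sup>+x. G x y * (ennreal_powr (v x) q * f x) \<partial>M) (s + 1)
    \<le> ennreal_powr (u y) s * (\<integral>\<^sup>+x. G x y * (ennreal_powr (v x) q * ennreal_powr (f x) (s + 1)) \<partial>M)"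
  using u_eq AE_space
proof eventually_elim
  case (elim y)
  then show ?case
    using nn_integral_Jensen_powr[of "\<lambda>x. G x y * ennreal_powr (v x) q" M f s] s
    by (simp add: mult.assoc)
qed

text \<open>With exponent p + 1 Jensen's inequality produces the factor u^p, which is just the
  density of the second equation: after exchanging the integrals, the inner one equals v and the
  kernel has disappeared.\<close>

lemma Jensen_integral:
  assumes [measurable]: "f \<in> borel_measurable M"
  shows "(\<integral>\<^sup>+y. ennreal_powr (\<integral>\<^sup>+x. G x y * (ennreal_powr (v x) q * f x) \<partial>M) (p + 1) \<partial>N)
    \<le> (\<integral>\<^sup>+x. ennreal_powr (v x) (q + 1) * ennreal_powr (f x) (p + 1) \<partial>M)"
proof -
  have "(\<integral>\<^sup>+y. ennreal_powr (\<integral>\<^sup>+x. G x y * (ennreal_powr (v x) q * f x) \<partial>M) (p + 1) \<partial>N)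
    \<le> (\<integral>\<^sup>+y. ennreal_powr (u y) p *
        (\<integral>\<^sup>+x. G x y * (ennreal_powr (v x) q * ennreal_powr (f x) (p + 1)) \<partial>M) \<partial>N)"
    using Jensen_u[of f p] p_pos by (intro nn_integral_mono_AE) auto
  also have "\<dots> = (\<integral>\<^sup>+x. (ennreal_powr (v x) q * ennreal_powr (f x) (p + 1)) *
        (\<integral>\<^sup>+y. G x y * ennreal_powr (u y) p \<partial>N) \<partial>M)"
    by (rule nn_integral_swap) measurable
  also have "\<dots> = (\<integral>\<^sup>+x. ennreal_powr (v x) (q + 1) * ennreal_powr (f x) (p + 1) \<partial>M)"
    using v_eq by (intro nn_integral_cong_AE) (auto simp: ennreal_powr_add mult_ac)
  finally show ?thesis .
qed

text \<open>
  For \<open>p * q \<le> 1\<close> a subsolution \<open>(u \<rho>, v \<tau>)\<close> above the solution is a solution: Jensen's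
  inequality, with the weights supplied by the solution itself, bounds each of
  $\int (u\rho)^{p+1}$ and $\int (v\tau)^{q+1}$ by the other one.
\<close>

lemma subsolution_eq:
  assumes pq: "p * q \<le> 1"
    and [measurable]: "\<rho> \<in> borel_measurable N" "\<tau> \<in> borel_measurable M"
    and ge1: "\<And>y. 1 \<le> \<rho> y" "\<And>x. 1 \<le> \<tau> x"
    and \<rho>: "AE y in N. u y * \<rho> y \<le> (\<integral>\<^sup>+x. G x y * ennreal_powr (v x * \<tau> x) q \<partial>M)"
    and \<tau>: "AE x in M. v x * \<tau> x \<le> (\<integral>\<^sup>+y. G x y * ennreal_powr (u y * \<rho> y) p \<partial>N)"
    and fin: "(\<integral>\<^sup>+y. ennreal_powr (u y * \<rho> y) (p + 1) \<partial>N) < top"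
  shows "AE x in M. v x * \<tau> x = (\<integral>\<^sup>+y. G x y * ennreal_powr (u y * \<rho> y) p \<partial>N)"
proof -
  interpret D: dual_system N M "\<lambda>y x. G x y" v u q p
    by (rule dual)
  define I where "I = (\<integral>\<^sup>+y. ennreal_powr (u y * \<rho> y) (p + 1) \<partial>N)"
  define J where "J = (\<integral>\<^sup>+x. ennreal_powr (v x * \<tau> x) (q + 1) \<partial>M)"
  define J' where "J' = (\<integral>\<^sup>+x. ennreal_powr (\<integral>\<^sup>+y. G x y * ennreal_powr (u y * \<rho> y) p \<partial>N) (q + 1) \<partial>M)"
  \<comment> \<open>Each of these is \<open>p * q \<le> 1\<close> rewritten. As
    \<open>\<rho>\<close> and \<open>\<tau>\<close> are at least 1, they permit raising the
    exponents that Jensen's inequality leaves on them to q + 1 and p + 1.\<close>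
  have le: "q * (p + 1) \<le> q + 1" "p * (q + 1) \<le> p + 1"
    using pq by (auto simp: algebra_simps)
  have "I \<le> (\<integral>\<^sup>+y. ennreal_powr (\<integral>\<^sup>+x. G x y * ennreal_powr (v x * \<tau> x) q \<partial>M) (p + 1) \<partial>N)"
    unfolding I_def
    by (rule nn_integral_mono_AE, use \<rho> in eventually_elim) (use p_pos in \<open>auto intro: ennreal_powr_mono\<close>)
  also have "\<dots> \<le> (\<integral>\<^sup>+x. ennreal_powr (v x) (q + 1) * ennreal_powr (\<tau> x) (q * (p + 1)) \<partial>M)"
    using Jensen_integral[of "\<lambda>x. ennreal_powr (\<tau> x) q"] q_pos by (simp add: ennreal_powr_mult)
  also have "\<dots> \<le> J"
    unfolding J_def using le q_pos
    by (intro nn_integral_mono) (auto simp: ennreal_powr_mult intro!: mult_left_mono ennreal_powr_exponent_mono ge1)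
  finally have IJ: "I \<le> J" .
  have "J' \<le> (\<integral>\<^sup>+y. ennreal_powr (u y) (p + 1) * ennreal_powr (\<rho> y) (p * (q + 1)) \<partial>N)"
    unfolding J'_def using D.Jensen_integral[of "\<lambda>x. ennreal_powr (\<rho> x) p"] p_pos
    by (simp add: ennreal_powr_mult)
  also have "\<dots> \<le> I"
    unfolding I_def using le p_pos
    by (intro nn_integral_mono) (auto simp: ennreal_powr_mult intro!: mult_left_mono ennreal_powr_exponent_mono ge1)
  finally have J'I: "J' \<le> I" .
  have JJ': "J \<le> J'"
    unfolding J_def J'_def
    by (rule nn_integral_mono_AE, use \<tau> in eventually_elim) (use q_pos in \<open>auto intro: ennreal_powr_mono\<close>)
  \<comment> \<open>The chain I \<le> J \<le> J' \<le> I closes with I finite, so the integrands of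
    J and J', which are ordered pointwise, agree almost everywhere.\<close>
  have "AE x in M. ennreal_powr (v x * \<tau> x) (q + 1) =
      ennreal_powr (\<integral>\<^sup>+y. G x y * ennreal_powr (u y * \<rho> y) p \<partial>N) (q + 1)"
  proof (rule nn_integral_eq_imp_AE_eq)
    show "AE x in M. ennreal_powr (v x * \<tau> x) (q + 1) \<le>
        ennreal_powr (\<integral>\<^sup>+y. G x y * ennreal_powr (u y * \<rho> y) p \<partial>N) (q + 1)"
      using \<tau> by eventually_elim (use q_pos in \<open>auto intro: ennreal_powr_mono\<close>)
  qed (use IJ J'I JJ' fin in \<open>auto simp: J_def J'_def I_def\<close>)
  then show ?thesis
    using q_pos by (simp add: ennreal_powr_eq_iff)
qed

text \<open>A Schur test with three Hoelder factors: the two parts of the kernel take the exponents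
  1/(p+1) and 1/(q+1), and the rest \<theta>, positive since pq > 1, goes to the mass of v^(q+1) on
  the support of \<open>\<tau>\<close>. Only G1 keeps a function of x attached; it is integrated in
  y by Fubini, while G2 is integrated in x at once.\<close>

lemma Schur_bound:
  assumes pq: "1 < p * q"
    and [measurable]: "case_prod G1 \<in> borel_measurable (M \<Otimes>\<^sub>M N)" "case_prod G2 \<in> borel_measurable (M \<Otimes>\<^sub>M N)"
      "\<tau> \<in> borel_measurable M"
    and le: "AE y in N. AE x in M. G x y \<le> ennreal_powr (G1 x y) (1 / (p + 1)) * ennreal_powr (G2 x y) (1 / (q + 1))"
    and C1: "AE x in M. (\<integral>\<^sup>+y. G1 x y \<partial>N) \<le> C1" and C2: "AE y in N. (\<integral>\<^sup>+x. G2 x y \<partial>M) \<le> C2"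
  shows "(\<integral>\<^sup>+y. ennreal_powr (\<integral>\<^sup>+x. G x y * (ennreal_powr (v x) q * \<tau> x) \<partial>M) (p + 1) \<partial>N)
    \<le> C1 * ennreal_powr C2 ((p + 1) / (q + 1)) *
      ennreal_powr (\<integral>\<^sup>+x. ennreal_powr (v x) (q + 1) * indicator {x. 0 < \<tau> x} x \<partial>M) ((p * q - 1) / (q + 1)) *
      (\<integral>\<^sup>+x. ennreal_powr (v x) (q + 1) * ennreal_powr (\<tau> x) (p + 1) \<partial>M)"
proof -
  interpret D: dual_system N M "\<lambda>y x. G x y" v u q p
    by (rule dual)
  have G12 [measurable]: "(\<lambda>(y, x). G1 x y) \<in> borel_measurable (N \<Otimes>\<^sub>M M)"
    "(\<lambda>(y, x). G2 x y) \<in> borel_measurable (N \<Otimes>\<^sub>M M)"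
    using measurable_compose[OF measurable_pair_swap' assms(2)]
      measurable_compose[OF measurable_pair_swap' assms(3)] by (simp_all add: split_beta)
  define a b \<theta> where "a = 1 / (p + 1)" and "b = 1 / (q + 1)" and "\<theta> = 1 - a - b"
  have ab: "0 < a" "0 < b" "a + b + \<theta> = 1" "(q + 1) * b = 1" "(p + 1) * a = 1" "a * (p + 1) = 1"
    "b * (p + 1) = (p + 1) / (q + 1)"
    using p_pos q_pos by (auto simp: a_def b_def \<theta>_def)
  have "(q + 1) * (a + \<theta>) = (q + 1) * (1 - b)"
    by (simp add: \<theta>_def)
  also have "\<dots> = q"
    using ab(4) by (simp add: algebra_simps)
  finally have ab': "(q + 1) * (a + \<theta>) = q" .
  have "\<theta> * (p + 1) = p + 1 - 1 - b * (p + 1)"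
    using ab(6) by (simp add: \<theta>_def algebra_simps)
  also have "\<dots> = (p * q - 1) / (q + 1)"
    using q_pos unfolding ab(7) by (simp add: field_simps)
  finally have \<theta>: "\<theta> * (p + 1) = (p * q - 1) / (q + 1)" .
  have "0 < \<theta> * (p + 1)"
    unfolding \<theta> using pq q_pos by simp
  then have "0 < \<theta>"
    using p_pos by (simp add: zero_less_mult_iff)
  let ?V = "\<lambda>x. ennreal_powr (v x) (q + 1)"
  define m where "m = (\<integral>\<^sup>+x. ?V x * indicator {x. 0 < \<tau> x} x \<partial>M)"
  let ?H = "\<lambda>x. ?V x * ennreal_powr (\<tau> x) (p + 1)"
  have "AE y in N. ennreal_powr (\<integral>\<^sup>+x. G x y * (ennreal_powr (v x) q * \<tau> x) \<partial>M) (p + 1)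
      \<le> (ennreal_powr C2 ((p + 1) / (q + 1)) * ennreal_powr m ((p * q - 1) / (q + 1))) *
        (\<integral>\<^sup>+x. G1 x y * ?H x \<partial>M)"
    using le C2 AE_space
  proof eventually_elim
    case (elim y)
    note [measurable] = elim(3)
    have "(\<integral>\<^sup>+x. G x y * (ennreal_powr (v x) q * \<tau> x) \<partial>M) \<le>
        (\<integral>\<^sup>+x. ennreal_powr (G1 x y * ?H x) a * (ennreal_powr (G2 x y) b *
          ennreal_powr (?V x * indicator {x. 0 < \<tau> x} x) \<theta>) \<partial>M)"
    proof (rule nn_integral_mono_AE, use elim(1) in eventually_elim)
      case (elim x)
      \<comment> \<open>The power v^q is split by (q+1)(a + \<theta>) = q. The indicator costs
        nothing, since both sides vanish where \<tau> = 0.\<close>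
      have "ennreal_powr (v x) q * \<tau> x = (ennreal_powr (v x) ((q + 1) * a) * ennreal_powr (v x) ((q + 1) * \<theta>)) * \<tau> x"
        using ab' by (simp flip: ennreal_powr_add distrib_left)
      also have "\<dots> = ennreal_powr (?H x) a * ennreal_powr (?V x * indicator {x. 0 < \<tau> x} x) \<theta>"
        using ab(1,5) \<open>0 < \<theta>\<close> by (cases "\<tau> x = 0") (simp_all add: ennreal_powr_mult mult_ac zero_less_iff_neq_zero)
      finally have *: "ennreal_powr (v x) q * \<tau> x = \<dots>" .
      have "G x y * (ennreal_powr (v x) q * \<tau> x) \<le>
          ennreal_powr (G1 x y) a * ennreal_powr (G2 x y) b * (ennreal_powr (v x) q * \<tau> x)"
        using elim by (intro mult_right_mono) (auto simp: a_def b_def)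
      also have "\<dots> = ennreal_powr (G1 x y * ?H x) a * (ennreal_powr (G2 x y) b *
          ennreal_powr (?V x * indicator {x. 0 < \<tau> x} x) \<theta>)"
        unfolding * ennreal_powr_mult[OF ab(1), of "G1 x y"] by (simp only: mult_ac)
      finally show ?case .
    qed
    also have "\<dots> \<le> ennreal_powr (\<integral>\<^sup>+x. G1 x y * ?H x \<partial>M) a *
        (ennreal_powr (\<integral>\<^sup>+x. G2 x y \<partial>M) b * ennreal_powr m \<theta>)"
      unfolding m_def using ab \<open>0 < \<theta>\<close> by (intro nn_integral_Hoelder3) auto
    also have "\<dots> \<le> ennreal_powr (\<integral>\<^sup>+x. G1 x y * ?H x \<partial>M) a * (ennreal_powr C2 b * ennreal_powr m \<theta>)"
      using elim ab by (intro mult_left_mono mult_right_mono ennreal_powr_mono) auto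
    finally have "ennreal_powr (\<integral>\<^sup>+x. G x y * (ennreal_powr (v x) q * \<tau> x) \<partial>M) (p + 1) \<le>
        ennreal_powr (ennreal_powr (\<integral>\<^sup>+x. G1 x y * ?H x \<partial>M) a * (ennreal_powr C2 b * ennreal_powr m \<theta>)) (p + 1)"
      using p_pos by (intro ennreal_powr_mono) auto
    also have "\<dots> = (ennreal_powr C2 ((p + 1) / (q + 1)) * ennreal_powr m ((p * q - 1) / (q + 1))) *
        (\<integral>\<^sup>+x. G1 x y * ?H x \<partial>M)"
      using p_pos ab(6,7) \<theta> by (simp add: ennreal_powr_mult mult_ac)
    finally show ?case .
  qed
  then have A: "(\<integral>\<^sup>+y. ennreal_powr (\<integral>\<^sup>+x. G x y * (ennreal_powr (v x) q * \<tau> x) \<partial>M) (p + 1) \<partial>N) \<le>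
      (\<integral>\<^sup>+y. (ennreal_powr C2 ((p + 1) / (q + 1)) * ennreal_powr m ((p * q - 1) / (q + 1))) *
        (\<integral>\<^sup>+x. G1 x y * ?H x \<partial>M) \<partial>N)"
    by (rule nn_integral_mono_AE)
  have A': "(\<integral>\<^sup>+y. (ennreal_powr C2 ((p + 1) / (q + 1)) * ennreal_powr m ((p * q - 1) / (q + 1))) *
        (\<integral>\<^sup>+x. G1 x y * ?H x \<partial>M) \<partial>N) = (ennreal_powr C2 ((p + 1) / (q + 1)) * ennreal_powr m ((p * q - 1) / (q + 1))) *
        (\<integral>\<^sup>+y. (\<integral>\<^sup>+x. G1 x y * ?H x \<partial>M) \<partial>N)"
    by (rule nn_integral_cmult) measurable
  have "(\<integral>\<^sup>+y. (\<integral>\<^sup>+x. G1 x y * ?H x \<partial>M) \<partial>N) = (\<integral>\<^sup>+x. (\<integral>\<^sup>+y. G1 x y * ?H x \<partial>N) \<partial>M)"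
    by (rule Fubini') measurable
  also have "\<dots> = (\<integral>\<^sup>+x. (\<integral>\<^sup>+y. G1 x y \<partial>N) * ?H x \<partial>M)"
    by (intro nn_integral_cong nn_integral_multc) measurable
  also have "\<dots> \<le> (\<integral>\<^sup>+x. C1 * ?H x \<partial>M)"
    by (rule nn_integral_mono_AE, use C1 in eventually_elim) (auto intro: mult_right_mono)
  also have "\<dots> = C1 * (\<integral>\<^sup>+x. ?H x \<partial>M)"
    by (rule nn_integral_cmult) measurable
  finally have B: "(\<integral>\<^sup>+y. (\<integral>\<^sup>+x. G1 x y * ?H x \<partial>M) \<partial>N) \<le> C1 * (\<integral>\<^sup>+x. ?H x \<partial>M)" .
  show ?thesis
    using order_trans[OF A[unfolded A'] mult_left_mono[OF B]] by (simp add: m_def mult_ac)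
qed

text \<open>
  For \<open>p * q > 1\<close> the Schur bound gains integrability, hence a small factor when the support of
  \<open>\<tau>\<close> carries little mass, while Jensen's inequality returns from \<open>\<tau>\<close> to \<open>\<rho>\<close> in the same
  exponent. This avoids a bound for the second equation and any case distinction on \<open>p\<close> and \<open>q\<close>.
\<close>

lemma small_support_imp_zero:
  fixes C1 C2 c :: real
  assumes pq: "1 < p * q"
    and meas: "case_prod G1 \<in> borel_measurable (M \<Otimes>\<^sub>M N)" "case_prod G2 \<in> borel_measurable (M \<Otimes>\<^sub>M N)"
    and le: "AE y in N. AE x in M. G x y \<le> ennreal_powr (G1 x y) (1 / (p + 1)) * ennreal_powr (G2 x y) (1 / (q + 1))"
    and C1: "AE x in M. (\<integral>\<^sup>+y. G1 x y \<partial>N) \<le> ennreal C1" and C2: "AE y in N. (\<integral>\<^sup>+x. G2 x y \<partial>M) \<le> ennreal C2"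
    and fin: "(\<integral>\<^sup>+y. ennreal_powr (u y) (p + 1) \<partial>N) < top"
  obtains \<eta> where "0 < \<eta>"
    "\<And>\<rho> \<tau>. \<rho> \<in> borel_measurable N \<Longrightarrow> \<tau> \<in> borel_measurable M \<Longrightarrow> (\<And>y. \<rho> y \<le> 1) \<Longrightarrow>
      AE y in N. u y * \<rho> y \<le> ennreal c * (\<integral>\<^sup>+x. G x y * (ennreal_powr (v x) q * \<tau> x) \<partial>M) \<Longrightarrow>
      AE x in M. v x * \<tau> x \<le> ennreal c * (\<integral>\<^sup>+y. G x y * (ennreal_powr (u y) p * \<rho> y) \<partial>N) \<Longrightarrow>
      (\<integral>\<^sup>+x. ennreal_powr (v x) (q + 1) * indicator {x. 0 < \<tau> x} x \<partial>M) < ennreal \<eta> \<Longrightarrow>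
      AE y in N. u y * \<rho> y = 0"
proof -
  interpret D: dual_system N M "\<lambda>y x. G x y" v u q p
    by (rule dual)
  define e where "e = (p * q - 1) / (q + 1)"
  define c' where "c' = ennreal_powr (ennreal c) (p + 1)"
  define K where "K = c' * (C1 * ennreal_powr C2 ((p + 1) / (q + 1))) * c'"
  have e: "0 < e"
    using pq q_pos by (simp add: e_def)
  have "K < top"
    by (simp add: K_def c'_def ennreal_mult_less_top)
  then obtain k where k: "K = ennreal k" "0 \<le> k"
    by (cases K) auto
  \<comment> \<open>Chosen so that K \<eta>^e = k/(k+1) < 1; the loop from \<open>\<rho>\<close> to
    \<open>\<tau>\<close> and back is then a strict contraction of the finite quantity
    \<open>I\<close>.\<close>
  define \<eta> where "\<eta> = (1 / (k + 1)) powr (1 / e)"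
  have \<eta>: "0 < \<eta>" "ennreal_powr (ennreal \<eta>) e = ennreal (1 / (k + 1))"
    using k e by (auto simp: \<eta>_def ennreal_powr_ennreal powr_powr)
  show thesis
  proof (rule that[OF \<eta>(1)])
    fix \<rho> \<tau>
    assume [measurable]: "\<rho> \<in> borel_measurable N" "\<tau> \<in> borel_measurable M"
      and \<rho>1: "\<And>y. \<rho> y \<le> 1"
      and \<rho>: "AE y in N. u y * \<rho> y \<le> ennreal c * (\<integral>\<^sup>+x. G x y * (ennreal_powr (v x) q * \<tau> x) \<partial>M)"
      and \<tau>: "AE x in M. v x * \<tau> x \<le> ennreal c * (\<integral>\<^sup>+y. G x y * (ennreal_powr (u y) p * \<rho> y) \<partial>N)"
      and small: "(\<integral>\<^sup>+x. ennreal_powr (v x) (q + 1) * indicator {x. 0 < \<tau> x} x \<partial>M) < ennreal \<eta>" (is "?m < _")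
    define I where "I = (\<integral>\<^sup>+y. ennreal_powr (u y * \<rho> y) (p + 1) \<partial>N)"
    define J where "J = (\<integral>\<^sup>+x. ennreal_powr (v x) (q + 1) * ennreal_powr (\<tau> x) (p + 1) \<partial>M)"
    let ?Z = "\<lambda>x. \<integral>\<^sup>+y. G x y * (ennreal_powr (u y) p * ennreal_powr (\<rho> y) (p + 1)) \<partial>N"
    have "I \<le> (\<integral>\<^sup>+y. ennreal_powr (u y) (p + 1) \<partial>N)"
      unfolding I_def using p_pos \<rho>1
      by (intro nn_integral_mono ennreal_powr_mono) (use mult_left_mono[OF \<rho>1] in fastforce)+
    with fin have I: "I < top" by (simp add: le_less_trans)
    have "J \<le> (\<integral>\<^sup>+x. c' * (ennreal_powr (v x) q * ?Z x) \<partial>M)"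
      unfolding J_def
    proof (rule nn_integral_mono_AE, use \<tau> D.Jensen_u[OF \<open>\<rho> \<in> _\<close> p_pos] in eventually_elim)
      case (elim x)
      \<comment> \<open>Splitting off v^(q-p) makes the power p + 1 of the defect v \<tau> appear.
        Jensen's inequality returns the factor v^p, which restores v^q. The exponent q - p may be
        negative: the addition law for \<open>ennreal_powr\<close> holds for all exponents.\<close>
      have "ennreal_powr (v x) (q + 1) * ennreal_powr (\<tau> x) (p + 1) =
          ennreal_powr (v x) (q - p) * ennreal_powr (v x * \<tau> x) (p + 1)"
        using p_pos ennreal_powr_add[of "v x" "q - p" "p + 1"] by (simp add: ennreal_powr_mult mult_ac)
      also have "\<dots> \<le> ennreal_powr (v x) (q - p) *
          ennreal_powr (ennreal c * (\<integral>\<^sup>+y. G x y * (ennreal_powr (u y) p * \<rho> y) \<partial>N)) (p + 1)"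
        using elim p_pos by (intro mult_left_mono ennreal_powr_mono) auto
      also have "\<dots> = ennreal_powr (v x) (q - p) * c' *
          ennreal_powr (\<integral>\<^sup>+y. G x y * (ennreal_powr (u y) p * \<rho> y) \<partial>N) (p + 1)"
        using p_pos by (simp add: ennreal_powr_mult c'_def mult_ac)
      also have "\<dots> \<le> ennreal_powr (v x) (q - p) * c' * (ennreal_powr (v x) p * ?Z x)"
        using elim by (intro mult_left_mono) auto
      also have "\<dots> = c' * (ennreal_powr (v x) q * ?Z x)"
        using ennreal_powr_add[of "v x" "q - p" p] by (simp add: mult_ac)
      finally show ?case .
    qed
    also have "\<dots> = c' * (\<integral>\<^sup>+x. ennreal_powr (v x) q * ?Z x \<partial>M)"
      by (rule nn_integral_cmult) measurable
    also have "(\<integral>\<^sup>+x. ennreal_powr (v x) q * ?Z x \<partial>M) = (\<integral>\<^sup>+y. (ennreal_powr (u y) p * ennreal_powr (\<rho> y) (p + 1)) *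
        (\<integral>\<^sup>+x. G x y * ennreal_powr (v x) q \<partial>M) \<partial>N)"
      by (rule nn_integral_swap[symmetric]) measurable
    also have "\<dots> = I"
      unfolding I_def using u_eq p_pos
      by (intro nn_integral_cong_AE) (auto simp: ennreal_powr_mult ennreal_powr_add[of _ p 1] mult_ac)
    finally have J: "J \<le> c' * I" .
    have "I \<le> (\<integral>\<^sup>+y. c' * ennreal_powr (\<integral>\<^sup>+x. G x y * (ennreal_powr (v x) q * \<tau> x) \<partial>M) (p + 1) \<partial>N)"
      unfolding I_def
    proof (rule nn_integral_mono_AE, use \<rho> in eventually_elim)
      case (elim y)
      then have "ennreal_powr (u y * \<rho> y) (p + 1) \<le>
          ennreal_powr (ennreal c * (\<integral>\<^sup>+x. G x y * (ennreal_powr (v x) q * \<tau> x) \<partial>M)) (p + 1)"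
        using p_pos by (intro ennreal_powr_mono) auto
      also have "\<dots> = c' * ennreal_powr (\<integral>\<^sup>+x. G x y * (ennreal_powr (v x) q * \<tau> x) \<partial>M) (p + 1)"
        using p_pos by (simp add: ennreal_powr_mult c'_def)
      finally show ?case .
    qed
    also have "\<dots> = c' * (\<integral>\<^sup>+y. ennreal_powr (\<integral>\<^sup>+x. G x y * (ennreal_powr (v x) q * \<tau> x) \<partial>M) (p + 1) \<partial>N)"
      by (rule nn_integral_cmult) measurable
    also have "\<dots> \<le> c' * (C1 * ennreal_powr C2 ((p + 1) / (q + 1)) * ennreal_powr ?m e * J)"
      using Schur_bound[OF pq meas \<open>\<tau> \<in> _\<close> le C1 C2] by (intro mult_left_mono) (simp_all add: e_def J_def)
    also have "\<dots> \<le> c' * (C1 * ennreal_powr C2 ((p + 1) / (q + 1)) * ennreal_powr (ennreal \<eta>) e * (c' * I))"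
      using J small e by (intro mult_left_mono mult_mono ennreal_powr_mono) auto
    also have "\<dots> = K * ennreal (1 / (k + 1)) * I"
      unfolding K_def \<eta>(2) by (simp only: mult_ac)
    also have "\<dots> = ennreal (k / (k + 1)) * I"
      using k by (simp flip: ennreal_mult)
    finally have le: "I \<le> ennreal (k / (k + 1)) * I" .
    have "I = 0"
    proof (cases I)
      case (real i)
      with le k have "i \<le> k / (k + 1) * i"
        by (simp flip: ennreal_mult)
      with k real show ?thesis by (simp add: field_simps)
    qed (use I in simp)
    then have "AE y in N. ennreal_powr (u y * \<rho> y) (p + 1) = 0"
      unfolding I_def by (subst (asm) nn_integral_0_iff_AE) auto
    then show "AE y in N. u y * \<rho> y = 0"
      by simp
  qed
qed

end

subsection \<open>Power weights against measures of polynomial growth\<close>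

lemma powr_le_of_ratio:
  fixes x y a :: real
  assumes "0 < y" "y / 2 \<le> x" "x \<le> 2 * y"
  shows "x powr a \<le> 2 powr \<bar>a\<bar> * y powr a"
proof -
  have x: "0 < x" and r: "1 / 2 \<le> x / y" "x / y \<le> 2"
    using assms by (auto simp: field_simps)
  have "\<bar>ln (x / y)\<bar> \<le> ln 2"
  proof -
    have "ln (1 / 2) \<le> ln (x / y)" "ln (x / y) \<le> ln 2"
      using r x assms by (subst ln_le_cancel_iff; simp)+
    then show ?thesis by (auto simp: ln_div)
  qed
  then have "a * ln (x / y) \<le> \<bar>a\<bar> * ln 2"
    by (metis abs_ge_zero abs_le_D1 abs_mult mult_left_mono order_trans abs_ge_self)
  then have "(x / y) powr a \<le> 2 powr \<bar>a\<bar>"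
    using x assms by (simp add: powr_def)
  then show ?thesis
    using x assms by (simp add: powr_divide field_simps)
qed

lemma powr_prod4:
  fixes A B C D :: real
  assumes "0 < A" "0 < B" "0 < C" "0 < D"
  shows "(A powr a * (B powr b * (C powr c * D powr d))) powr s * (A powr a' * (B powr b' * (C powr c' * D powr d'))) powr r
    = A powr (a * s + a' * r) * (B powr (b * s + b' * r) * (C powr (c * s + c' * r) * D powr (d * s + d' * r)))"
  using assms by (simp add: powr_mult powr_powr powr_add mult_ac)

lemma dyadic_scale:
  fixes t :: real
  assumes "1 \<le> t"
  obtains k :: nat where "2 ^ k \<le> t" "t \<le> 2 ^ Suc k"
proof -
  define k where "k = nat \<lfloor>log 2 t\<rfloor>"
  have "0 \<le> log 2 t"
    using assms by simp
  then have k: "real k \<le> log 2 t" "log 2 t \<le> real (Suc k)"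
    unfolding k_def by linarith+
  have "2 powr real k \<le> 2 powr log 2 t" "2 powr log 2 t \<le> 2 powr real (Suc k)"
    using k by (simp_all only: powr_le_cancel_iff)
  then show thesis
    using assms that[of k] by (simp add: powr_realpow del: power_Suc of_nat_Suc)
qed

text \<open>Sum of the geometric series over dyadic shells shrinking to the singularity: 2^|a| is
  lost by freezing the power on a shell, 2^(a-D) is the ratio.\<close>

definition near_const :: "real \<Rightarrow> real \<Rightarrow> real" where
  "near_const a D = 2 powr \<bar>a\<bar> / (1 - 2 powr (a - D))"

text \<open>The analogue for shells growing to infinity. The extra 2^D arises because each shell is
  measured by the ball of its outer radius, twice the inner one.\<close>

definition far_const :: "real \<Rightarrow> real \<Rightarrow> real" where
  "far_const a D = 2 powr (\<bar>a\<bar> + D) / (1 - 2 powr (D - a))"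

lemma near_const_nonneg: "a < D \<Longrightarrow> 0 \<le> near_const a D"
  unfolding near_const_def using powr_less_mono[of "a - D" 0 2] by simp

lemma far_const_nonneg: "D < a \<Longrightarrow> 0 \<le> far_const a D"
  unfolding far_const_def using powr_less_mono[of "D - a" 0 2] by simp

lemma le_suminf_ennreal: "f k \<le> suminf f" for f :: "nat \<Rightarrow> ennreal"
  using sum_le_suminf[of f "{k}"] by simp

lemma suminf_geometric_ennreal:
  fixes c :: real
  assumes "0 \<le> c" "e < 0"
  shows "(\<Sum>k. ennreal (c * (2 powr e) ^ k)) = ennreal (c / (1 - 2 powr e))"
proof -
  have "2 powr e < 1"
    using powr_less_mono[of e 0 2] assms by simp
  then have "(\<lambda>k. c * (2 powr e) ^ k) sums (c * (1 / (1 - 2 powr e)))"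
    by (intro sums_mult geometric_sums) simp
  then show ?thesis
    using assms by (intro suminf_ennreal_eq) auto
qed

text \<open>Dyadic decomposition, with the sublevel sets of \<open>g\<close> in the role of balls.
  The zero set of \<open>g\<close> has to be excluded from the growth condition and from the
  integrand alike, because 0 \<open>powr\<close> anything is 0 and says nothing about the
  singularity.\<close>

lemma nn_integral_powr_near:
  fixes g :: "'a \<Rightarrow> real"
  assumes [measurable]: "g \<in> borel_measurable M" and a: "a < D" and "0 \<le> C" "0 < r"
    and growth: "\<And>s. 0 < s \<Longrightarrow> s \<le> r \<Longrightarrow> emeasure M {x\<in>space M. 0 < g x \<and> g x \<le> s} \<le> ennreal (C * s powr D)"
  shows "(\<integral>\<^sup>+x. ennreal (g x powr - a) * indicator {x. 0 < g x \<and> g x \<le> r} x \<partial>M)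
    \<le> ennreal (near_const a D * C * r powr (D - a))"
proof -
  define s where "s k = r / 2 ^ k" for k :: nat
  have s: "0 < s k" "s k \<le> r" for k
    using \<open>0 < r\<close> by (auto simp: s_def field_simps self_le_power)
  let ?E = "\<lambda>k. {x\<in>space M. 0 < g x \<and> g x \<le> s k}"
  let ?t = "\<lambda>k x. ennreal (2 powr \<bar>a\<bar> * s k powr - a) * indicator (?E k) x"
  have "(\<integral>\<^sup>+x. ennreal (g x powr - a) * indicator {x. 0 < g x \<and> g x \<le> r} x \<partial>M) \<le> (\<integral>\<^sup>+x. (\<Sum>k. ?t k x) \<partial>M)"
  proof (rule nn_integral_mono)
    fix x assume x: "x \<in> space M"
    show "ennreal (g x powr - a) * indicator {x. 0 < g x \<and> g x \<le> r} x \<le> (\<Sum>k. ?t k x)"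
    proof (cases "0 < g x \<and> g x \<le> r")
      case True
      then obtain k where "2 ^ k \<le> r / g x" "r / g x \<le> 2 ^ Suc k"
        using dyadic_scale[of "r / g x"] by auto
      then have k: "g x \<le> s k" "s k / 2 \<le> g x"
        using True by (auto simp: s_def field_simps)
      have "g x powr - a \<le> 2 powr \<bar>a\<bar> * s k powr - a"
        using powr_le_of_ratio[of "s k" "g x" "- a"] s(1)[of k] k by simp
      then have "ennreal (g x powr - a) * indicator {x. 0 < g x \<and> g x \<le> r} x \<le> ?t k x"
        using True k x by (auto intro: ennreal_leI)
      also have "\<dots> \<le> (\<Sum>k. ?t k x)"
        by (rule le_suminf_ennreal)
      finally show ?thesis .
    qed simp
  qed
  also have "\<dots> = (\<Sum>k. ennreal (2 powr \<bar>a\<bar> * s k powr - a) * emeasure M (?E k))"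
    by (subst nn_integral_suminf) (auto simp: nn_integral_cmult_indicator)
  also have "\<dots> \<le> (\<Sum>k. ennreal (2 powr \<bar>a\<bar> * s k powr - a) * ennreal (C * s k powr D))"
    using growth s by (intro suminf_le mult_left_mono) auto
  also have "\<dots> = (\<Sum>k. ennreal (2 powr \<bar>a\<bar> * C * r powr (D - a) * (2 powr (a - D)) ^ k))"
  proof (rule arg_cong[where f=suminf], rule ext)
    fix k
    have "s k powr - a * s k powr D = s k powr (D - a)"
      by (simp flip: powr_add)
    also have "\<dots> = r powr (D - a) * (2 powr (a - D)) ^ k"
      using \<open>0 < r\<close> by (simp add: s_def powr_divide powr_diff powr_power power_divide flip: powr_realpow)
        (simp add: powr_powr mult.commute)
    finally show "ennreal (2 powr \<bar>a\<bar> * s k powr - a) * ennreal (C * s k powr D) =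
        ennreal (2 powr \<bar>a\<bar> * C * r powr (D - a) * (2 powr (a - D)) ^ k)"
      using \<open>0 \<le> C\<close> by (simp flip: ennreal_mult add: mult_ac)
  qed
  also have "\<dots> = ennreal (near_const a D * C * r powr (D - a))"
    using a \<open>0 \<le> C\<close> by (subst suminf_geometric_ennreal) (auto simp: near_const_def mult_ac)
  finally show ?thesis .
qed

lemma nn_integral_powr_far:
  fixes g :: "'a \<Rightarrow> real"
  assumes [measurable]: "g \<in> borel_measurable M" and a: "D < a" and "0 \<le> C" "0 < r"
    and growth: "\<And>s. r \<le> s \<Longrightarrow> emeasure M {x\<in>space M. 0 < g x \<and> g x \<le> s} \<le> ennreal (C * s powr D)"
  shows "(\<integral>\<^sup>+x. ennreal (g x powr - a) * indicator {x. r \<le> g x} x \<partial>M)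
    \<le> ennreal (far_const a D * C * r powr (D - a))"
proof -
  define s where "s k = r * 2 ^ k" for k :: nat
  have s: "0 < s k" "r \<le> s k" "s (Suc k) = 2 * s k" for k
    using \<open>0 < r\<close> by (auto simp: s_def field_simps)
  let ?E = "\<lambda>k. {x\<in>space M. 0 < g x \<and> g x \<le> s (Suc k)}"
  let ?t = "\<lambda>k x. ennreal (2 powr \<bar>a\<bar> * s k powr - a) * indicator (?E k) x"
  have "(\<integral>\<^sup>+x. ennreal (g x powr - a) * indicator {x. r \<le> g x} x \<partial>M) \<le> (\<integral>\<^sup>+x. (\<Sum>k. ?t k x) \<partial>M)"
  proof (rule nn_integral_mono)
    fix x assume x: "x \<in> space M"
    show "ennreal (g x powr - a) * indicator {x. r \<le> g x} x \<le> (\<Sum>k. ?t k x)"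
    proof (cases "r \<le> g x")
      case True
      then obtain k where "2 ^ k \<le> g x / r" "g x / r \<le> 2 ^ Suc k"
        using dyadic_scale[of "g x / r"] \<open>0 < r\<close> by auto
      then have k: "s k \<le> g x" "g x \<le> 2 * s k"
        using \<open>0 < r\<close> by (auto simp: s_def field_simps)
      have "g x powr - a \<le> 2 powr \<bar>a\<bar> * s k powr - a"
        using powr_le_of_ratio[of "s k" "g x" "- a"] s(1)[of k] k by simp
      then have "ennreal (g x powr - a) * indicator {x. r \<le> g x} x \<le> ?t k x"
        using True \<open>0 < r\<close> k x s(3)[of k] by (auto intro: ennreal_leI)
      also have "\<dots> \<le> (\<Sum>k. ?t k x)"
        by (rule le_suminf_ennreal)
      finally show ?thesis .
    qed simp
  qed
  also have "\<dots> = (\<Sum>k. ennreal (2 powr \<bar>a\<bar> * s k powr - a) * emeasure M (?E k))"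
    by (subst nn_integral_suminf) (auto simp: nn_integral_cmult_indicator)
  also have "\<dots> \<le> (\<Sum>k. ennreal (2 powr \<bar>a\<bar> * s k powr - a) * ennreal (C * s (Suc k) powr D))"
    by (intro suminf_le mult_left_mono growth s) auto
  also have "\<dots> = (\<Sum>k. ennreal (2 powr (\<bar>a\<bar> + D) * C * r powr (D - a) * (2 powr (D - a)) ^ k))"
  proof (rule arg_cong[where f=suminf], rule ext)
    fix k
    have "s k powr - a * s (Suc k) powr D = 2 powr D * s k powr (D - a)"
      using s(1)[of k] by (simp add: s(3) powr_mult flip: powr_add)
    also have "s k powr (D - a) = r powr (D - a) * (2 powr (D - a)) ^ k"
      using \<open>0 < r\<close> by (simp add: s_def powr_mult powr_power flip: powr_realpow)
        (simp add: powr_powr mult.commute)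
    finally have *: "s k powr - a * s (Suc k) powr D = 2 powr D * (r powr (D - a) * (2 powr (D - a)) ^ k)" .
    have "ennreal (2 powr \<bar>a\<bar> * s k powr - a) * ennreal (C * s (Suc k) powr D) =
        ennreal (2 powr \<bar>a\<bar> * C * (s k powr - a * s (Suc k) powr D))"
      using \<open>0 \<le> C\<close> by (simp flip: ennreal_mult add: mult_ac)
    then show "ennreal (2 powr \<bar>a\<bar> * s k powr - a) * ennreal (C * s (Suc k) powr D) =
        ennreal (2 powr (\<bar>a\<bar> + D) * C * r powr (D - a) * (2 powr (D - a)) ^ k)"
      unfolding * by (simp add: powr_add mult_ac)
  qed
  also have "\<dots> = ennreal (far_const a D * C * r powr (D - a))"
    using a \<open>0 \<le> C\<close> by (subst suminf_geometric_ennreal) (auto simp: far_const_def mult_ac)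
  finally show ?thesis .
qed

text \<open>The summands belong to r \<le> R/2, to r \<ge> 2R and to the region in between. The
  powers of 2 and 3 come from the radii R/2, 2R and 3R, the last one being the largest distance to
  the second centre in the middle region.\<close>

definition two_centre_const :: "real \<Rightarrow> real \<Rightarrow> real \<Rightarrow> real \<Rightarrow> real" where
  "two_centre_const a b c D = near_const a D * 2 powr (a + b - D)
     + 2 powr b * far_const (a + b) D * 2 powr (D - a - b)
     + 2 powr \<bar>a\<bar> * near_const c D * 3 powr (D - c)"

lemma two_centre_const_nonneg:
  "a < D \<Longrightarrow> D < a + b \<Longrightarrow> c < D \<Longrightarrow> 0 \<le> two_centre_const a b c D"
  by (simp add: two_centre_const_def near_const_nonneg far_const_nonneg)

text \<open>
  The model case is \<open>r x = norm x\<close>, \<open>d x = dist x z\<close> and \<open>k x = dist x z powr - b\<close> with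
  \<open>norm z = R\<close>; there \<open>c = b\<close>.
\<close>

lemma nn_integral_two_centres:
  fixes r d k :: "'a \<Rightarrow> real"
  assumes [measurable]: "r \<in> borel_measurable M" "d \<in> borel_measurable M" "k \<in> borel_measurable M"
    and ab: "a < D" "D < a + b" "c < D" and "0 \<le> C" "0 < R"
    and growth: "\<And>s. 0 < s \<Longrightarrow> emeasure M {x\<in>space M. 0 < r x \<and> r x \<le> s} \<le> ennreal (C * s powr D)"
      "\<And>s. 0 < s \<Longrightarrow> emeasure M {x\<in>space M. 0 < d x \<and> d x \<le> s} \<le> ennreal (C * s powr D)"
    and pos: "AE x in M. 0 < r x" "AE x in M. 0 < d x"
    and near: "\<And>x. 0 < r x \<Longrightarrow> r x \<le> R / 2 \<Longrightarrow> k x \<le> (R / 2) powr - b"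
    and far: "\<And>x. 2 * R \<le> r x \<Longrightarrow> k x \<le> (r x / 2) powr - b"
    and mid: "\<And>x. R / 2 \<le> r x \<Longrightarrow> r x \<le> 2 * R \<Longrightarrow> 0 < d x \<Longrightarrow> d x \<le> 3 * R \<and> k x \<le> R powr (c - b) * d x powr - c"
  shows "(\<integral>\<^sup>+x. ennreal (r x powr - a * k x) \<partial>M) \<le> ennreal (two_centre_const a b c D * C * R powr (D - a - b))"
proof -
  let ?N = "\<lambda>x. ennreal (r x powr - a) * indicator {x. 0 < r x \<and> r x \<le> R / 2} x"
  let ?F = "\<lambda>x. ennreal (r x powr - (a + b)) * indicator {x. 2 * R \<le> r x} x"
  let ?D = "\<lambda>x. ennreal (d x powr - c) * indicator {x. 0 < d x \<and> d x \<le> 3 * R} x"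
  have "(\<integral>\<^sup>+x. ennreal (r x powr - a * k x) \<partial>M) \<le>
    (\<integral>\<^sup>+x. ennreal ((R / 2) powr - b) * ?N x + (ennreal (2 powr b) * ?F x +
      ennreal (2 powr \<bar>a\<bar> * R powr (c - b - a)) * ?D x) \<partial>M)"
  proof (rule nn_integral_mono_AE, use pos in eventually_elim)
    case (elim x)
    consider "r x \<le> R / 2" | "2 * R \<le> r x" | "R / 2 \<le> r x" "r x \<le> 2 * R"
      by linarith
    then show ?case
    proof cases
      case 1
      have "ennreal (r x powr - a * k x) \<le> ennreal ((R / 2) powr - b) * ?N x"
        using near[OF elim(1) 1] 1 elim
        by (auto simp: mult.commute[of "r x powr - a"] intro!: ennreal_leI mult_right_mono simp flip: ennreal_mult)
      then show ?thesis by (simp add: add_increasing2)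
    next
      case 2
      have "r x powr - a * k x \<le> r x powr - a * (r x / 2) powr - b"
        using far[OF 2] by (intro mult_left_mono) auto
      also have "\<dots> = 2 powr b * r x powr - (a + b)"
      proof -
        have "(r x / 2) powr - b = 2 powr b * r x powr - b"
          using elim by (simp add: powr_divide powr_minus field_simps)
        then show ?thesis by (simp add: mult_ac flip: powr_add)
      qed
      finally have "ennreal (r x powr - a * k x) \<le> ennreal (2 powr b) * ?F x"
        using 2 by (auto intro!: ennreal_leI simp flip: ennreal_mult)
      then show ?thesis by (simp add: add_increasing2 add_increasing)
    next
      case 3
      note m = mid[OF 3 elim(2)]
      have "r x powr - a * k x \<le> r x powr - a * (R powr (c - b) * d x powr - c)"
        using m by (intro mult_left_mono) auto
      also have "\<dots> \<le> (2 powr \<bar>a\<bar> * R powr - a) * (R powr (c - b) * d x powr - c)"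
        using powr_le_of_ratio[of R "r x" "- a"] 3 \<open>0 < R\<close> by (intro mult_right_mono) auto
      also have "\<dots> = (2 powr \<bar>a\<bar> * R powr (c - b - a)) * d x powr - c"
        by (simp add: powr_diff powr_minus divide_simps)
      finally have "ennreal (r x powr - a * k x) \<le> ennreal (2 powr \<bar>a\<bar> * R powr (c - b - a)) * ?D x"
        using m elim by (auto intro!: ennreal_leI simp flip: ennreal_mult)
      then show ?thesis by (simp add: add_increasing)
    qed
  qed
  also have "\<dots> = ennreal ((R / 2) powr - b) * (\<integral>\<^sup>+x. ?N x \<partial>M) + (ennreal (2 powr b) * (\<integral>\<^sup>+x. ?F x \<partial>M) +
      ennreal (2 powr \<bar>a\<bar> * R powr (c - b - a)) * (\<integral>\<^sup>+x. ?D x \<partial>M))"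
    by (simp add: nn_integral_add nn_integral_cmult)
  also have "\<dots> \<le> ennreal ((R / 2) powr - b) * ennreal (near_const a D * C * (R / 2) powr (D - a)) +
     (ennreal (2 powr b) * ennreal (far_const (a + b) D * C * (2 * R) powr (D - (a + b))) +
      ennreal (2 powr \<bar>a\<bar> * R powr (c - b - a)) * ennreal (near_const c D * C * (3 * R) powr (D - c)))"
    using ab \<open>0 \<le> C\<close> \<open>0 < R\<close> growth
    by (intro add_mono mult_left_mono nn_integral_powr_near nn_integral_powr_far) auto
  also have "\<dots> = ennreal ((R / 2) powr - b * (near_const a D * C * (R / 2) powr (D - a)) +
     (2 powr b * (far_const (a + b) D * C * (2 * R) powr (D - (a + b))) +
      2 powr \<bar>a\<bar> * R powr (c - b - a) * (near_const c D * C * (3 * R) powr (D - c))))"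
    using ab \<open>0 \<le> C\<close> by (simp add: near_const_nonneg far_const_nonneg flip: ennreal_mult ennreal_plus)
  also have "(R / 2) powr - b * (near_const a D * C * (R / 2) powr (D - a)) +
     (2 powr b * (far_const (a + b) D * C * (2 * R) powr (D - (a + b))) +
      2 powr \<bar>a\<bar> * R powr (c - b - a) * (near_const c D * C * (3 * R) powr (D - c))) =
      two_centre_const a b c D * C * R powr (D - a - b)"
  proof -
    have "(R / 2) powr - b * (R / 2) powr (D - a) = 2 powr (a + b - D) * R powr (D - a - b)"
      using \<open>0 < R\<close> by (simp add: powr_divide powr_diff powr_add powr_minus field_simps)
    moreover have "(2 * R) powr (D - (a + b)) = 2 powr (D - a - b) * R powr (D - a - b)"
      using \<open>0 < R\<close> by (simp add: powr_mult diff_diff_eq)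
    moreover have "R powr (c - b - a) * (3 * R) powr (D - c) = 3 powr (D - c) * R powr (D - a - b)"
      using \<open>0 < R\<close> by (simp add: powr_mult flip: powr_add)
    ultimately show ?thesis
      unfolding two_centre_const_def by algebra
  qed
  finally show ?thesis .
qed

section \<open>Integrals of the weighted kernel over the boundary and over the half space\<close>

lemma half_space_iff [simp]: "x \<in> half_space \<longleftrightarrow> 0 < snd x"
  by (simp add: half_space_def)

lemma sets_half_space [measurable]: "half_space \<in> sets borel"
  unfolding half_space_def by (intro borel_open open_Collect_less continuous_intros)

lemma measurable_fst_snd_borel [measurable]:
  "fst \<in> borel_measurable (borel :: ('a::topological_space \<times> 'b::topological_space) measure)"
  "snd \<in> borel_measurable (borel :: ('a::topological_space \<times> 'b::topological_space) measure)"
  by (intro borel_measurable_continuous_onI continuous_intros)+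

lemma emeasure_lborel_punctured_cball:
  fixes c :: "'a::euclidean_space"
  assumes "0 < s"
  shows "emeasure lborel {y. 0 < norm (y - c) \<and> norm (y - c) \<le> s}
    \<le> ennreal (unit_ball_vol (DIM('a)) * s powr DIM('a))"
proof -
  have "emeasure lborel {y. 0 < norm (y - c) \<and> norm (y - c) \<le> s} \<le> emeasure lborel (cball c s)"
    by (intro emeasure_mono) (auto simp: dist_norm norm_minus_commute)
  then show ?thesis
    using assms by (simp add: emeasure_cball powr_realpow)
qed

lemma norm_fst_snd_le: "norm (fst x) \<le> norm x" "norm (snd x) \<le> norm x"
  by (metis norm_fst_le prod.collapse, metis norm_snd_le prod.collapse)

lemma snd_le_norm_diff: "\<bar>snd x\<bar> \<le> norm (x - (y, 0))"
  for x :: "'a::real_normed_vector \<times> real"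
  using norm_fst_snd_le(2)[of "x - (y, 0)"] by simp

lemma fst_le_norm_diff: "norm (y - fst x) \<le> norm (x - (y, 0))"
  for x :: "'a::real_normed_vector \<times> 'b::real_normed_vector"
  using norm_fst_snd_le(1)[of "x - (y, 0)"] by (simp add: norm_minus_commute)

text \<open>The centres are 0 and the projection x' of x, with R = |x|. Since x_n \<le> |x - (y,0)|,
  the factor x_n^g can be traded against the singularity at x', which is why only b - g has to lie
  below the dimension. The quotient x_n / R is at most 1 and is simply dropped near 0 and far
  away.\<close>

lemma nn_integral_boundary_kernel:
  fixes x :: "(real^'m) \<times> real"
  defines "D \<equiv> real (CARD('m))"
  assumes a: "a < D" "D < a + b" and g: "0 \<le> g" "b - g < D" and b: "0 < b" and x: "0 < snd x"
  shows "(\<integral>\<^sup>+y. ennreal (norm y powr - a * (snd x powr g * norm (x - (y, 0)) powr - b)) \<partial>lborel)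
    \<le> ennreal (two_centre_const a b (b - min g b) D * unit_ball_vol D * norm x powr (D - a - b + g))"
proof -
  define R c where "R = norm x" and "c = b - min g b"
  let ?L = "\<lambda>y. norm (x - (y, 0))"
  let ?k = "\<lambda>y. (snd x / R) powr g * ?L y powr - b"
  have R: "0 < R" "snd x \<le> R"
    using x norm_fst_snd_le(2)[of x] by (auto simp: R_def)
  have D: "0 < D"
    by (simp add: D_def)
  have q: "0 \<le> snd x / R" "snd x / R \<le> 1"
    using R x by auto
  have le1: "(snd x / R) powr g \<le> 1"
    using q g by (simp add: powr_le1)
  have 1: "(\<integral>\<^sup>+y. ennreal (norm y powr - a * ?k y) \<partial>lborel) \<le>
      ennreal (two_centre_const a b c D * unit_ball_vol D * R powr (D - a - b))"
  proof (rule nn_integral_two_centres[where d="\<lambda>y. norm (y - fst x)"])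
    show "c < D"
      using g D by (auto simp: c_def min_def)
    show "emeasure lborel {y \<in> space lborel. 0 < norm (y :: real^'m) \<and> norm y \<le> s} \<le> ennreal (unit_ball_vol D * s powr D)"
      if "0 < s" for s
      using emeasure_lborel_punctured_cball[OF that, of "0 :: real^'m"] by (simp add: D_def)
    show "emeasure lborel {y \<in> space lborel. 0 < norm (y - fst x) \<and> norm (y - fst x) \<le> s} \<le> ennreal (unit_ball_vol D * s powr D)"
      if "0 < s" for s
      using emeasure_lborel_punctured_cball[OF that, of "fst x"] by (simp add: D_def)
    show "AE y in lborel. 0 < norm (y :: real^'m)" "AE y in lborel. 0 < norm (y - fst x)"
      using AE_lborel_singleton[of "0 :: real^'m"] AE_lborel_singleton[of "fst x"] by simp_all
  next
    fix y :: "real^'m" assume "norm y \<le> R / 2"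
    then have "R / 2 \<le> ?L y"
      using norm_triangle_ineq2[of x "(y, 0)"] by (simp add: R_def)
    then have "?L y powr - b \<le> (R / 2) powr - b"
      using R b by (intro powr_mono2') auto
    then show "?k y \<le> (R / 2) powr - b"
      using mult_mono[OF le1] by fastforce
  next
    fix y :: "real^'m" assume "2 * R \<le> norm y"
    then have "norm y / 2 \<le> ?L y" "0 < norm y"
      using norm_triangle_ineq3[of x "(y, 0)"] R by (auto simp: R_def)
    then have "?L y powr - b \<le> (norm y / 2) powr - b"
      using b by (intro powr_mono2') auto
    then show "?k y \<le> (norm y / 2) powr - b"
      using mult_mono[OF le1] by fastforce
  next
    fix y :: "real^'m" assume y: "norm y \<le> 2 * R" and dy: "0 < norm (y - fst x)"
    have "norm (y - fst x) \<le> norm y + norm (fst x)"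
      by (rule norm_triangle_ineq4)
    also have "\<dots> \<le> 3 * R"
      using y norm_fst_snd_le(1)[of x] by (simp add: R_def)
    finally have d3: "norm (y - fst x) \<le> 3 * R" .
    have L: "0 < ?L y" "snd x \<le> ?L y" "norm (y - fst x) \<le> ?L y"
      using snd_le_norm_diff[of x y] fst_le_norm_diff[of y x] x by auto
    \<comment> \<open>Only the power min g b is spent, so that c \<ge> 0 and |x - (y,0)|^(-c) may be
      replaced by the larger |y - x'|^(-c).\<close>
    have "(snd x / R) powr g \<le> (snd x / R) powr min g b"
      using q by (intro powr_mono') auto
    also have "\<dots> \<le> (?L y / R) powr min g b"
      using L x R g b by (intro powr_mono2 divide_right_mono) auto
    finally have "?k y \<le> (?L y / R) powr min g b * ?L y powr - b"
      by (intro mult_right_mono) auto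
    also have "\<dots> = R powr (c - b) * ?L y powr - c"
      using L R by (simp add: c_def powr_divide powr_diff powr_minus field_simps)
    also have "\<dots> \<le> R powr (c - b) * norm (y - fst x) powr - c"
      using L dy by (intro mult_left_mono powr_mono2') (auto simp: c_def)
    finally show "norm (y - fst x) \<le> 3 * R \<and> ?k y \<le> R powr (c - b) * norm (y - fst x) powr - c"
      using d3 by simp
  qed (use a R in \<open>auto simp: D_def\<close>)
  have "(\<integral>\<^sup>+y. ennreal (norm y powr - a * (snd x powr g * ?L y powr - b)) \<partial>lborel) =
      (\<integral>\<^sup>+y. ennreal (R powr g) * ennreal (norm y powr - a * ?k y) \<partial>lborel)"
    using R x by (intro nn_integral_cong) (simp add: powr_divide flip: ennreal_mult)
  also have "\<dots> = ennreal (R powr g) * (\<integral>\<^sup>+y. ennreal (norm y powr - a * ?k y) \<partial>lborel)"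
    by (rule nn_integral_cmult) measurable
  also have "\<dots> \<le> ennreal (R powr g) * ennreal (two_centre_const a b c D * unit_ball_vol D * R powr (D - a - b))"
    by (intro mult_left_mono 1) simp
  also have "\<dots> = ennreal (two_centre_const a b c D * unit_ball_vol D * R powr (D - a - b + g))"
    using R D two_centre_const_nonneg[of a D b c] a g
    by (simp add: powr_add mult_ac c_def min_def split: if_splits flip: ennreal_mult')
  finally show ?thesis
    unfolding R_def c_def .
qed

text \<open>Provides the growth of the measure x_n^(-g) dx at boundary points: it behaves like a
  measure of dimension n - g. The cylinder replaces the half ball because it is a product.\<close>

lemma nn_integral_powr_snd_cylinder:
  fixes c :: "real^'m"
  assumes g: "g < 1" and s: "0 < s"
  shows "(\<integral>\<^sup>+x. ennreal (snd x powr - g) * indicator {x. norm (fst x - c) \<le> s \<and> 0 < snd x \<and> snd x \<le> s} x \<partial>lborel)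
    \<le> ennreal (near_const g 1 * unit_ball_vol (real (CARD('m))) * s powr (real (CARD('m)) + 1 - g))"
proof -
  define C where "C = unit_ball_vol (real (CARD('m))) * s powr real (CARD('m))"
  have C: "0 \<le> C" by (simp add: C_def)
  \<comment> \<open>Restricted to the infinite cylinder, Lebesgue measure of {0 < x_n \<le> t} is
    linear in t, so the near estimate applies to the function x_n with dimension 1.\<close>
  let ?M = "density lborel (indicator {x::(real^'m) \<times> real. norm (fst x - c) \<le> s})"
  have "(\<integral>\<^sup>+x. ennreal (snd x powr - g) * indicator {x. 0 < snd x \<and> snd x \<le> s} x \<partial>?M)
      \<le> ennreal (near_const g 1 * C * s powr (1 - g))"
  proof (rule nn_integral_powr_near)
    fix t :: real assume t: "0 < t"
    have "emeasure ?M {x \<in> space ?M. 0 < snd x \<and> snd x \<le> t} =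
        (\<integral>\<^sup>+x. indicator (cball c s \<times> {0<..t}) x \<partial>lborel)"
      by (subst emeasure_density)
        (auto simp: dist_norm norm_minus_commute intro!: nn_integral_cong split: split_indicator)
    also have "\<dots> = emeasure lborel (cball c s \<times> {0<..t})"
      by (rule nn_integral_indicator) (auto intro: borel_Times)
    also have "\<dots> = emeasure (lborel \<Otimes>\<^sub>M lborel) (cball c s \<times> {0<..t})"
      by (simp add: lborel_prod)
    also have "\<dots> = ennreal C * ennreal t"
      using t s by (subst lborel.emeasure_pair_measure_Times)
        (simp_all add: emeasure_cball C_def powr_realpow)
    finally show "emeasure ?M {x \<in> space ?M. 0 < snd x \<and> snd x \<le> t} \<le> ennreal (C * t powr 1)"
      using t C by (simp add: ennreal_mult)
  qed (use g s C in auto)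
  also have "near_const g 1 * C * s powr (1 - g) =
      near_const g 1 * unit_ball_vol (real (CARD('m))) * s powr (real (CARD('m)) + 1 - g)"
    using s by (simp add: C_def mult.assoc flip: powr_add) (simp add: add_diff_eq)
  finally show ?thesis
    by (subst (asm) nn_integral_density)
      (auto elim!: order_trans[rotated] intro!: nn_integral_mono split: split_indicator)
qed

text \<open>The factor x_n^(-g) is absorbed into the measure, which lowers the dimension to D; what
  remains is the model case of two centres, 0 and (y,0).\<close>

lemma nn_integral_half_space_kernel:
  fixes y :: "real^'m" and g :: real
  defines "D \<equiv> real (CARD('m)) + 1 - g"
  assumes a: "a < D" "D < a + b" and g: "g < 1" and b: "0 < b" "b < D" and y: "y \<noteq> 0"
  shows "(\<integral>\<^sup>+x. ennreal (norm x powr - a * (snd x powr - g * norm (x - (y, 0)) powr - b)) * indicator half_space x \<partial>lborel)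
    \<le> ennreal (two_centre_const a b b D * (near_const g 1 * unit_ball_vol (real (CARD('m)))) * norm y powr (D - a - b))"
proof -
  define R where "R = norm y"
  have R: "0 < R"
    using y by (simp add: R_def)
  let ?w = "\<lambda>x::(real^'m) \<times> real. ennreal (snd x powr - g) * indicator half_space x"
  let ?M = "density lborel ?w"
  let ?L = "\<lambda>x. norm (x - (y, 0))"
  let ?C = "near_const g 1 * unit_ball_vol (real (CARD('m)))"
  have growth: "emeasure ?M {x \<in> space ?M. 0 < norm (x - (c, 0)) \<and> norm (x - (c, 0)) \<le> s} \<le> ennreal (?C * s powr D)"
    if "0 < s" for s and c :: "real^'m"
  proof -
    have "emeasure ?M {x \<in> space ?M. 0 < norm (x - (c, 0)) \<and> norm (x - (c, 0)) \<le> s} =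
        (\<integral>\<^sup>+x. ?w x * indicator {x. 0 < norm (x - (c, 0)) \<and> norm (x - (c, 0)) \<le> s} x \<partial>lborel)"
      by (subst emeasure_density) auto
    also have "\<dots> \<le> (\<integral>\<^sup>+x. ennreal (snd x powr - g) * indicator {x. norm (fst x - c) \<le> s \<and> 0 < snd x \<and> snd x \<le> s} x \<partial>lborel)"
    proof (intro nn_integral_mono)
      fix x :: "(real^'m) \<times> real"
      show "?w x * indicator {x. 0 < norm (x - (c, 0)) \<and> norm (x - (c, 0)) \<le> s} x \<le>
          ennreal (snd x powr - g) * indicator {x. norm (fst x - c) \<le> s \<and> 0 < snd x \<and> snd x \<le> s} x"
        using snd_le_norm_diff[of x c] fst_le_norm_diff[of c x]
        by (auto split: split_indicator simp: norm_minus_commute)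
    qed
    also have "\<dots> \<le> ennreal (?C * s powr D)"
      using nn_integral_powr_snd_cylinder[OF g that, of c] by (simp add: D_def)
    finally show ?thesis .
  qed
  have "(\<integral>\<^sup>+x. ennreal (norm x powr - a * ?L x powr - b) \<partial>?M) \<le>
      ennreal (two_centre_const a b b D * ?C * R powr (D - a - b))"
  proof (rule nn_integral_two_centres[where d="?L"])
    show "emeasure ?M {x \<in> space ?M. 0 < norm x \<and> norm x \<le> s} \<le> ennreal (?C * s powr D)" if "0 < s" for s
      using growth[OF that, of 0] by (simp flip: zero_prod_def)
    show "emeasure ?M {x \<in> space ?M. 0 < ?L x \<and> ?L x \<le> s} \<le> ennreal (?C * s powr D)" if "0 < s" for s
      by (rule growth[OF that])
    show "AE x in ?M. 0 < norm x"
      using AE_lborel_singleton[of "0 :: (real^'m) \<times> real"]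
      by (subst AE_density) (auto elim: eventually_mono)
    show "AE x in ?M. 0 < ?L x"
      using AE_lborel_singleton[of "(y, 0 :: real)"]
      by (subst AE_density) (auto elim: eventually_mono)
  next
    fix x :: "(real^'m) \<times> real" assume "norm x \<le> R / 2"
    then have "R / 2 \<le> ?L x"
      using norm_triangle_ineq3[of x "(y, 0)"] by (simp add: R_def)
    then show "?L x powr - b \<le> (R / 2) powr - b"
      using R b by (intro powr_mono2') auto
  next
    fix x :: "(real^'m) \<times> real" assume "2 * R \<le> norm x"
    then have "norm x / 2 \<le> ?L x" "0 < norm x"
      using norm_triangle_ineq2[of x "(y, 0)"] R by (auto simp: R_def)
    then show "?L x powr - b \<le> (norm x / 2) powr - b"
      using b by (intro powr_mono2') auto
  next
    fix x :: "(real^'m) \<times> real" assume "norm x \<le> 2 * R"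
    then show "?L x \<le> 3 * R \<and> ?L x powr - b \<le> R powr (b - b) * ?L x powr - b"
      using norm_triangle_ineq4[of x "(y, 0)"] R by (simp add: R_def)
  qed (use a b R g near_const_nonneg[of g 1] in auto)
  then show ?thesis
    by (subst (asm) nn_integral_density) (auto simp: R_def ennreal_mult mult_ac)
qed

subsection \<open>Reflections\<close>

definition reflect :: "'a::real_inner \<Rightarrow> real \<Rightarrow> 'a \<Rightarrow> 'a" where
  "reflect e \<sigma> x = x - (2 * (x \<bullet> e - \<sigma>)) *\<^sub>R e"

lemma measurable_reflect [measurable]: "reflect e \<sigma> \<in> borel_measurable borel"
  for e :: "'a::euclidean_space"
  unfolding reflect_def by measurable

context
  fixes e :: "'a::real_inner" and \<sigma> :: real
  assumes e: "norm e = 1"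
begin

lemma reflect_inner: "reflect e \<sigma> x \<bullet> e = 2 * \<sigma> - x \<bullet> e"
  using e by (simp add: reflect_def inner_diff_left norm_eq_1)

lemma reflect_reflect [simp]: "reflect e \<sigma> (reflect e \<sigma> x) = x"
proof -
  have "reflect e \<sigma> (reflect e \<sigma> x) = reflect e \<sigma> x - (2 * (reflect e \<sigma> x \<bullet> e - \<sigma>)) *\<^sub>R e"
    by (simp only: reflect_def)
  then show ?thesis
    unfolding reflect_inner by (simp add: reflect_def algebra_simps flip: scaleR_add_left scaleR_diff_left)
qed

text \<open>Source of all comparisons. For two points on the same side of the mirror the product is
  positive, so reflecting one of them moves it away from the other.\<close>

lemma norm_reflect_diff_sq:
  "(norm (reflect e \<sigma> x - y))\<^sup>2 = (norm (x - y))\<^sup>2 + 4 * (x \<bullet> e - \<sigma>) * (y \<bullet> e - \<sigma>)"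
proof -
  define t where "t = 2 * (x \<bullet> e - \<sigma>)"
  have "(norm (reflect e \<sigma> x - y))\<^sup>2 = ((x - y) - t *\<^sub>R e) \<bullet> ((x - y) - t *\<^sub>R e)"
    by (simp add: reflect_def t_def power2_norm_eq_inner algebra_simps)
  also have "\<dots> = (x - y) \<bullet> (x - y) - 2 * t * ((x - y) \<bullet> e) + t\<^sup>2 * (e \<bullet> e)"
    by (simp add: inner_diff_left inner_diff_right inner_commute power2_eq_square algebra_simps)
  also have "(x - y) \<bullet> (x - y) = (norm (x - y))\<^sup>2"
    by (rule power2_norm_eq_inner[symmetric])
  also have "e \<bullet> e = 1"
    using e by (simp add: norm_eq_1)
  finally show ?thesis
    by (simp add: t_def inner_diff_left power2_eq_square algebra_simps)
qed

lemma norm_reflect_sq: "(norm (reflect e \<sigma> x))\<^sup>2 = (norm x)\<^sup>2 - 4 * (x \<bullet> e - \<sigma>) * \<sigma>"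
  using norm_reflect_diff_sq[of x 0] by simp

lemma norm_reflect_reflect_diff: "norm (reflect e \<sigma> x - reflect e \<sigma> y) = norm (x - y)"
proof -
  have "(norm (reflect e \<sigma> x - reflect e \<sigma> y))\<^sup>2 =
      (norm (x - reflect e \<sigma> y))\<^sup>2 - 4 * (x \<bullet> e - \<sigma>) * (y \<bullet> e - \<sigma>)"
    by (subst norm_reflect_diff_sq) (simp add: reflect_inner algebra_simps)
  also have "norm (x - reflect e \<sigma> y) = norm (reflect e \<sigma> y - x)"
    by (rule norm_minus_commute)
  also have "(norm (reflect e \<sigma> y - x))\<^sup>2 = (norm (x - y))\<^sup>2 + 4 * (x \<bullet> e - \<sigma>) * (y \<bullet> e - \<sigma>)"
    by (subst norm_reflect_diff_sq) (simp add: norm_minus_commute algebra_simps)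
  finally show ?thesis
    by simp
qed

lemma reflect_diff_swap: "norm (x - reflect e \<sigma> y) = norm (reflect e \<sigma> x - y)"
  using norm_reflect_reflect_diff[of x "reflect e \<sigma> y"] by simp

end

lemma nn_integral_lborel_translate:
  fixes c :: "'a::euclidean_space"
  assumes [measurable]: "f \<in> borel_measurable borel"
  shows "(\<integral>\<^sup>+x. f (c + x) \<partial>lborel) = (\<integral>\<^sup>+x. f x \<partial>lborel)"
proof -
  have "(\<integral>\<^sup>+x. f x \<partial>lborel) = (\<integral>\<^sup>+x. f x \<partial>distr lborel borel ((+) c))"
    by (simp add: lborel_distr_plus)
  also have "\<dots> = (\<integral>\<^sup>+x. f (c + x) \<partial>lborel)"
    by (rule nn_integral_distr) auto
  finally show ?thesis ..
qed

text \<open>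
  Translation invariance gives the reflected Lebesgue measure up to a constant factor, by
  comparing $\int\int f(Tx)\,1_B(y - Tx)\,dx\,dy$ in the two orders of integration; the constant
  is 1 since reflections map balls to balls. (The change of variables theorem for linear maps
  is only available for well-ordered index types.)
\<close>

lemma nn_integral_reflect:
  fixes e :: "'a::euclidean_space"
  assumes e: "norm e = 1" and f [measurable]: "f \<in> borel_measurable borel"
  shows "(\<integral>\<^sup>+x. f (reflect e \<sigma> x) \<partial>lborel) = (\<integral>\<^sup>+x. f x \<partial>lborel)"
proof -
  define B where "B = ball (0::'a) 1"
  let ?T = "reflect e \<sigma>"
  define z where "z = ?T 0"
  have [measurable]: "B \<in> sets borel"
    by (simp add: B_def)
  define m where "m = emeasure lborel B"
  have "unit_ball_vol (real DIM('a)) \<noteq> 0"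
    by (metis less_irrefl unit_ball_vol_pos of_nat_0_le_iff)
  then have m: "m \<noteq> 0" "m \<noteq> top"
    by (auto simp: m_def B_def emeasure_ball)
  \<comment> \<open>The reflection is an isometry, hence the preimage of the unit ball about 0 is
    the unit ball about the image \<open>z\<close> of 0.\<close>
  have TB: "indicator B (- ?T x) = (indicator (ball z 1) x :: ennreal)" for x
    using norm_reflect_reflect_diff[OF e, of \<sigma> x z] e
    by (auto simp: B_def z_def dist_norm norm_minus_commute split: split_indicator)
  have "(\<integral>\<^sup>+x. f (?T x) \<partial>lborel) * m = (\<integral>\<^sup>+x. f (?T x) * (\<integral>\<^sup>+y. indicator B (- ?T x + y) \<partial>lborel) \<partial>lborel)"
    by (subst nn_integral_lborel_translate) (auto simp: m_def nn_integral_multc)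
  also have "\<dots> = (\<integral>\<^sup>+x. (\<integral>\<^sup>+y. f (?T x) * indicator B (y - ?T x) \<partial>lborel) \<partial>lborel)"
    by (intro nn_integral_cong) (simp add: nn_integral_cmult)
  also have "\<dots> = (\<integral>\<^sup>+y. (\<integral>\<^sup>+x. f (?T x) * indicator B (y - ?T x) \<partial>lborel) \<partial>lborel)"
    by (rule lborel_pair.Fubini') measurable
  also have "\<dots> = (\<integral>\<^sup>+y. (\<integral>\<^sup>+x. f (?T x + y) * indicator B (- ?T x) \<partial>lborel) \<partial>lborel)"
  proof (rule nn_integral_cong)
    fix y :: 'a
    \<comment> \<open>The linear part of the reflection is an involution; \<open>?c\<close> is the
      image of \<open>y\<close> under it, hence the translation that becomes translation by
      \<open>y\<close> after reflecting.\<close>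
    let ?c = "y - (2 * (y \<bullet> e)) *\<^sub>R e"
    have shift: "?T (?c + x) = ?T x + y" for x
      using e by (simp add: reflect_def inner_add_left inner_diff_left norm_eq_1 algebra_simps flip: scaleR_add_left)
    show "(\<integral>\<^sup>+x. f (?T x) * indicator B (y - ?T x) \<partial>lborel) = (\<integral>\<^sup>+x. f (?T x + y) * indicator B (- ?T x) \<partial>lborel)"
      by (subst nn_integral_lborel_translate[symmetric, of _ ?c]) (measurable, simp add: shift)
  qed
  also have "\<dots> = (\<integral>\<^sup>+x. (\<integral>\<^sup>+y. f (?T x + y) * indicator B (- ?T x) \<partial>lborel) \<partial>lborel)"
    by (rule lborel_pair.Fubini') measurable
  also have "\<dots> = (\<integral>\<^sup>+x. (\<integral>\<^sup>+y. f y \<partial>lborel) * indicator B (- ?T x) \<partial>lborel)"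
    by (simp add: nn_integral_multc nn_integral_lborel_translate)
  also have "\<dots> = (\<integral>\<^sup>+y. f y \<partial>lborel) * m"
  proof -
    have "(\<integral>\<^sup>+x. indicator (ball z 1) x \<partial>lborel) = emeasure lborel (ball z 1)"
      by (rule nn_integral_indicator) simp
    moreover have "(\<integral>\<^sup>+x. (\<integral>\<^sup>+y. f y \<partial>lborel) * indicator (ball z 1) x \<partial>lborel) =
        (\<integral>\<^sup>+y. f y \<partial>lborel) * (\<integral>\<^sup>+x. indicator (ball z 1) x \<partial>lborel)"
      by (rule nn_integral_cmult) (rule borel_measurable_indicator, simp)
    ultimately show ?thesis
      unfolding TB by (simp add: m_def B_def emeasure_ball)
  qed
  finally show ?thesis
    using m by (simp add: mult.commute[of _ m] ennreal_mult_cancel_left)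
qed

lemma AE_lborel_hyperplane:
  fixes e :: "'a::euclidean_space"
  assumes "e \<noteq> 0"
  shows "AE x in lborel. x \<bullet> e \<noteq> \<sigma>"
proof -
  have "negligible {x. e \<bullet> x = \<sigma>}"
    using assms by (intro negligible_hyperplane) simp
  moreover have "{x. e \<bullet> x = \<sigma>} \<in> sets lborel"
    by simp
  ultimately have "{x. e \<bullet> x = \<sigma>} \<in> null_sets lborel"
    by (simp add: negligible_iff_null_sets null_sets_completion_iff)
  then show ?thesis
    by (rule AE_not_in[THEN eventually_mono]) (auto simp: inner_commute)
qed

lemma AE_lborel_open_ex:
  fixes x :: "'a::euclidean_space"
  assumes "open S" "x \<in> S" and P: "AE x in lborel. P x"
  obtains z where "z \<in> S" "P z"
proof (rule ccontr)
  assume "\<not> thesis"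
  then have "AE x in lborel. x \<notin> S"
    using P that by (auto elim!: eventually_mono)
  then have "S \<in> null_sets lborel"
    using \<open>open S\<close> by (simp add: AE_iff_null_sets[symmetric] null_sets_def)
  then have "negligible S"
    by (simp add: negligible_iff_null_sets null_sets_completion_iff null_sets_completionI)
  then show False
    using open_not_negligible assms by blast
qed

lemma nn_integral_fold_reflect:
  fixes e :: "'a::euclidean_space"
  assumes e: "norm e = 1" and [measurable]: "f \<in> borel_measurable borel"
  shows "(\<integral>\<^sup>+x. f x \<partial>lborel) = (\<integral>\<^sup>+x. (f x + f (reflect e \<sigma> x)) * indicator {x. x \<bullet> e < \<sigma>} x \<partial>lborel)"
proof -
  have "(\<integral>\<^sup>+x. f x \<partial>lborel) =
      (\<integral>\<^sup>+x. f x * indicator {x. x \<bullet> e < \<sigma>} x + f x * indicator {x. \<sigma> < x \<bullet> e} x \<partial>lborel)"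
  proof (rule nn_integral_cong_AE)
    have "e \<noteq> 0" using e by auto
    then show "AE x in lborel. f x = f x * indicator {x. x \<bullet> e < \<sigma>} x + f x * indicator {x. \<sigma> < x \<bullet> e} x"
      using AE_lborel_hyperplane[of e \<sigma>] by (auto elim!: eventually_mono split: split_indicator)
  qed
  also have "\<dots> = (\<integral>\<^sup>+x. f x * indicator {x. x \<bullet> e < \<sigma>} x \<partial>lborel) + (\<integral>\<^sup>+x. f x * indicator {x. \<sigma> < x \<bullet> e} x \<partial>lborel)"
    by (rule nn_integral_add) measurable
  also have "(\<integral>\<^sup>+x. f x * indicator {x. \<sigma> < x \<bullet> e} x \<partial>lborel) =
      (\<integral>\<^sup>+x. f (reflect e \<sigma> x) * indicator {x. \<sigma> < x \<bullet> e} (reflect e \<sigma> x) \<partial>lborel)"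
    by (rule nn_integral_reflect[OF e, symmetric]) measurable
  also have "\<dots> = (\<integral>\<^sup>+x. f (reflect e \<sigma> x) * indicator {x. x \<bullet> e < \<sigma>} x \<partial>lborel)"
    using e by (intro nn_integral_cong) (auto simp: reflect_inner split: split_indicator)
  also have "(\<integral>\<^sup>+x. f x * indicator {x. x \<bullet> e < \<sigma>} x \<partial>lborel) + \<dots> =
      (\<integral>\<^sup>+x. f x * indicator {x. x \<bullet> e < \<sigma>} x + f (reflect e \<sigma> x) * indicator {x. x \<bullet> e < \<sigma>} x \<partial>lborel)"
    by (rule nn_integral_add[symmetric]) measurable
  finally show ?thesis
    by (simp add: distrib_right)
qed

section \<open>Comparing an integral with the one whose kernel is reflected\<close>

context
  fixes e :: "'a::euclidean_space" and \<sigma> :: real and f w :: "'a \<Rightarrow> ennreal"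
  assumes e: "norm e = 1"
    and [measurable]: "f \<in> borel_measurable borel" "w \<in> borel_measurable borel"
    and f: "\<And>x. x \<bullet> e < \<sigma> \<Longrightarrow> f (reflect e \<sigma> x) \<le> f x"
    and w: "\<And>x. x \<bullet> e < \<sigma> \<Longrightarrow> w x \<le> w (reflect e \<sigma> x)"
begin

text \<open>A rearrangement in each pair of mirror points. The excess d = f(x) - f(R x) is moved
  from x to R x, where the weight is larger; the second condition on V and V' serves this moved
  part, the first one the part that stays. Allowing V' to differ from V covers both the solution
  itself and an envelope above it.\<close>

lemma nn_integral_reflect_kernel_le:
  assumes [measurable]: "V \<in> borel_measurable borel" "V' \<in> borel_measurable borel"
    and V: "\<And>x. V x \<le> V' x" "\<And>x. x \<bullet> e < \<sigma> \<Longrightarrow> V x \<le> V' (reflect e \<sigma> x)"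
  shows "(\<integral>\<^sup>+x. f x * w x * V x \<partial>lborel) \<le> (\<integral>\<^sup>+x. f (reflect e \<sigma> x) * w x * V' x \<partial>lborel)"
proof -
  let ?R = "reflect e \<sigma>"
  have "f x * w x * V x + f (?R x) * w (?R x) * V (?R x) \<le>
      f (?R x) * w x * V' x + f x * w (?R x) * V' (?R x)" if x: "x \<bullet> e < \<sigma>" for x
  proof -
    obtain d where d: "f x = f (?R x) + d"
      using f[OF x] le_iff_add by blast
    have "f (?R x) * w x * V x \<le> f (?R x) * w x * V' x"
      "f (?R x) * w (?R x) * V (?R x) \<le> f (?R x) * w (?R x) * V' (?R x)"
      "d * w x * V x \<le> d * w (?R x) * V' (?R x)"
      using V(1) V(2)[OF x] w[OF x] by (intro mult_mono order_refl; simp)+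
    then have "(f (?R x) * w x * V x + f (?R x) * w (?R x) * V (?R x)) + d * w x * V x \<le>
      (f (?R x) * w x * V' x + f (?R x) * w (?R x) * V' (?R x)) + d * w (?R x) * V' (?R x)"
      by (intro add_mono)
    then show ?thesis
      unfolding d by (simp add: distrib_right add_ac)
  qed
  then show ?thesis
    by (subst (1 2) nn_integral_fold_reflect[OF e, where \<sigma>=\<sigma>])
      (auto simp: e intro!: nn_integral_mono split: split_indicator)
qed

text \<open>The same rearrangement when V is not ordered: moving d from x to R x costs at most the
  positive part of V(x) - V(R x), which is what subtraction of extended nonnegative reals
  computes.\<close>

lemma nn_integral_reflect_kernel_diff:
  assumes [measurable]: "V \<in> borel_measurable borel"
  shows "(\<integral>\<^sup>+x. f x * w x * V x \<partial>lborel) \<le> (\<integral>\<^sup>+x. f (reflect e \<sigma> x) * w x * V x \<partial>lborel) +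
    (\<integral>\<^sup>+x. f x * w x * ((V x - V (reflect e \<sigma> x)) * indicator {x. x \<bullet> e < \<sigma>} x) \<partial>lborel)"
proof -
  let ?R = "reflect e \<sigma>"
  have *: "f x * w x * V x + f (?R x) * w (?R x) * V (?R x) \<le>
      (f (?R x) * w x * V x + f x * w (?R x) * V (?R x)) + f x * w x * (V x - V (?R x))" if x: "x \<bullet> e < \<sigma>" for x
  proof -
    obtain d where d: "f x = f (?R x) + d"
      using f[OF x] le_iff_add by blast
    have "V x \<le> V (?R x) + (V x - V (?R x))"
      by (cases "V (?R x) \<le> V x") (simp_all add: add_diff_inverse_ennreal add_increasing2)
    then have "d * w x * V x \<le> d * w x * (V (?R x) + (V x - V (?R x)))"
      by (rule mult_left_mono) simp
    also have "\<dots> = d * w x * V (?R x) + d * w x * (V x - V (?R x))"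
      by (rule distrib_left)
    also have "\<dots> \<le> d * w (?R x) * V (?R x) + f x * w x * (V x - V (?R x))"
      using w[OF x] by (intro add_mono mult_mono order_refl) (auto simp: d)
    finally have "(f (?R x) * w x * V x + f (?R x) * w (?R x) * V (?R x)) + d * w x * V x \<le>
      (f (?R x) * w x * V x + f (?R x) * w (?R x) * V (?R x)) + \<dots>"
      by (rule add_left_mono)
    then show ?thesis
      by (simp add: d distrib_right add_ac)
  qed
  have "(\<integral>\<^sup>+x. f x * w x * V x \<partial>lborel) \<le>
    (\<integral>\<^sup>+x. (f (?R x) * w x * V x + f x * w (?R x) * V (?R x)) * indicator {x. x \<bullet> e < \<sigma>} x +
      f x * w x * ((V x - V (?R x)) * indicator {x. x \<bullet> e < \<sigma>} x) \<partial>lborel)"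
    by (subst nn_integral_fold_reflect[OF e, where \<sigma>=\<sigma>])
      (auto intro!: nn_integral_mono * split: split_indicator)
  also have "\<dots> = (\<integral>\<^sup>+x. (f (?R x) * w x * V x + f x * w (?R x) * V (?R x)) * indicator {x. x \<bullet> e < \<sigma>} x \<partial>lborel) +
    (\<integral>\<^sup>+x. f x * w x * ((V x - V (?R x)) * indicator {x. x \<bullet> e < \<sigma>} x) \<partial>lborel)"
    by (rule nn_integral_add) measurable
  finally show ?thesis
    by (subst nn_integral_fold_reflect[OF e, where \<sigma>=\<sigma> and f="\<lambda>x. f (?R x) * w x * V x"]) (auto simp: e)
qed

end

lemma measurable_singular_weight [measurable]:
  "singular_weight a \<in> borel_measurable (borel :: 'a::{real_normed_vector, second_countable_topology} measure)"
  unfolding singular_weight_def[abs_def] by measurable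

lemma singular_weight_eq: "x \<noteq> 0 \<Longrightarrow> singular_weight a x = ennreal (norm x powr - a)"
  by (simp add: singular_weight_def inverse_ennreal powr_minus)

lemma singular_weight_pos: "0 < singular_weight a x"
  by (simp add: singular_weight_def zero_less_iff_neq_zero)

lemma singular_weight_antimono: "norm x \<le> norm y \<Longrightarrow> 0 \<le> a \<Longrightarrow> singular_weight a y \<le> singular_weight a x"
  for x :: "'a::real_normed_vector"
proof (cases "x = 0")
  case False
  assume "norm x \<le> norm y" "0 \<le> a"
  moreover from this False have "y \<noteq> 0" by auto
  ultimately show ?thesis
    using False by (auto simp: singular_weight_eq intro!: ennreal_leI powr_mono2')
qed (simp add: singular_weight_def[of _ "0 :: 'a"])

subsection \<open>The system on the half space\<close>

text \<open>The Poisson-type kernel extended by zero, so that all integrals run over the whole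
  space. The denominator is a norm of the product space, on which the reflections in directions (e,
  0) act as isometries.\<close>

definition half_space_kernel :: "real \<Rightarrow> real \<Rightarrow> (real^'m) \<times> real \<Rightarrow> real^'m \<Rightarrow> ennreal" where
  "half_space_kernel lam \<mu> x y =
     ennreal (if 0 < snd x then snd x powr lam * norm (x - (y, 0)) powr - \<mu> else 0)"

lemma measurable_norm_diff [measurable]:
  "(\<lambda>z. norm (fst z - (snd z, 0 :: real))) \<in> borel_measurable (lborel \<Otimes>\<^sub>M (lborel :: (real^'m) measure))"
proof -
  have "(\<lambda>z. norm (fst z - (snd z, 0 :: real))) \<in> borel_measurable (borel :: (((real^'m) \<times> real) \<times> (real^'m)) measure)"
    by (intro borel_measurable_continuous_onI continuous_intros)
  then show ?thesis
    by (simp add: lborel_prod)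
qed

lemma measurable_half_space_kernel [measurable]:
  "(\<lambda>z. half_space_kernel lam \<mu> (fst z) (snd z)) \<in> borel_measurable (lborel \<Otimes>\<^sub>M (lborel :: (real^'m) measure))"
  unfolding half_space_kernel_def by measurable

lemma measurable_half_space_kernel_1 [measurable]:
  "(\<lambda>x. half_space_kernel lam \<mu> x y) \<in> borel_measurable borel"
  using measurable_Pair_compose_split[of "half_space_kernel lam \<mu>" lborel lborel borel "\<lambda>x. x" borel "\<lambda>_. y"]
  by (simp add: split_beta)

lemma measurable_half_space_kernel_2 [measurable]:
  "half_space_kernel lam \<mu> x \<in> borel_measurable borel"
  using measurable_Pair_compose_split[of "half_space_kernel lam \<mu>" lborel lborel borel "\<lambda>_. x" borel "\<lambda>y. y"]
  by (simp add: split_beta)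

lemma reflect_half_space:
  fixes e :: "'b::real_inner"
  shows "reflect (e, 0 :: real) \<sigma> x = (reflect e \<sigma> (fst x), snd x)"
  by (simp add: reflect_def prod_eq_iff inner_prod_def)

lemma half_space_kernel_reflect:
  assumes e: "norm e = 1"
  shows "half_space_kernel lam \<mu> (reflect (e, 0) \<sigma> x) y = half_space_kernel lam \<mu> x (reflect e \<sigma> y)"
proof -
  have "norm (e, 0 :: real) = 1" using e by simp
  from reflect_diff_swap[OF this, of x \<sigma> "(y, 0)"] show ?thesis
    by (simp add: half_space_kernel_def reflect_half_space)
qed

lemma half_space_kernel_reflect_le:
  assumes e: "norm e = 1" and "0 \<le> \<mu>" and x: "x \<bullet> (e, 0) < \<sigma>" and y: "y \<bullet> e < \<sigma>"
  shows "half_space_kernel lam \<mu> (reflect (e, 0) \<sigma> x) y \<le> half_space_kernel lam \<mu> x y"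
proof (cases "0 < snd x")
  case True
  have "norm (e, 0 :: real) = 1" using e by simp
  from norm_reflect_diff_sq[OF this, of \<sigma> x "(y, 0)"]
  have "(norm (x - (y, 0)))\<^sup>2 \<le> (norm (reflect (e, 0) \<sigma> x - (y, 0)))\<^sup>2"
    using x y by (simp add: mult_nonpos_nonpos)
  then have "norm (x - (y, 0)) \<le> norm (reflect (e, 0) \<sigma> x - (y, 0))"
    by (rule power2_le_imp_le) simp
  moreover have "0 < norm (x - (y, 0))"
    using True snd_le_norm_diff[of x y] by linarith
  ultimately have "norm (reflect (e, 0) \<sigma> x - (y, 0)) powr - \<mu> \<le> norm (x - (y, 0)) powr - \<mu>"
    using \<open>0 \<le> \<mu>\<close> by (intro powr_mono2') auto
  then show ?thesis
    by (simp add: half_space_kernel_def reflect_half_space True mult_left_mono ennreal_leI)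
qed (simp add: half_space_kernel_def reflect_half_space)

text \<open>For \<sigma> \<le> 0 the origin is on the mirror or beyond it, hence the reflected point
  is no farther from it.\<close>

lemma singular_weight_reflect_le:
  assumes e: "norm e = 1" and "0 \<le> a" and x: "x \<bullet> e < \<sigma>" and "\<sigma> \<le> 0"
  shows "singular_weight a x \<le> singular_weight a (reflect e \<sigma> x)"
proof (rule singular_weight_antimono)
  have "0 \<le> 4 * ((x \<bullet> e - \<sigma>) * \<sigma>)"
    using x \<open>\<sigma> \<le> 0\<close> by (simp add: mult_nonpos_nonpos)
  then have "(norm (reflect e \<sigma> x))\<^sup>2 \<le> (norm x)\<^sup>2"
    using norm_reflect_sq[OF e, of \<sigma> x] by (simp add: mult_ac)
  then show "norm (reflect e \<sigma> x) \<le> norm x"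
    by (rule power2_le_imp_le) simp
qed (rule \<open>0 \<le> a\<close>)

text \<open>Normal form of the problem: \<open>u\<close> and \<open>v\<close> are Borel functions,
  \<open>v\<close> is zero outside the half space (see \<open>v_outside\<close>), the outer weights
  are pulled out of the integrals, and \<open>critical\<close> is the exponent relation multiplied
  by the dimension CARD('m) + 1.\<close>

locale half_space_system =
  fixes lam \<alpha> \<beta> \<mu> p q :: real
    and u :: "real^'m \<Rightarrow> ennreal" and v :: "(real^'m) \<times> real \<Rightarrow> ennreal"
  assumes lam: "0 \<le> lam" and \<alpha>: "0 < \<alpha>" and \<beta>: "0 < \<beta>" and \<mu>: "0 < \<mu>" and p: "0 < p" and q: "0 < q"
    and measurable_u [measurable]: "u \<in> borel_measurable borel"
    and measurable_v [measurable]: "v \<in> borel_measurable borel"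
    and u_formula: "\<And>y. u y = singular_weight \<alpha> y *
      (\<integral>\<^sup>+x. half_space_kernel lam \<mu> x y * singular_weight \<beta> x * ennreal_powr (v x) q \<partial>lborel)"
    and v_formula: "\<And>x. v x = singular_weight \<beta> x *
      (\<integral>\<^sup>+y. half_space_kernel lam \<mu> x y * singular_weight \<alpha> y * ennreal_powr (u y) p \<partial>lborel)"
    and u_pos: "\<And>y. 0 < u y" and v_pos: "\<And>x. 0 < snd x \<Longrightarrow> 0 < v x"
    and u_int: "(\<integral>\<^sup>+y. ennreal_powr (u y) (p + 1) \<partial>lborel) < top"
    and v_int: "(\<integral>\<^sup>+x. ennreal_powr (v x) (q + 1) \<partial>lborel) < top"
    and critical: "real CARD('m) / (p + 1) + (real CARD('m) + 1) / (q + 1) = \<alpha> + \<beta> + \<mu> - lam"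
begin

abbreviation "K \<equiv> half_space_kernel lam \<mu>"

definition "G x y = singular_weight \<beta> x * K x y * singular_weight \<alpha> y"

lemma measurable_G [measurable]: "case_prod G \<in> borel_measurable (lborel \<Otimes>\<^sub>M lborel)"
  unfolding G_def by (simp add: split_beta)

sublocale dual_system lborel lborel G u v p q
proof
  show "AE y in lborel. u y = (\<integral>\<^sup>+x. G x y * ennreal_powr (v x) q \<partial>lborel)"
    by (subst u_formula, subst nn_integral_cmult[symmetric]) (auto simp: G_def mult_ac)
  show "AE x in lborel. v x = (\<integral>\<^sup>+y. G x y * ennreal_powr (u y) p \<partial>lborel)"
    by (subst v_formula, subst nn_integral_cmult[symmetric]) (auto simp: G_def mult_ac)
qed (auto simp: p q)

lemma v_outside: "snd x \<le> 0 \<Longrightarrow> v x = 0"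
  by (subst v_formula) (simp add: half_space_kernel_def)

lemma u_finite: "AE y in lborel. u y < top"
  using nn_integral_PInf_AE[of "\<lambda>y. ennreal_powr (u y) (p + 1)" lborel] u_int by (simp add: less_top)

lemma v_finite_AE: "AE x in lborel. v x < top"
  using nn_integral_PInf_AE[of "\<lambda>x. ennreal_powr (v x) (q + 1)" lborel] v_int by (simp add: less_top)

section \<open>Finiteness and continuity of v in the open half space\<close>

definition "\<phi> x = (\<integral>\<^sup>+y. ennreal (norm (x - (y, 0 :: real)) powr - \<mu>) * (singular_weight \<alpha> y * ennreal_powr (u y) p) \<partial>lborel)"

lemma measurable_norm_diff_2 [measurable]: "(\<lambda>y. norm (x - (y, 0 :: real))) \<in> borel_measurable (borel :: (real^'m) measure)"
  by (intro borel_measurable_continuous_onI continuous_intros)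

lemma v_eq_\<phi>:
  assumes "0 < snd x"
  shows "v x = ennreal (norm x powr - \<beta> * snd x powr lam) * \<phi> x"
proof -
  have "x \<noteq> 0" using assms by auto
  have "v x = singular_weight \<beta> x * (ennreal (snd x powr lam) * \<phi> x)"
    unfolding \<phi>_def
    by (subst v_formula, subst nn_integral_cmult[symmetric])
      (auto simp: half_space_kernel_def assms ennreal_mult mult_ac)
  then show ?thesis
    using \<open>x \<noteq> 0\<close> by (simp add: singular_weight_eq ennreal_mult mult_ac)
qed

text \<open>Uniformly in y, |z - (y,0)| \<le> c |x - (y,0)| by the triangle inequality and x_n \<le>
  |x - (y,0)|. A single point where v is finite therefore makes \<open>\<phi>\<close> finite
  everywhere in the half space; and as the constant tends to 1 when the points merge, using it in
  both directions gives continuity.\<close>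

lemma \<phi>_Harnack:
  assumes x: "0 < snd x" and z: "0 < snd z"
  shows "\<phi> x \<le> ennreal ((1 + norm (z - x) / snd x) powr \<mu>) * \<phi> z"
proof -
  define c where "c = 1 + norm (z - x) / snd x"
  have c: "0 < c" using x by (simp add: c_def add_pos_nonneg)
  have "norm (x - (y, 0)) powr - \<mu> \<le> c powr \<mu> * norm (z - (y, 0)) powr - \<mu>" for y
  proof -
    have "z \<noteq> (y, 0)" using z by auto
    have L: "snd x \<le> norm (x - (y, 0))"
      using snd_le_norm_diff[of x y] by simp
    have "norm (z - (y, 0)) \<le> norm (z - x) + norm (x - (y, 0))"
      by (rule norm_diff_triangle_ineq[of z x x "(y, 0)", simplified])
    also have "\<dots> \<le> c * norm (x - (y, 0))"
    proof -
      have "norm (z - x) = norm (z - x) / snd x * snd x"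
        using x by simp
      also have "\<dots> \<le> norm (z - x) / snd x * norm (x - (y, 0))"
        using x by (intro mult_left_mono L) simp
      finally show ?thesis by (simp add: c_def distrib_right)
    qed
    finally have "(c * norm (x - (y, 0))) powr - \<mu> \<le> norm (z - (y, 0)) powr - \<mu>"
      using \<open>z \<noteq> (y, 0)\<close> \<mu> by (intro powr_mono2') auto
    moreover have "norm (x - (y, 0)) powr - \<mu> = c powr \<mu> * (c * norm (x - (y, 0))) powr - \<mu>"
      using c by (simp add: powr_mult powr_minus)
    ultimately show ?thesis
      by (simp add: mult_left_mono)
  qed
  then show ?thesis
    unfolding \<phi>_def c_def[symmetric]
    by (subst nn_integral_cmult[symmetric])
      (auto simp flip: mult.assoc ennreal_mult intro!: nn_integral_mono mult_right_mono ennreal_leI)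
qed

lemma open_upper: "open {x :: (real^'m) \<times> real. 0 < snd x}"
  by (intro open_Collect_less continuous_intros)

lemma finite_off_boundary:
  assumes x: "0 < snd x"
  shows "\<phi> x < top" "v x < top"
proof -
  obtain z where z: "0 < snd z" "v z < top"
    using AE_lborel_open_ex[OF open_upper _ v_finite_AE, of x] x by auto
  have "0 < norm z powr - \<beta> * snd z powr lam"
    using z by (intro mult_pos_pos) auto
  then have "ennreal (norm z powr - \<beta> * snd z powr lam) \<noteq> 0"
    by (simp only: ennreal_eq_0_iff not_le)
  then have "\<phi> z \<noteq> top"
    using z v_eq_\<phi>[of z] by (metis ennreal_mult_top less_irrefl)
  then show fin: "\<phi> x < top"
    using \<phi>_Harnack[OF x z(1)] by (auto simp: ennreal_mult_less_top less_top elim: le_less_trans)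
  then show "v x < top"
    using v_eq_\<phi>[OF x] by (simp add: ennreal_mult_less_top)
qed

lemma v_less_top: "v x < top"
  using finite_off_boundary(2)[of x] v_outside[of x] by (cases "0 < snd x") auto

lemma isCont_\<phi>:
  assumes z: "0 < snd z"
  shows "isCont (\<lambda>x. enn2real (\<phi> x)) z"
proof -
  let ?f = "\<lambda>x. enn2real (\<phi> x)"
  have le: "?f x \<le> (1 + norm (y - x) / snd x) powr \<mu> * ?f y" if "0 < snd x" "0 < snd y" for x y
    using enn2real_mono[OF \<phi>_Harnack[OF that]] finite_off_boundary(1)[OF that(2)]
    by (simp add: ennreal_mult_less_top enn2real_mult)
  have ev: "\<forall>\<^sub>F x in at z. 0 < snd x"
    using eventually_at_in_open'[OF open_upper, of z] z by simp
  show ?thesis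
    unfolding isCont_def
  proof (rule tendsto_sandwich)
    show "\<forall>\<^sub>F x in at z. (1 + norm (x - z) / snd z) powr - \<mu> * ?f z \<le> ?f x"
      using ev
    proof eventually_elim
      case (elim x)
      have "0 < 1 + norm (x - z) / snd z"
        using z by (simp add: add_pos_nonneg)
      then show ?case
        using le[OF z elim] by (simp add: powr_minus field_simps)
    qed
    show "\<forall>\<^sub>F x in at z. ?f x \<le> (1 + norm (z - x) / snd x) powr \<mu> * ?f z"
      using ev by eventually_elim (rule le[OF _ z])
    have "((\<lambda>x. (1 + norm (x - z) / snd z) powr - \<mu> * ?f z) \<longlongrightarrow> (1 + norm (z - z) / snd z) powr - \<mu> * ?f z) (at z)"
      using z by (intro tendsto_intros) auto
    then show "((\<lambda>x. (1 + norm (x - z) / snd z) powr - \<mu> * ?f z) \<longlongrightarrow> ?f z) (at z)"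
      by simp
    have "((\<lambda>x. (1 + norm (z - x) / snd x) powr \<mu> * ?f z) \<longlongrightarrow> (1 + norm (z - z) / snd z) powr \<mu> * ?f z) (at z)"
      using z by (intro tendsto_intros) auto
    then show "((\<lambda>x. (1 + norm (z - x) / snd x) powr \<mu> * ?f z) \<longlongrightarrow> ?f z) (at z)"
      by simp
  qed
qed

lemma isCont_v:
  assumes z: "0 < snd z"
  shows "isCont (\<lambda>x. enn2real (v x)) z"
proof -
  have "isCont (\<lambda>x. norm x powr - \<beta> * snd x powr lam * enn2real (\<phi> x)) z"
    using z by (intro continuous_intros isCont_\<phi>) auto
  moreover have "\<forall>\<^sub>F x in nhds z. 0 < snd x"
    using eventually_nhds_in_open[OF open_upper, of z] z by simp
  then have "\<forall>\<^sub>F x in nhds z. enn2real (v x) = norm x powr - \<beta> * snd x powr lam * enn2real (\<phi> x)"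
    by eventually_elim (simp add: v_eq_\<phi> enn2real_mult)
  ultimately show ?thesis
    by (simp cong: isCont_cong)
qed

section \<open>A solution and its reflection\<close>

context
  fixes e :: "real^'m" and \<sigma> :: real
  assumes e: "norm e = 1" and \<sigma>: "\<sigma> \<le> 0"
begin

abbreviation "R \<equiv> reflect e \<sigma>"
abbreviation "R' \<equiv> reflect (e, 0 :: real) \<sigma>"

lemma norm_e0: "norm (e, 0 :: real) = 1"
  using e by simp

text \<open>The inner weight and the kernel are compared, the outer weight stays at
  \<open>y\<close>. Its increase on passing to \<open>R y\<close> is a separate gain, kept in
  reserve; in the analogous bound for v this is what yields strict inequality.\<close>

lemma u_le_reflect:
  assumes [measurable]: "V \<in> borel_measurable borel"
    and V: "\<And>x. ennreal_powr (v x) q \<le> V x" "\<And>x. x \<bullet> (e, 0) < \<sigma> \<Longrightarrow> ennreal_powr (v x) q \<le> V (R' x)"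
    and y: "y \<bullet> e < \<sigma>"
  shows "u y \<le> singular_weight \<alpha> y * (\<integral>\<^sup>+x. K x (R y) * singular_weight \<beta> x * V x \<partial>lborel)"
  unfolding u_formula[of y] half_space_kernel_reflect[OF e, symmetric]
  using e y \<sigma> \<beta> \<mu> V
  by (intro mult_left_mono nn_integral_reflect_kernel_le norm_e0)
    (auto intro!: half_space_kernel_reflect_le singular_weight_reflect_le norm_e0)

lemma v_le_reflect:
  assumes [measurable]: "U \<in> borel_measurable borel"
    and U: "\<And>y. ennreal_powr (u y) p \<le> U y" "\<And>y. y \<bullet> e < \<sigma> \<Longrightarrow> ennreal_powr (u y) p \<le> U (R y)"
    and x: "x \<bullet> (e, 0) < \<sigma>"
  shows "v x \<le> singular_weight \<beta> x * (\<integral>\<^sup>+y. K (R' x) y * singular_weight \<alpha> y * U y \<partial>lborel)"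
  unfolding v_formula[of x] half_space_kernel_reflect[OF e]
  using e x \<sigma> \<alpha> \<mu> U
  by (intro mult_left_mono nn_integral_reflect_kernel_le e)
    (auto intro!: half_space_kernel_reflect_le[OF e, unfolded half_space_kernel_reflect[OF e]] singular_weight_reflect_le)

lemma u_reflect_mono:
  assumes v: "\<And>x. x \<bullet> (e, 0) < \<sigma> \<Longrightarrow> v x \<le> v (R' x)" and y: "y \<bullet> e < \<sigma>"
  shows "u y \<le> u (R y)"
proof -
  have "u y \<le> singular_weight \<alpha> y * (\<integral>\<^sup>+x. K x (R y) * singular_weight \<beta> x * ennreal_powr (v x) q \<partial>lborel)"
    using v q by (intro u_le_reflect y) (auto intro: ennreal_powr_mono)
  also have "\<dots> \<le> u (R y)"
    unfolding u_formula[of "R y"] using e \<sigma> \<alpha> y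
    by (intro mult_right_mono singular_weight_reflect_le) auto
  finally show ?thesis .
qed

lemma singular_weight_reflect_less:
  assumes x: "x \<bullet> (e, 0) < \<sigma>" "0 < snd x" and "\<sigma> < 0"
  shows "singular_weight \<beta> x < singular_weight \<beta> (R' x)"
proof -
  have "0 < 4 * ((x \<bullet> (e, 0) - \<sigma>) * \<sigma>)"
    using x \<open>\<sigma> < 0\<close> by (simp add: mult_neg_neg)
  then have "(norm (R' x))\<^sup>2 < (norm x)\<^sup>2"
    using norm_reflect_sq[OF norm_e0, of \<sigma> x] by (simp add: mult_ac)
  then have "norm (R' x) < norm x"
    by (rule power2_less_imp_less) simp
  moreover have "R' x \<noteq> 0" "x \<noteq> 0"
    using x by (auto simp: reflect_half_space zero_prod_def)
  ultimately show ?thesis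
    using \<beta> by (simp add: singular_weight_eq ennreal_less_iff powr_less_mono2_neg)
qed

text \<open>Strictness comes from the outer weight |x|^(-\<beta>) alone, which grows strictly since
  \<sigma> < 0. The remaining integral must be neither 0 nor infinite to preserve it: positivity of
  v at x and finiteness of v at \<open>R' x\<close> ensure this.\<close>

lemma v_reflect_strict_mono:
  assumes u: "\<And>y. y \<bullet> e < \<sigma> \<Longrightarrow> u y \<le> u (R y)" and x: "x \<bullet> (e, 0) < \<sigma>" "0 < snd x" and "\<sigma> < 0"
  shows "v x < v (R' x)"
proof -
  let ?I = "\<integral>\<^sup>+y. K (R' x) y * singular_weight \<alpha> y * ennreal_powr (u y) p \<partial>lborel"
  have le: "v x \<le> singular_weight \<beta> x * ?I"
    using u p by (intro v_le_reflect x) (auto intro: ennreal_powr_mono)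
  have "0 < v x"
    by (rule v_pos[OF x(2)])
  then have "?I \<noteq> 0"
    using le by auto
  have "v (R' x) < top" "v (R' x) = singular_weight \<beta> (R' x) * ?I"
    by (rule v_less_top) (rule v_formula)
  moreover have "?I \<noteq> top"
    using calculation singular_weight_pos[of \<beta> "R' x"] by (auto simp: ennreal_mult_top zero_less_iff_neq_zero)
  ultimately show ?thesis
    using le \<open>?I \<noteq> 0\<close> singular_weight_reflect_less[OF x \<open>\<sigma> < 0\<close>]
    by (auto intro!: le_less_trans[OF le] ennreal_mult_strict_right_mono simp: less_top zero_less_iff_neq_zero)
qed

lemma u_diff_le:
  assumes y: "y \<bullet> e < \<sigma>"
  shows "u y \<le> u (R y) + (\<integral>\<^sup>+x. G x y * ((ennreal_powr (v x) q - ennreal_powr (v (R' x)) q) *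
    indicator {x. x \<bullet> (e, 0) < \<sigma>} x) \<partial>lborel)"
proof -
  let ?D = "\<lambda>x. (ennreal_powr (v x) q - ennreal_powr (v (R' x)) q) * indicator {x. x \<bullet> (e, 0) < \<sigma>} x"
  have "u y \<le> singular_weight \<alpha> y * ((\<integral>\<^sup>+x. K x (R y) * singular_weight \<beta> x * ennreal_powr (v x) q \<partial>lborel) +
      (\<integral>\<^sup>+x. K x y * singular_weight \<beta> x * ?D x \<partial>lborel))"
    unfolding u_formula[of y] half_space_kernel_reflect[OF e, symmetric]
    using e y \<sigma> \<beta> \<mu>
    by (intro mult_left_mono nn_integral_reflect_kernel_diff norm_e0)
      (auto intro!: half_space_kernel_reflect_le singular_weight_reflect_le norm_e0)
  also have "\<dots> = singular_weight \<alpha> y * (\<integral>\<^sup>+x. K x (R y) * singular_weight \<beta> x * ennreal_powr (v x) q \<partial>lborel) +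
      (\<integral>\<^sup>+x. G x y * ?D x \<partial>lborel)"
    by (subst distrib_left, subst (2) nn_integral_cmult[symmetric]) (auto simp: G_def mult_ac)
  also have "\<dots> \<le> u (R y) + (\<integral>\<^sup>+x. G x y * ?D x \<partial>lborel)"
    unfolding u_formula[of "R y"] using e \<sigma> \<alpha> y
    by (intro add_right_mono mult_right_mono singular_weight_reflect_le) auto
  finally show ?thesis .
qed

lemma v_diff_le:
  assumes x: "x \<bullet> (e, 0) < \<sigma>"
  shows "v x \<le> v (R' x) + (\<integral>\<^sup>+y. G x y * ((ennreal_powr (u y) p - ennreal_powr (u (R y)) p) *
    indicator {y. y \<bullet> e < \<sigma>} y) \<partial>lborel)"
proof -
  let ?D = "\<lambda>y. (ennreal_powr (u y) p - ennreal_powr (u (R y)) p) * indicator {y. y \<bullet> e < \<sigma>} y"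
  have "v x \<le> singular_weight \<beta> x * ((\<integral>\<^sup>+y. K (R' x) y * singular_weight \<alpha> y * ennreal_powr (u y) p \<partial>lborel) +
      (\<integral>\<^sup>+y. K x y * singular_weight \<alpha> y * ?D y \<partial>lborel))"
    unfolding v_formula[of x] half_space_kernel_reflect[OF e]
    using e x \<sigma> \<alpha> \<mu>
    by (intro mult_left_mono nn_integral_reflect_kernel_diff e)
      (auto intro!: half_space_kernel_reflect_le[OF e, unfolded half_space_kernel_reflect[OF e]] singular_weight_reflect_le)
  also have "\<dots> = singular_weight \<beta> x * (\<integral>\<^sup>+y. K (R' x) y * singular_weight \<alpha> y * ennreal_powr (u y) p \<partial>lborel) +
      (\<integral>\<^sup>+y. G x y * ?D y \<partial>lborel)"
    by (subst distrib_left, subst (2) nn_integral_cmult[symmetric]) (auto simp: G_def mult_ac)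
  also have "\<dots> \<le> v (R' x) + (\<integral>\<^sup>+y. G x y * ?D y \<partial>lborel)"
    unfolding v_formula[of "R' x"] using norm_e0 \<sigma> \<beta> x
    by (intro add_right_mono mult_right_mono singular_weight_reflect_le) auto
  finally show ?thesis .
qed

end

end

text \<open>Dominated convergence in the form used for moving planes: the bad sets need not shrink
  monotonically, it suffices that almost every point eventually leaves them.\<close>

lemma nn_integral_vanishing:
  assumes [measurable]: "f \<in> borel_measurable M" "\<And>k. E k \<in> sets M"
    and fin: "(\<integral>\<^sup>+x. f x \<partial>M) < top" and E: "AE x in M. \<forall>\<^sub>F k in sequentially. x \<notin> E k"
  shows "(\<lambda>k. \<integral>\<^sup>+x. f x * indicator (E k) x \<partial>M) \<longlonglongrightarrow> 0"
proof -
  have "(\<lambda>k. \<integral>\<^sup>+x. f x * indicator (E k) x \<partial>M) \<longlonglongrightarrow> (\<integral>\<^sup>+x. 0 \<partial>M)"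
  proof (rule nn_integral_dominated_convergence[where w=f])
    show "AE x in M. (\<lambda>k. f x * indicator (E k) x) \<longlonglongrightarrow> 0"
      using E
    proof eventually_elim
      case (elim x)
      then have "\<forall>\<^sub>F k in sequentially. f x * indicator (E k) x = 0"
        by eventually_elim simp
      then show ?case
        by (rule tendsto_eventually)
    qed
  qed (use fin in \<open>auto split: split_indicator\<close>)
  then show ?thesis by simp
qed

section \<open>Relative defects and envelopes\<close>

lemma one_minus_powr_le:
  fixes t s :: real
  assumes "0 \<le> t" "t \<le> 1" "0 < s"
  shows "1 - t powr s \<le> max 1 s * (1 - t)"
proof (cases "t = 0 \<or> s \<le> 1")
  case True
  then have "t \<le> t powr s"
    using assms powr_mono'[of s 1 t] by auto
  moreover have "1 - t \<le> max 1 s * (1 - t)"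
    using assms mult_right_mono[of 1 "max 1 s" "1 - t"] by simp
  ultimately show ?thesis by linarith
next
  case False
  \<comment> \<open>Bernoulli's inequality, obtained as Young's inequality for t^s and 1 with
    weights 1/s and 1 - 1/s.\<close>
  then have "t \<le> 1 / s * t powr s + (1 - 1 / s)"
    using Youngs_inequality_0[of "1 / s" "1 - 1 / s" "t powr s" 1] assms
    by (simp add: powr_powr)
  then have "s * t \<le> s * (1 / s * t powr s + (1 - 1 / s))"
    using assms by (intro mult_left_mono) auto
  then show ?thesis
    using False assms by (simp add: algebra_simps max_def)
qed

text \<open>Linearisation at the larger value \<open>a\<close>. Measuring the defect relative to
  \<open>a\<close> keeps the factor bounded also for s < 1, where the derivative of t^s is unbounded
  near 0.\<close>

lemma ennreal_powr_diff_le: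
  assumes "0 < s" "a < top" and c: "max 1 s \<le> c"
  shows "ennreal_powr a s - ennreal_powr b s \<le> ennreal c * (ennreal_powr a s * ((a - b) / a))"
proof (cases "a \<le> b \<or> a = 0")
  case True
  then have "ennreal_powr a s - ennreal_powr b s = 0"
    using assms by (auto simp: diff_eq_0_iff_ennreal intro: ennreal_powr_mono)
  then show ?thesis by simp
next
  case False
  then obtain x y where xy: "a = ennreal x" "b = ennreal y" "0 < x" "0 \<le> y" "y \<le> x"
    using assms by (cases a; cases b) (auto simp: less_le)
  have "1 - (y / x) powr s \<le> max 1 s * (1 - y / x)"
    using xy assms by (intro one_minus_powr_le) auto
  also have "\<dots> \<le> c * (1 - y / x)"
    using xy c by (intro mult_right_mono) auto
  finally have "x powr s * (1 - (y / x) powr s) \<le> x powr s * (c * (1 - y / x))"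
    by (intro mult_left_mono) auto
  then have "x powr s - y powr s \<le> c * (x powr s * ((x - y) / x))"
    using xy by (simp add: powr_divide right_diff_distrib diff_divide_distrib mult_ac)
  moreover have "0 \<le> c"
    using c by simp
  ultimately show ?thesis
    using xy by (simp add: ennreal_powr_ennreal ennreal_minus divide_ennreal ennreal_leI flip: ennreal_mult)
qed

lemma ennreal_relative_diff_le_1: "(a - b) / a \<le> (1 :: ennreal)"
proof (cases "a = 0 \<or> a = top")
  case False
  have "(a - b) / a \<le> a / a"
    by (intro divide_right_mono_ennreal) (simp add: diff_le_self_ennreal)
  also have "\<dots> = 1"
    using False by (simp add: less_top)
  finally show ?thesis .
qed (auto simp: divide_ennreal_def ennreal_mult_eq_top_iff)

lemma ennreal_mult_ratio: "0 < a \<Longrightarrow> a < top \<Longrightarrow> a * (b / a) = (b :: ennreal)"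
  using mult_divide_eq_ennreal[of a b] by (auto simp: ennreal_times_divide mult.commute)

lemma ennreal_mult_relative_diff: "0 < a \<Longrightarrow> a < top \<Longrightarrow> a * ((a - b) / a) = a - (b :: ennreal)"
  by (rule ennreal_mult_ratio)

text \<open>
  \<open>f y * reflect_ratio e \<sigma> f y\<close> is the larger one of the values of \<open>f\<close> at \<open>y\<close> and at its mirror
  image when \<open>y\<close> is on the far side of the mirror, and \<open>f y\<close> on the near side.
\<close>

definition reflect_ratio :: "'a::real_inner \<Rightarrow> real \<Rightarrow> ('a \<Rightarrow> ennreal) \<Rightarrow> 'a \<Rightarrow> ennreal" where
  "reflect_ratio e \<sigma> f y = (if y \<bullet> e < \<sigma> then 1 else max 1 (f (reflect e \<sigma> y) / f y))"

lemma measurable_reflect_ratio [measurable]: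
  fixes e :: "'a::euclidean_space"
  assumes [measurable]: "f \<in> borel_measurable borel"
  shows "reflect_ratio e \<sigma> f \<in> borel_measurable borel"
  unfolding reflect_ratio_def[abs_def] by measurable

text \<open>The side conditions guard the quotient in \<open>reflect_ratio\<close>: where f
  vanishes, a product with f is 0 whatever the ratio is. They hold for v because reflections
  preserve the half space, outside of which v is 0.\<close>

lemma upper_envelope:
  fixes f :: "'b::euclidean_space \<Rightarrow> ennreal" and e :: 'b and \<sigma> :: real
  assumes e: "norm e = 1"
  defines "r \<equiv> reflect_ratio e \<sigma> f"
  shows "1 \<le> r y" "f y \<le> f y * r y"
    "\<not> y \<bullet> e < \<sigma> \<Longrightarrow> 0 < f y \<Longrightarrow> f y < top \<Longrightarrow> f y * r y = max (f y) (f (reflect e \<sigma> y))"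
    "y \<bullet> e < \<sigma> \<Longrightarrow> 0 < f (reflect e \<sigma> y) \<or> f y = 0 \<Longrightarrow> f y \<le> f (reflect e \<sigma> y) * r (reflect e \<sigma> y)"
proof -
  show 1: "1 \<le> r y" for y
    by (simp add: r_def reflect_ratio_def)
  show 2: "f y \<le> f y * r y"
    using mult_left_mono[OF 1, of "f y" y] by simp
  show 3: "f y * r y = max (f y) (f (reflect e \<sigma> y))" if "\<not> y \<bullet> e < \<sigma>" "0 < f y" "f y < top" for y
  proof -
    define t where "t = f (reflect e \<sigma> y) / f y"
    have t: "f (reflect e \<sigma> y) = f y * t"
      unfolding t_def using ennreal_mult_ratio that by simp
    have "f y * max 1 t = max (f y) (f (reflect e \<sigma> y))"
      unfolding t
      using mult_left_mono[of 1 t "f y"] mult_left_mono[of t 1 "f y"]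
      by (cases "1 \<le> t") (auto simp: max_def)
    then show ?thesis
      using that by (simp add: r_def reflect_ratio_def flip: t_def)
  qed
  show "f y \<le> f (reflect e \<sigma> y) * r (reflect e \<sigma> y)"
    if "y \<bullet> e < \<sigma>" "0 < f (reflect e \<sigma> y) \<or> f y = 0"
  proof (cases "f y = 0 \<or> f (reflect e \<sigma> y) = top")
    case True
    then show ?thesis
      using 1[of "reflect e \<sigma> y"] by (auto simp: ennreal_top_mult)
  next
    case False
    then show ?thesis
      using 3[of "reflect e \<sigma> y"] that e by (auto simp: reflect_inner less_top)
  qed
qed

section \<open>The reflection inequality from a small defect, and for
  \<open>p * q \<le> 1\<close>\<close>

context half_space_system
begin

text \<open>\<open>small_support_imp_zero\<close> for the relative defects. The threshold \<eta> is
  fixed before e and \<sigma>, so the same one serves every position of the plane.\<close>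

lemma small_reflection_defect:
  fixes C1 C2 :: real and G1 G2 :: "(real^'m) \<times> real \<Rightarrow> real^'m \<Rightarrow> ennreal"
  assumes pq: "1 < p * q"
    and schur: "case_prod G1 \<in> borel_measurable (lborel \<Otimes>\<^sub>M lborel)" "case_prod G2 \<in> borel_measurable (lborel \<Otimes>\<^sub>M lborel)"
      "AE y in lborel. AE x in lborel. G x y \<le> ennreal_powr (G1 x y) (1 / (p + 1)) * ennreal_powr (G2 x y) (1 / (q + 1))"
      "AE x in lborel. (\<integral>\<^sup>+y. G1 x y \<partial>lborel) \<le> ennreal C1" "AE y in lborel. (\<integral>\<^sup>+x. G2 x y \<partial>lborel) \<le> ennreal C2"
  obtains \<eta> where "0 < \<eta>"
    "\<And>e \<sigma> x. norm e = 1 \<Longrightarrow> \<sigma> \<le> 0 \<Longrightarrow>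
      (\<integral>\<^sup>+x. ennreal_powr (v x) (q + 1) * indicator {x. x \<bullet> (e, 0) < \<sigma> \<and> v (reflect (e, 0) \<sigma> x) < v x} x \<partial>lborel) < ennreal \<eta> \<Longrightarrow>
      x \<bullet> (e, 0) < \<sigma> \<Longrightarrow> v x \<le> v (reflect (e, 0) \<sigma> x)"
proof -
  \<comment> \<open>A common constant for the linearisations of t^p and t^q.\<close>
  define c where "c = max 1 (max p q)"
  obtain \<eta> where \<eta>: "0 < \<eta>" and small: "\<And>\<rho> \<tau>. \<rho> \<in> borel_measurable lborel \<Longrightarrow> \<tau> \<in> borel_measurable lborel \<Longrightarrow>
      (\<And>y. \<rho> y \<le> 1) \<Longrightarrow>
      AE y in lborel. u y * \<rho> y \<le> ennreal c * (\<integral>\<^sup>+x. G x y * (ennreal_powr (v x) q * \<tau> x) \<partial>lborel) \<Longrightarrow>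
      AE x in lborel. v x * \<tau> x \<le> ennreal c * (\<integral>\<^sup>+y. G x y * (ennreal_powr (u y) p * \<rho> y) \<partial>lborel) \<Longrightarrow>
      (\<integral>\<^sup>+x. ennreal_powr (v x) (q + 1) * indicator {x. 0 < \<tau> x} x \<partial>lborel) < ennreal \<eta> \<Longrightarrow>
      AE y in lborel. u y * \<rho> y = 0"
    using small_support_imp_zero[OF pq schur u_int] by blast
  show thesis
  proof (rule that[OF \<eta>])
    fix e :: "real^'m" and \<sigma> :: real and x :: "(real^'m) \<times> real"
    assume e: "norm e = 1" and \<sigma>: "\<sigma> \<le> 0" and x: "x \<bullet> (e, 0) < \<sigma>"
      and m: "(\<integral>\<^sup>+x. ennreal_powr (v x) (q + 1) *
        indicator {x. x \<bullet> (e, 0) < \<sigma> \<and> v (reflect (e, 0) \<sigma> x) < v x} x \<partial>lborel) < ennreal \<eta>"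
    let ?R = "reflect e \<sigma>" and ?R' = "reflect (e, 0 :: real) \<sigma>"
    define \<rho> where "\<rho> y = (u y - u (?R y)) / u y * indicator {y. y \<bullet> e < \<sigma>} y" for y
    define \<tau> where "\<tau> x = (v x - v (?R' x)) / v x * indicator {x. x \<bullet> (e, 0) < \<sigma>} x" for x
    have [measurable]: "\<rho> \<in> borel_measurable borel" "\<tau> \<in> borel_measurable borel"
      unfolding \<rho>_def \<tau>_def by measurable
    have "AE y in lborel. u y * \<rho> y = 0"
    proof (rule small)
      show "\<rho> y \<le> 1" for y
        by (simp add: \<rho>_def ennreal_relative_diff_le_1 split: split_indicator)
      show "AE y in lborel. u y * \<rho> y \<le> ennreal c * (\<integral>\<^sup>+x. G x y * (ennreal_powr (v x) q * \<tau> x) \<partial>lborel)"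
        using u_finite
      proof eventually_elim
        case (elim y)
        show ?case
        proof (cases "y \<bullet> e < \<sigma>")
          case True
          have "u y * \<rho> y = u y - u (?R y)"
            using True u_pos[of y] elim by (simp add: \<rho>_def ennreal_mult_relative_diff)
          also have "\<dots> \<le> (\<integral>\<^sup>+x. G x y * ((ennreal_powr (v x) q - ennreal_powr (v (?R' x)) q) *
              indicator {x. x \<bullet> (e, 0) < \<sigma>} x) \<partial>lborel)"
            using u_diff_le[OF e \<sigma> True] elim by (intro ennreal_minus_le_iff[THEN iffD2]) auto
          also have "\<dots> \<le> (\<integral>\<^sup>+x. ennreal c * (G x y * (ennreal_powr (v x) q * \<tau> x)) \<partial>lborel)"
          proof (rule nn_integral_mono)
            fix x
            show "G x y * ((ennreal_powr (v x) q - ennreal_powr (v (?R' x)) q) * indicator {x. x \<bullet> (e, 0) < \<sigma>} x) \<le>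
                ennreal c * (G x y * (ennreal_powr (v x) q * \<tau> x))"
              using mult_left_mono[OF ennreal_powr_diff_le[OF q v_less_top, of c x "v (?R' x)"], of "G x y"]
              by (auto simp: \<tau>_def c_def mult_ac split: split_indicator)
          qed
          also have "\<dots> = ennreal c * (\<integral>\<^sup>+x. G x y * (ennreal_powr (v x) q * \<tau> x) \<partial>lborel)"
            by (rule nn_integral_cmult) (simp add: G_def)
          finally show ?thesis .
        qed (simp add: \<rho>_def)
      qed
      show "AE x in lborel. v x * \<tau> x \<le> ennreal c * (\<integral>\<^sup>+y. G x y * (ennreal_powr (u y) p * \<rho> y) \<partial>lborel)"
      proof (rule AE_I2)
        fix x
        show "v x * \<tau> x \<le> ennreal c * (\<integral>\<^sup>+y. G x y * (ennreal_powr (u y) p * \<rho> y) \<partial>lborel)"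
        proof (cases "x \<bullet> (e, 0) < \<sigma> \<and> 0 < v x")
          case True
          have "v x * \<tau> x = v x - v (?R' x)"
            using True v_less_top[of x] by (simp add: \<tau>_def ennreal_mult_relative_diff)
          also have "\<dots> \<le> (\<integral>\<^sup>+y. G x y * ((ennreal_powr (u y) p - ennreal_powr (u (?R y)) p) *
              indicator {y. y \<bullet> e < \<sigma>} y) \<partial>lborel)"
            using v_diff_le[OF e \<sigma>, of x] v_less_top[of x] True by (intro ennreal_minus_le_iff[THEN iffD2]) auto
          also have "\<dots> \<le> (\<integral>\<^sup>+y. ennreal c * (G x y * (ennreal_powr (u y) p * \<rho> y)) \<partial>lborel)"
          proof (rule nn_integral_mono_AE, use u_finite in eventually_elim)
            case (elim y)
            then show ?case
              using mult_left_mono[OF ennreal_powr_diff_le[OF p, of "u y" c "u (?R y)"], of "G x y"]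
              by (auto simp: \<rho>_def c_def mult_ac split: split_indicator)
          qed
          also have "\<dots> = ennreal c * (\<integral>\<^sup>+y. G x y * (ennreal_powr (u y) p * \<rho> y) \<partial>lborel)"
            by (rule nn_integral_cmult) (simp add: G_def)
          finally show ?thesis .
        qed (auto simp: \<tau>_def zero_less_iff_neq_zero)
      qed
      have "(\<integral>\<^sup>+x. ennreal_powr (v x) (q + 1) * indicator {x. 0 < \<tau> x} x \<partial>lborel) \<le>
          (\<integral>\<^sup>+x. ennreal_powr (v x) (q + 1) *
            indicator {x. x \<bullet> (e, 0) < \<sigma> \<and> v (?R' x) < v x} x \<partial>lborel)"
      proof (rule nn_integral_mono)
        fix x
        have "x \<bullet> (e, 0) < \<sigma> \<and> v (?R' x) < v x" if "0 < \<tau> x"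
        proof -
          have "x \<bullet> (e, 0) < \<sigma>" "v x - v (?R' x) \<noteq> 0"
            using that by (auto simp: \<tau>_def split: split_indicator_asm)
          then show ?thesis
            using v_less_top[of x] by (auto simp: diff_eq_0_iff_ennreal)
        qed
        then show "ennreal_powr (v x) (q + 1) * indicator {x. 0 < \<tau> x} x \<le> ennreal_powr (v x) (q + 1) *
            indicator {x. x \<bullet> (e, 0) < \<sigma> \<and> v (?R' x) < v x} x"
          by (auto split: split_indicator)
      qed
      then show "(\<integral>\<^sup>+x. ennreal_powr (v x) (q + 1) * indicator {x. 0 < \<tau> x} x \<partial>lborel) < ennreal \<eta>"
        using m by (rule le_less_trans)
    qed auto
    \<comment> \<open>The defect of u vanishes only almost everywhere, but it enters the inequality
      for v under an integral; so the conclusion for v holds at every point.\<close>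
    then have "AE y in lborel. G x y * ((ennreal_powr (u y) p - ennreal_powr (u (?R y)) p) *
        indicator {y. y \<bullet> e < \<sigma>} y) = 0"
      using u_finite
    proof eventually_elim
      case (elim y)
      then have "y \<bullet> e < \<sigma> \<Longrightarrow> u y \<le> u (?R y)"
        using u_pos[of y] by (auto simp: \<rho>_def ennreal_mult_relative_diff diff_eq_0_iff_ennreal)
      then show ?case
        using elim p by (auto simp: diff_eq_0_iff_ennreal ennreal_powr_mono split: split_indicator)
    qed
    then have "(\<integral>\<^sup>+y. G x y * ((ennreal_powr (u y) p - ennreal_powr (u (?R y)) p) *
        indicator {y. y \<bullet> e < \<sigma>} y) \<partial>lborel) = 0"
      by (subst nn_integral_0_iff_AE) (auto simp: G_def)
    then show "v x \<le> v (?R' x)"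
      using v_diff_le[OF e \<sigma> x] by simp
  qed
qed

lemma u_eq_G: "u y = (\<integral>\<^sup>+x. G x y * ennreal_powr (v x) q \<partial>lborel)"
  by (subst u_formula, subst nn_integral_cmult[symmetric]) (auto simp: G_def mult_ac)

lemma v_eq_G: "v x = (\<integral>\<^sup>+y. G x y * ennreal_powr (u y) p \<partial>lborel)"
  by (subst v_formula, subst nn_integral_cmult[symmetric]) (auto simp: G_def mult_ac)

text \<open>By continuity of v a violation at one point would persist on an open set, which cannot
  be null. The hypothesis is put on the side \<sigma> < z \<bullet> (e, 0) because that is where the
  envelope differs from v.\<close>

lemma v_reflect_le_closure:
  assumes e: "norm e = 1" and x: "x \<bullet> (e, 0) < \<sigma>"
    and ae: "AE z in lborel. \<sigma> < z \<bullet> (e, 0) \<longrightarrow> 0 < snd z \<longrightarrow> v (reflect (e, 0) \<sigma> z) \<le> v z"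
  shows "v x \<le> v (reflect (e, 0) \<sigma> x)"
proof (cases "0 < snd x")
  case True
  let ?R = "reflect (e, 0 :: real) \<sigma>"
  define z where "z = ?R x"
  have e0: "norm (e, 0 :: real) = 1"
    using e by simp
  have z: "\<sigma> < z \<bullet> (e, 0)" "0 < snd z" "?R z = x" and sR: "snd (?R w) = snd w" for w
    using x True e0 by (simp_all add: z_def reflect_inner[OF e0] del: inner_Pair) (simp_all add: reflect_half_space)
  show ?thesis
  proof (rule ccontr)
    assume "\<not> v x \<le> v (reflect (e, 0) \<sigma> x)"
    then have "v z < v (?R z)"
      by (simp add: z(3)) (simp add: z_def)
    then have *: "enn2real (v z) < enn2real (v (?R z))"
      using v_less_top[of z] v_less_top[of "?R z"]
      by (cases "v z"; cases "v (?R z)") (auto simp: ennreal_less_iff)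
    have R: "isCont ?R z"
      unfolding reflect_def by (intro continuous_intros)
    define h where "h w = enn2real (v (?R w)) - enn2real (v w)" for w
    have "isCont (\<lambda>w. enn2real (v (?R w))) z"
      using z(2) by (intro isCont_o2[OF R isCont_v]) (simp only: sR)
    moreover have "isCont (\<lambda>w. enn2real (v w)) z"
      using z by (intro isCont_v)
    ultimately have "isCont h z"
      unfolding h_def by (intro continuous_intros)
    then have "(h \<longlongrightarrow> h z) (nhds z)"
      unfolding isCont_def tendsto_at_iff_tendsto_nhds .
    moreover have "0 < h z"
      using * by (simp add: h_def)
    ultimately have "\<forall>\<^sub>F w in nhds z. 0 < h w"
      by (rule order_tendstoD(1))
    moreover have "open {w :: (real^'m) \<times> real. 0 < snd w \<and> \<sigma> < w \<bullet> (e, 0)}"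
      by (intro open_Collect_conj open_Collect_less continuous_intros)
    then have "\<forall>\<^sub>F w in nhds z. 0 < snd w \<and> \<sigma> < w \<bullet> (e, 0)"
      using z eventually_nhds_in_open[of "{w. 0 < snd w \<and> \<sigma> < w \<bullet> (e, 0)}" z] by (simp del: inner_Pair)
    ultimately have "\<forall>\<^sub>F w in nhds z. 0 < snd w \<and> \<sigma> < w \<bullet> (e, 0) \<and> v w < v (?R w)"
      by eventually_elim (use v_less_top enn2real_mono in \<open>fastforce simp: h_def not_le[symmetric] less_top\<close>)
    then obtain S where S: "open S" "z \<in> S"
      "\<And>w. w \<in> S \<Longrightarrow> 0 < snd w \<and> \<sigma> < w \<bullet> (e, 0) \<and> v w < v (?R w)"
      unfolding eventually_nhds by blast
    from AE_lborel_open_ex[OF S(1,2) ae] obtain w where "w \<in> S"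
      "\<sigma> < w \<bullet> (e, 0) \<longrightarrow> 0 < snd w \<longrightarrow> v (?R w) \<le> v w" .
    with S(3)[of w] show False
      using leD by blast
  qed
qed (simp add: v_outside)

lemma v_reflect_le_sublinear:
  assumes pq: "p * q \<le> 1" and e: "norm e = 1" and \<sigma>: "\<sigma> < 0" and x: "x \<bullet> (e, 0) < \<sigma>"
  shows "v x \<le> v (reflect (e, 0) \<sigma> x)"
proof (rule v_reflect_le_closure[OF e x])
  let ?R = "reflect e \<sigma>" and ?R' = "reflect (e, 0 :: real) \<sigma>"
  have e0: "norm (e, 0 :: real) = 1"
    using e by simp
  define \<rho> where "\<rho> = reflect_ratio e \<sigma> u"
  define \<tau> where "\<tau> = reflect_ratio (e, 0 :: real) \<sigma> v"
  have [measurable]: "\<rho> \<in> borel_measurable borel" "\<tau> \<in> borel_measurable borel"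
    unfolding \<rho>_def \<tau>_def by measurable
  have v0: "0 < v (?R' x) \<or> v x = 0" for x
    using v_pos[of "?R' x"] v_outside[of x] by (cases "0 < snd x") (auto simp: reflect_half_space)
  note \<rho> = upper_envelope[OF e, where f=u and \<sigma>=\<sigma>, folded \<rho>_def]
  note \<tau> = upper_envelope[OF e0, where f=v and \<sigma>=\<sigma>, folded \<tau>_def]
  let ?U = "\<lambda>y. ennreal_powr (u y * \<rho> y) p" and ?V = "\<lambda>x. ennreal_powr (v x * \<tau> x) q"
  have U: "ennreal_powr (u y) p \<le> ?U y" "y \<bullet> e < \<sigma> \<Longrightarrow> ennreal_powr (u y) p \<le> ?U (?R y)" for y
    using \<rho>(2,4)[of y] u_pos[of "?R y"] p by (auto intro: ennreal_powr_mono)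
  have V: "ennreal_powr (v x) q \<le> ?V x" "x \<bullet> (e, 0) < \<sigma> \<Longrightarrow> ennreal_powr (v x) q \<le> ?V (?R' x)" for x
    using \<tau>(2,4)[of x] v0[of x] q by (auto intro: ennreal_powr_mono simp del: inner_Pair)
  have "AE x in lborel. v x * \<tau> x = (\<integral>\<^sup>+y. G x y * ?U y \<partial>lborel)"
  proof (rule subsolution_eq[OF pq])
    have "e \<noteq> 0" using e by auto
    from AE_lborel_hyperplane[OF this, of \<sigma>] u_finite
    show "AE y in lborel. u y * \<rho> y \<le> (\<integral>\<^sup>+x. G x y * ?V x \<partial>lborel)"
    proof eventually_elim
      case (elim y)
      have le: "u y \<le> (\<integral>\<^sup>+x. G x y * ?V x \<partial>lborel)"
        unfolding u_eq_G[of y] using V by (intro nn_integral_mono mult_left_mono) auto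
      show ?case
      proof (cases "y \<bullet> e < \<sigma>")
        case True
        then show ?thesis
          using le by (simp add: \<rho>_def reflect_ratio_def)
      next
        case False
        then have Ry: "?R y \<bullet> e < \<sigma>"
          using elim e by (simp add: reflect_inner)
        \<comment> \<open>On the near side the envelope may take the value u(R y). It satisfies the
          bound with kernel at y and weight at R y, and the weight only grows when moved to
          y.\<close>
        have "u (?R y) \<le> singular_weight \<alpha> (?R y) * (\<integral>\<^sup>+x. K x y * singular_weight \<beta> x * ?V x \<partial>lborel)"
          using u_le_reflect[OF e _ _ V Ry] \<sigma> e by simp
        also have "\<dots> \<le> singular_weight \<alpha> y * (\<integral>\<^sup>+x. K x y * singular_weight \<beta> x * ?V x \<partial>lborel)"
          using singular_weight_reflect_le[OF e _ Ry, of \<alpha>] \<sigma> \<alpha> e by (intro mult_right_mono) auto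
        also have "\<dots> = (\<integral>\<^sup>+x. G x y * ?V x \<partial>lborel)"
          by (subst nn_integral_cmult[symmetric]) (auto simp: G_def mult_ac)
        finally show ?thesis
          using le \<rho>(3)[OF False u_pos elim(2)] by simp
      qed
    qed
    have "(e, 0 :: real) \<noteq> 0" using e by (auto simp: zero_prod_def)
    from AE_lborel_hyperplane[OF this, of \<sigma>]
    show "AE x in lborel. v x * \<tau> x \<le> (\<integral>\<^sup>+y. G x y * ?U y \<partial>lborel)"
    proof eventually_elim
      case (elim x)
      have le: "v x \<le> (\<integral>\<^sup>+y. G x y * ?U y \<partial>lborel)"
        unfolding v_eq_G[of x] using U by (intro nn_integral_mono mult_left_mono) auto
      consider "v x = 0" | "x \<bullet> (e, 0) < \<sigma>" | "\<not> x \<bullet> (e, 0) < \<sigma>" "0 < v x"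
        by (auto simp: zero_less_iff_neq_zero)
      then show ?case
      proof cases
        case 2
        then show ?thesis
          using le by (simp add: \<tau>_def reflect_ratio_def)
      next
        case 3
        then have Rx: "?R' x \<bullet> (e, 0) < \<sigma>"
          using elim by (simp add: reflect_inner[OF e0] del: inner_Pair)
        have "v (?R' x) \<le> singular_weight \<beta> (?R' x) * (\<integral>\<^sup>+y. K x y * singular_weight \<alpha> y * ?U y \<partial>lborel)"
          using v_le_reflect[OF e _ _ U Rx] \<sigma> e0 by simp
        also have "\<dots> \<le> singular_weight \<beta> x * (\<integral>\<^sup>+y. K x y * singular_weight \<alpha> y * ?U y \<partial>lborel)"
          using singular_weight_reflect_le[OF e0 _ Rx, of \<beta>] \<sigma> \<beta> e0 by (intro mult_right_mono) auto
        also have "\<dots> = (\<integral>\<^sup>+y. G x y * ?U y \<partial>lborel)"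
          by (subst nn_integral_cmult[symmetric]) (auto simp: G_def mult_ac)
        finally show ?thesis
          using le \<tau>(3)[OF 3 v_less_top] by simp
      qed simp
    qed
    \<comment> \<open>The envelope takes one of the values u(y) and u(R y), and reflection preserves
      Lebesgue measure.\<close>
    have "(\<integral>\<^sup>+y. ennreal_powr (u y * \<rho> y) (p + 1) \<partial>lborel) \<le>
        (\<integral>\<^sup>+y. ennreal_powr (u y) (p + 1) + ennreal_powr (u (?R y)) (p + 1) \<partial>lborel)"
    proof (rule nn_integral_mono_AE, use u_finite in eventually_elim)
      case (elim y)
      have "u y * \<rho> y = u y \<or> u y * \<rho> y = u (?R y)"
        using \<rho>(3)[OF _ u_pos elim] by (cases "y \<bullet> e < \<sigma>") (auto simp: \<rho>_def reflect_ratio_def max_def)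
      then show ?case
        by (auto simp: add_increasing add_increasing2)
    qed
    also have "\<dots> = (\<integral>\<^sup>+y. ennreal_powr (u y) (p + 1) \<partial>lborel) + (\<integral>\<^sup>+y. ennreal_powr (u (?R y)) (p + 1) \<partial>lborel)"
      by (rule nn_integral_add) measurable
    also have "(\<integral>\<^sup>+y. ennreal_powr (u (?R y)) (p + 1) \<partial>lborel) = (\<integral>\<^sup>+y. ennreal_powr (u y) (p + 1) \<partial>lborel)"
      by (rule nn_integral_reflect[OF e]) measurable
    finally show "(\<integral>\<^sup>+y. ennreal_powr (u y * \<rho> y) (p + 1) \<partial>lborel) < top"
      using u_int by (auto elim: le_less_trans)
  qed (auto simp: \<rho> \<tau>)
  then show "AE z in lborel. \<sigma> < z \<bullet> (e, 0) \<longrightarrow> 0 < snd z \<longrightarrow> v (?R' z) \<le> v z"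
  proof (rule eventually_mono)
    fix z :: "(real^'m) \<times> real"
    assume eq: "v z * \<tau> z = (\<integral>\<^sup>+y. G z y * ?U y \<partial>lborel)"
    show "\<sigma> < z \<bullet> (e, 0) \<longrightarrow> 0 < snd z \<longrightarrow> v (?R' z) \<le> v z"
    proof (intro impI, rule ccontr)
      assume z: "\<sigma> < z \<bullet> (e, 0)" "0 < snd z" and less: "\<not> v (?R' z) \<le> v z"
      let ?I = "\<integral>\<^sup>+y. K z y * singular_weight \<alpha> y * ?U y \<partial>lborel"
      have Rz: "?R' z \<bullet> (e, 0) < \<sigma>" "0 < snd (?R' z)"
        using z by (simp_all add: reflect_inner[OF e0] del: inner_Pair) (simp add: reflect_half_space)
      have "v (?R' z) = v z * \<tau> z"
        using \<tau>(3)[of z] z less v_pos[OF z(2)] v_less_top by (auto simp: max_def not_le simp del: inner_Pair)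
      also have "\<dots> = singular_weight \<beta> z * ?I"
        unfolding eq by (subst nn_integral_cmult[symmetric]) (auto simp: G_def mult_ac)
      finally have I: "v (?R' z) = singular_weight \<beta> z * ?I" .
      then have "?I \<noteq> top" "?I \<noteq> 0"
        using v_less_top[of "?R' z"] v_pos[OF Rz(2)] singular_weight_pos[of \<beta> z]
        by (auto simp: ennreal_mult_top zero_less_iff_neq_zero)
      \<comment> \<open>Equality in the subsolution gives v(R' z) as the weight at z times
        \<open>?I\<close>, while the direct bound has the strictly smaller weight at R' z in front
        of the same integral.\<close>
      have "v (?R' z) \<le> singular_weight \<beta> (?R' z) * ?I"
        using v_le_reflect[OF e _ _ U Rz(1)] \<sigma> e0 by simp
      also have "\<dots> < singular_weight \<beta> z * ?I"
        using singular_weight_reflect_less[OF e _ Rz] \<sigma> e0 \<open>?I \<noteq> top\<close> \<open>?I \<noteq> 0\<close>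
        by (intro ennreal_mult_strict_right_mono) (auto simp: less_top zero_less_iff_neq_zero)
      finally show False
        using I by simp
    qed
  qed
qed

section \<open>Necessary conditions on the exponents and the weights for Schur's test\<close>

lemma u_lower_bound:
  obtains c where "0 < c" "\<And>y. y \<noteq> 0 \<Longrightarrow> ennreal (c * (norm y powr - \<alpha> * (norm y + 2) powr - \<mu>)) \<le> u y"
proof -
  \<comment> \<open>A ball inside the half space on which |x - (y,0)| \<le> |y| + 2; the
    contribution of this ball alone gives the lower bound.\<close>
  define B where "B = ball (0 :: real^'m, 1 :: real) 1"
  have [measurable]: "B \<in> sets borel"
    by (simp add: B_def)
  have B: "0 < snd x" "norm x \<le> 2" if "x \<in> B" for x
  proof -
    have "norm (x - (0, 1)) < 1"
      using that by (simp add: B_def dist_norm norm_minus_commute)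
    then show "0 < snd x" "norm x \<le> 2"
      using norm_fst_snd_le(2)[of "x - (0, 1)"] norm_triangle_ineq2[of x "(0, 1)"] by auto
  qed
  let ?f = "\<lambda>x. ennreal (snd x powr lam) * singular_weight \<beta> x * ennreal_powr (v x) q"
  define c0 where "c0 = (\<integral>\<^sup>+x. ?f x * indicator B x \<partial>lborel)"
  have "c0 \<noteq> 0"
  proof
    assume "c0 = 0"
    then have "AE x in lborel. ?f x * indicator B x = 0"
      unfolding c0_def by (subst (asm) nn_integral_0_iff_AE) auto
    then obtain x where x: "x \<in> B" "?f x * indicator B x = 0"
      by (rule AE_lborel_open_ex[of B "(0, 1)", rotated 2]) (auto simp: B_def)
    then show False
      using v_pos[OF B(1)[OF x(1)]] singular_weight_pos[of \<beta> x] B(1)[OF x(1)] by auto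
  qed
  \<comment> \<open>Any positive real below \<open>c0\<close>; the value 1 covers the case that
    \<open>c0\<close> is infinite.\<close>
  then obtain c where c: "0 < c" "ennreal c \<le> c0"
    by (cases c0) (auto intro: that[of 1] that simp: less_le)
  show thesis
  proof (rule that[OF c(1)])
    fix y :: "real^'m" assume y: "y \<noteq> 0"
    have "ennreal ((norm y + 2) powr - \<mu>) * c0 = (\<integral>\<^sup>+x. ennreal ((norm y + 2) powr - \<mu>) * (?f x * indicator B x) \<partial>lborel)"
      unfolding c0_def by (rule nn_integral_cmult[symmetric]) measurable
    also have "\<dots> \<le> (\<integral>\<^sup>+x. K x y * singular_weight \<beta> x * ennreal_powr (v x) q \<partial>lborel)"
    proof (rule nn_integral_mono)
      fix x
      show "ennreal ((norm y + 2) powr - \<mu>) * (?f x * indicator B x) \<le> K x y * singular_weight \<beta> x * ennreal_powr (v x) q"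
      proof (cases "x \<in> B")
        case True
        note x = B[OF True]
        have "0 < norm (x - (y, 0))" "norm (x - (y, 0)) \<le> norm y + 2"
          using x snd_le_norm_diff[of x y] norm_triangle_ineq4[of x "(y, 0)"] by auto
        then have "(norm y + 2) powr - \<mu> \<le> norm (x - (y, 0)) powr - \<mu>"
          using \<mu> by (intro powr_mono2') auto
        then have "ennreal ((norm y + 2) powr - \<mu>) * ennreal (snd x powr lam) \<le> K x y"
          using x by (auto simp: half_space_kernel_def mult_ac simp flip: ennreal_mult intro!: ennreal_leI mult_left_mono)
        then have "ennreal ((norm y + 2) powr - \<mu>) * ennreal (snd x powr lam) * (singular_weight \<beta> x * ennreal_powr (v x) q) \<le>
            K x y * (singular_weight \<beta> x * ennreal_powr (v x) q)"
          by (rule mult_right_mono) simp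
        then show ?thesis
          using True by (simp add: mult_ac)
      qed simp
    qed
    finally have I: "ennreal ((norm y + 2) powr - \<mu>) * c0 \<le> (\<integral>\<^sup>+x. K x y * singular_weight \<beta> x * ennreal_powr (v x) q \<partial>lborel)" .
    have "ennreal (c * (norm y powr - \<alpha> * (norm y + 2) powr - \<mu>)) =
        singular_weight \<alpha> y * (ennreal ((norm y + 2) powr - \<mu>) * ennreal c)"
      using c y by (simp add: singular_weight_eq mult_ac flip: ennreal_mult)
    also have "\<dots> \<le> singular_weight \<alpha> y * (ennreal ((norm y + 2) powr - \<mu>) * c0)"
      using c by (intro mult_left_mono) auto
    also have "\<dots> \<le> u y"
      unfolding u_formula[of y] using I by (rule mult_left_mono) simp
    finally show "ennreal (c * (norm y powr - \<alpha> * (norm y + 2) powr - \<mu>)) \<le> u y" .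
  qed
qed

text \<open>The conditions on the exponents under which the Schur bound below can hold are forced by the existence of a solution.\<close>

lemma necessary_exponents: "\<alpha> * (p + 1) < real CARD('m)" "real CARD('m) < (\<alpha> + \<mu>) * (p + 1)"
proof -
  obtain c where c: "0 < c" "\<And>y. y \<noteq> 0 \<Longrightarrow> ennreal (c * (norm y powr - \<alpha> * (norm y + 2) powr - \<mu>)) \<le> u y"
    using u_lower_bound by blast
  obtain e :: "real^'m" where e: "norm e = 1"
    using nonempty_Basis norm_Basis by blast
  \<comment> \<open>A ball of radius s inside the annulus 2s \<le> |y| \<le> 4s. On it u is at least
    a multiple of s^(-\<alpha>) (4s+2)^(-\<mu>), so the mass of u^(p+1) is at least of order s^(m -
    \<alpha>(p+1)) as s tends to 0 and s^(m - (\<alpha>+\<mu>)(p+1)) as s tends to infinity, with m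
    = CARD('m).\<close>
  define E where "E s = cball ((3 * s) *\<^sub>R e) s" for s
  have [measurable]: "E s \<in> sets borel" for s
    by (simp add: E_def)
  have E: "2 * s \<le> norm y" "norm y \<le> 4 * s" if "y \<in> E s" "0 < s" for y s
  proof -
    have "norm ((3 * s) *\<^sub>R e - y) \<le> s" "norm ((3 * s) *\<^sub>R e) = 3 * s"
      using that e by (simp_all add: E_def dist_norm)
    then show "2 * s \<le> norm y" "norm y \<le> 4 * s"
      using norm_triangle_ineq2[of "(3 * s) *\<^sub>R e" y] norm_triangle_ineq2[of y "(3 * s) *\<^sub>R e"]
      by (auto simp: norm_minus_commute)
  qed
  let ?b = "\<lambda>s. c powr (p + 1) * ((4 * s) powr (- \<alpha> * (p + 1)) * (4 * s + 2) powr (- \<mu> * (p + 1)))"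
  have mass: "ennreal (?b s * (unit_ball_vol (real CARD('m)) * s powr real CARD('m))) \<le> (\<integral>\<^sup>+y. ennreal_powr (u y) (p + 1) * indicator (E s) y \<partial>lborel)"
    if s: "0 < s" for s
  proof -
    have "ennreal (?b s * (unit_ball_vol (real CARD('m)) * s powr real CARD('m))) = ennreal (?b s) * emeasure lborel (E s)"
      using s by (simp add: E_def emeasure_cball powr_realpow flip: ennreal_mult)
    also have "\<dots> = (\<integral>\<^sup>+y. ennreal (?b s) * indicator (E s) y \<partial>lborel)"
      by (rule nn_integral_cmult_indicator[symmetric]) simp
    also have "\<dots> \<le> (\<integral>\<^sup>+y. ennreal_powr (u y) (p + 1) * indicator (E s) y \<partial>lborel)"
    proof (rule nn_integral_mono)
      fix y
      show "ennreal (?b s) * indicator (E s) y \<le> ennreal_powr (u y) (p + 1) * indicator (E s) y"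
      proof (cases "y \<in> E s")
        case True
        note y = E[OF True s]
        have "y \<noteq> 0"
          using y s by auto
        have "c * ((4 * s) powr - \<alpha> * (4 * s + 2) powr - \<mu>) \<le> c * (norm y powr - \<alpha> * (norm y + 2) powr - \<mu>)"
          using y s c \<alpha> \<mu> \<open>y \<noteq> 0\<close> by (intro mult_left_mono mult_mono powr_mono2') auto
        then have "ennreal (c * ((4 * s) powr - \<alpha> * (4 * s + 2) powr - \<mu>)) \<le> u y"
          using c(2)[OF \<open>y \<noteq> 0\<close>] ennreal_leI order_trans by blast
        then have "ennreal_powr (ennreal (c * ((4 * s) powr - \<alpha> * (4 * s + 2) powr - \<mu>))) (p + 1) \<le> ennreal_powr (u y) (p + 1)"
          using p by (intro ennreal_powr_mono) auto
        then show ?thesis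
          using True c s by (simp add: ennreal_powr_ennreal powr_mult powr_powr)
      qed simp
    qed
    finally show ?thesis .
  qed
  \<comment> \<open>Integrability of u^(p+1) makes the mass on escaping sets tend to 0,
    contradicting a fixed lower bound \<open>\<kappa>\<close>. Both claims use this, with balls
    shrinking to the origin or moving to infinity.\<close>
  have no_mass: False if s: "\<And>k. 0 < s k" and out: "\<And>y :: real^'m. y \<noteq> 0 \<Longrightarrow> \<forall>\<^sub>F k in sequentially. \<not> (2 * s k \<le> norm y \<and> norm y \<le> 4 * s k)"
    and k: "0 < \<kappa>" "\<And>k. \<kappa> \<le> (4 * s k) powr (- \<alpha> * (p + 1)) * (4 * s k + 2) powr (- \<mu> * (p + 1)) * s k powr real CARD('m)"
    for s :: "nat \<Rightarrow> real" and \<kappa>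
  proof -
    have "AE y in lborel. \<forall>\<^sub>F k in sequentially. y \<notin> E (s k)"
      using AE_lborel_singleton[of "0 :: real^'m"]
    proof eventually_elim
      case (elim y)
      from out[OF this] show ?case
        by eventually_elim (use E s in blast)
    qed
    then have lim: "(\<lambda>k. \<integral>\<^sup>+y. ennreal_powr (u y) (p + 1) * indicator (E (s k)) y \<partial>lborel) \<longlonglongrightarrow> 0"
      using u_int by (intro nn_integral_vanishing) auto
    let ?c = "c powr (p + 1) * unit_ball_vol (real CARD('m))"
    have "ennreal (?c * \<kappa>) \<le> (\<integral>\<^sup>+y. ennreal_powr (u y) (p + 1) * indicator (E (s k)) y \<partial>lborel)" for k
    proof -
      have "?c * \<kappa> \<le> ?c * ((4 * s k) powr (- \<alpha> * (p + 1)) * (4 * s k + 2) powr (- \<mu> * (p + 1)) * s k powr real CARD('m))"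
        using k(2)[of k] by (intro mult_left_mono) auto
      then have "ennreal (?c * \<kappa>) \<le> ennreal (?b (s k) * (unit_ball_vol (real CARD('m)) * s k powr real CARD('m)))"
        by (intro ennreal_leI) (simp add: mult_ac)
      then show ?thesis
        using mass[OF s] by (rule order_trans)
    qed
    then have "ennreal (?c * \<kappa>) \<le> 0"
      using LIMSEQ_le_const[OF lim] by blast
    moreover have "0 < ?c * \<kappa>"
      using c k by (intro mult_pos_pos) auto
    ultimately show False
      by (metis ennreal_eq_0_iff le_zero_eq not_le)
  qed
  show "\<alpha> * (p + 1) < real CARD('m)"
  proof (rule ccontr)
    assume "\<not> \<alpha> * (p + 1) < real CARD('m)"
    then have a: "real CARD('m) - \<alpha> * (p + 1) \<le> 0" by simp
    let ?s = "\<lambda>k::nat. inverse (real (Suc k))"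
    show False
    proof (rule no_mass)
      fix k
      have s: "0 < ?s k" "?s k \<le> 1"
        by (auto simp: field_simps)
      have "1 \<le> ?s k powr (real CARD('m) - \<alpha> * (p + 1))"
        using powr_mono'[OF a, of "?s k"] s by simp
      \<comment> \<open>Here s \<le> 1, hence 4s + 2 \<le> 6.\<close>
      moreover have "6 powr (- \<mu> * (p + 1)) \<le> (4 * ?s k + 2) powr (- \<mu> * (p + 1))"
        using s \<mu> p by (intro powr_mono2') (auto simp: mult_nonneg_nonpos add_nonneg_pos)
      ultimately have "4 powr (- \<alpha> * (p + 1)) * 6 powr (- \<mu> * (p + 1)) * 1 \<le>
          4 powr (- \<alpha> * (p + 1)) * (4 * ?s k + 2) powr (- \<mu> * (p + 1)) * ?s k powr (real CARD('m) - \<alpha> * (p + 1))"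
        by (intro mult_mono) auto
      also have "?s k powr (real CARD('m) - \<alpha> * (p + 1)) = ?s k powr (- \<alpha> * (p + 1)) * ?s k powr real CARD('m)"
        by (simp flip: powr_add)
      also have "4 powr (- \<alpha> * (p + 1)) * (4 * ?s k + 2) powr (- \<mu> * (p + 1)) * \<dots> =
          (4 * ?s k) powr (- \<alpha> * (p + 1)) * (4 * ?s k + 2) powr (- \<mu> * (p + 1)) * ?s k powr real CARD('m)"
        using powr_mult[of 4 "?s k" "- \<alpha> * (p + 1)"] s by (simp only: mult_ac)
      finally show "4 powr (- \<alpha> * (p + 1)) * 6 powr (- \<mu> * (p + 1)) \<le>
          (4 * ?s k) powr (- \<alpha> * (p + 1)) * (4 * ?s k + 2) powr (- \<mu> * (p + 1)) * ?s k powr real CARD('m)"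
        by simp
    next
      fix y :: "real^'m" assume "y \<noteq> 0"
      then have "0 < norm y / 4" by simp
      from order_tendstoD(2)[OF LIMSEQ_inverse_real_of_nat this]
      show "\<forall>\<^sub>F k in sequentially. \<not> (2 * ?s k \<le> norm y \<and> norm y \<le> 4 * ?s k)"
        by eventually_elim auto
    qed auto
  qed
  show "real CARD('m) < (\<alpha> + \<mu>) * (p + 1)"
  proof (rule ccontr)
    assume "\<not> real CARD('m) < (\<alpha> + \<mu>) * (p + 1)"
    then have a: "0 \<le> real CARD('m) - (\<alpha> + \<mu>) * (p + 1)" by simp
    let ?s = "\<lambda>k::nat. real (Suc k)"
    show False
    proof (rule no_mass)
      fix k
      have s: "1 \<le> ?s k" "0 < ?s k"
        by auto
      have "1 \<le> ?s k powr (real CARD('m) - (\<alpha> + \<mu>) * (p + 1))"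
        using ge_one_powr_ge_zero[OF s(1) a] .
      then have "4 powr (- \<alpha> * (p + 1)) * 6 powr (- \<mu> * (p + 1)) * 1 \<le>
          4 powr (- \<alpha> * (p + 1)) * 6 powr (- \<mu> * (p + 1)) * ?s k powr (real CARD('m) - (\<alpha> + \<mu>) * (p + 1))"
        by (intro mult_left_mono) auto
      also have "?s k powr (real CARD('m) - (\<alpha> + \<mu>) * (p + 1)) =
          ?s k powr (- \<alpha> * (p + 1)) * ?s k powr (- \<mu> * (p + 1)) * ?s k powr real CARD('m)"
        by (simp add: algebra_simps flip: powr_add)
      also have "4 powr (- \<alpha> * (p + 1)) * 6 powr (- \<mu> * (p + 1)) * \<dots> =
          (4 * ?s k) powr (- \<alpha> * (p + 1)) * (6 * ?s k) powr (- \<mu> * (p + 1)) * ?s k powr real CARD('m)"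
        using s by (simp only: powr_mult mult_ac)
      \<comment> \<open>Here s \<ge> 1, hence 4s + 2 \<le> 6s.\<close>
      also have "\<dots> \<le> (4 * ?s k) powr (- \<alpha> * (p + 1)) * (4 * ?s k + 2) powr (- \<mu> * (p + 1)) * ?s k powr real CARD('m)"
        using s \<mu> p by (intro mult_left_mono mult_right_mono powr_mono2') (auto simp: mult_nonneg_nonpos)
      finally show "4 powr (- \<alpha> * (p + 1)) * 6 powr (- \<mu> * (p + 1)) \<le>
          (4 * ?s k) powr (- \<alpha> * (p + 1)) * (4 * ?s k + 2) powr (- \<mu> * (p + 1)) * ?s k powr real CARD('m)"
        by simp
    next
      fix y :: "real^'m"
      have "\<forall>\<^sub>F k in sequentially. norm y < real k"
        using filterlim_real_sequentially by (simp add: filterlim_at_top_dense)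
      then show "\<forall>\<^sub>F k in sequentially. \<not> (2 * ?s k \<le> norm y \<and> norm y \<le> 4 * ?s k)"
        by eventually_elim (auto simp: algebra_simps)
    qed auto
  qed
qed

text \<open>
  The weight in Schur's test is $|x|^a x_n^g |y|^{-b}$ with $a = b + t/((p+1)(q+1)) - g$, which makes
  both integrals homogeneous of degree 0. The factor $x_n^g$ is needed because \<open>\<mu> * t\<close> may exceed
  the dimension of the boundary.
\<close>

lemma Schur_exponents:
  fixes s r t :: real
  assumes s: "0 < s" and r: "0 < r" and t: "0 < t" and ts: "t / s + t / r = 1"
    and crit: "real CARD('m) / s + (real CARD('m) + 1) / r = \<alpha> + \<beta> + \<mu> - lam"
    and ex: "\<alpha> < real CARD('m) / s" "real CARD('m) / s < \<alpha> + \<mu>"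
  obtains b g where "\<alpha> * t < b * r" "b * r < (\<alpha> + \<mu>) * t" "real CARD('m) - (\<alpha> + \<mu>) * t < b * s" "b * s < real CARD('m) - \<alpha> * t"
    "0 < g" "(\<mu> - lam) * t - real CARD('m) < g * s" "g * r < real CARD('m) + 1 - (\<mu> - lam) * t" "g * r < 1 + lam * t"
    "t * (\<alpha> + \<beta> + \<mu> - lam) = real CARD('m) + t / r"
proof -
  have split: "x * t / s + x * t / r = x" for x
  proof -
    have "x * t / s + x * t / r = x * (t / s + t / r)"
      by (simp add: distrib_left)
    then show ?thesis using ts by simp
  qed
  have pos: "0 < \<mu> * t / r" "0 < \<mu> * t / s" "0 \<le> lam * t"
    using s r t \<mu> lam by auto
  \<comment> \<open>Each lower bound for b against each upper bound. By t/s + t/r = 1 the two mixed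
    pairs become \<alpha> < m/s and m/s < \<alpha> + \<mu> with m = CARD('m), precisely the
    necessary conditions; the other two say \<mu> t > 0.\<close>
  have "max (\<alpha> * t / r) ((real CARD('m) - (\<alpha> + \<mu>) * t) / s) < min ((\<alpha> + \<mu>) * t / r) ((real CARD('m) - \<alpha> * t) / s)"
    using split[of \<alpha>] split[of "\<alpha> + \<mu>"] ex pos
    by (simp add: diff_divide_distrib add_divide_distrib distrib_right)
  then obtain b where b: "max (\<alpha> * t / r) ((real CARD('m) - (\<alpha> + \<mu>) * t) / s) < b" "b < min ((\<alpha> + \<mu>) * t / r) ((real CARD('m) - \<alpha> * t) / s)"
    using dense by blast
  have "t * (\<alpha> + \<beta> + \<mu> - lam) = real CARD('m) * (t / s + t / r) + t / r"
    unfolding crit[symmetric] by (simp add: algebra_simps add_divide_distrib)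
  then have \<kappa>: "t * (\<alpha> + \<beta> + \<mu> - lam) = real CARD('m) + t / r"
    using ts by simp
  have small: "\<mu> - lam < real CARD('m) / s + (real CARD('m) + 1) / r"
    unfolding crit using \<alpha> \<beta> by simp
  have "(\<mu> - lam) * t < t * (\<alpha> + \<beta> + \<mu> - lam)"
    using mult_pos_pos[OF add_pos_pos[OF \<alpha> \<beta>] t] by (simp add: algebra_simps)
  moreover have "t / r < 1"
    using ts divide_pos_pos[OF t s] by linarith
  ultimately have 1: "(\<mu> - lam) * t < real CARD('m) + 1"
    using \<kappa> by simp
  have 2: "((\<mu> - lam) * t - real CARD('m)) / s < (real CARD('m) + 1 - (\<mu> - lam) * t) / r"
    using split[of "\<mu> - lam"] small by (simp add: diff_divide_distrib)
  \<comment> \<open>If the left side is positive, then (\<mu> - lam) t > CARD('m), and the upper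
    bound in \<open>2\<close> is already the smaller one.\<close>
  have 3: "((\<mu> - lam) * t - real CARD('m)) / s < (1 + lam * t) / r"
  proof (cases "(\<mu> - lam) * t \<le> real CARD('m)")
    case True
    then have "((\<mu> - lam) * t - real CARD('m)) / s \<le> 0"
      using s by (simp add: divide_nonpos_pos)
    also have "0 < (1 + lam * t) / r"
      using r pos by (simp add: add_pos_nonneg)
    finally show ?thesis .
  next
    case False
    note 2
    also have "(real CARD('m) + 1 - (\<mu> - lam) * t) / r \<le> (1 + lam * t) / r"
      using False r pos by (intro divide_right_mono) auto
    finally show ?thesis .
  qed
  have "max 0 (((\<mu> - lam) * t - real CARD('m)) / s) < min ((real CARD('m) + 1 - (\<mu> - lam) * t) / r) ((1 + lam * t) / r)"
    using 1 2 3 r pos by (simp add: add_pos_nonneg)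
  then obtain g where g: "max 0 (((\<mu> - lam) * t - real CARD('m)) / s) < g" "g < min ((real CARD('m) + 1 - (\<mu> - lam) * t) / r) ((1 + lam * t) / r)"
    using dense by blast
  show thesis
    using b g s r \<kappa> by (intro that[of b g]) (auto simp: pos_less_divide_eq pos_divide_less_eq)
qed

text \<open>With test weight W = |x|^a x_n^g |y|^(-b) the choice is G1 = G^t W^s and G2 = G^t
  W^(-r), where s = p + 1 and r = q + 1; the weight cancels in the product of the roots. The two
  integrals are those of the kernel estimates above.\<close>

lemma Schur_weights:
  assumes pq: "1 < p * q"
  obtains G1 G2 :: "(real^'m) \<times> real \<Rightarrow> real^'m \<Rightarrow> ennreal" and C1 C2 :: real
  where "case_prod G1 \<in> borel_measurable (lborel \<Otimes>\<^sub>M lborel)" "case_prod G2 \<in> borel_measurable (lborel \<Otimes>\<^sub>M lborel)"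
    "AE y in lborel. AE x in lborel. G x y \<le> ennreal_powr (G1 x y) (1 / (p + 1)) * ennreal_powr (G2 x y) (1 / (q + 1))"
    "AE x in lborel. (\<integral>\<^sup>+y. G1 x y \<partial>lborel) \<le> ennreal C1" "AE y in lborel. (\<integral>\<^sup>+x. G2 x y \<partial>lborel) \<le> ennreal C2"
proof -
  \<comment> \<open>\<open>t\<close> is determined by t/s + t/r = 1, so that the roots of the two
    copies of G^t multiply to G.\<close>
  define s r t where "s = p + 1" and "r = q + 1" and "t = s * r / (s + r)"
  have s: "0 < s" and r: "0 < r" and t: "0 < t"
    using p q by (auto simp: s_def r_def t_def)
  have "t / s = r / (s + r)" "t / r = s / (s + r)"
    using s r by (auto simp: t_def)
  then have "t / s + t / r = (s + r) / (s + r)"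
    by (simp only: add_divide_distrib add.commute)
  then have ts: "t / s + t / r = 1"
    using s r by simp
  have ex: "\<alpha> < real CARD('m) / s" "real CARD('m) / s < \<alpha> + \<mu>"
    using necessary_exponents s by (auto simp: s_def pos_less_divide_eq pos_divide_less_eq)
  obtain b g where bg: "\<alpha> * t < b * r" "b * r < (\<alpha> + \<mu>) * t" "real CARD('m) - (\<alpha> + \<mu>) * t < b * s" "b * s < real CARD('m) - \<alpha> * t"
    "0 < g" "(\<mu> - lam) * t - real CARD('m) < g * s" "g * r < real CARD('m) + 1 - (\<mu> - lam) * t" "g * r < 1 + lam * t"
    and \<kappa>: "t * (\<alpha> + \<beta> + \<mu> - lam) = real CARD('m) + t / r"
    using Schur_exponents[OF s r t ts _ ex] critical by (auto simp: s_def r_def)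
  define a where "a = b + t / (r * s) - g"
  have as: "a * s = b * s + t / r - g * s" and ar: "a * r = b * r + t / s - g * r"
    using s r by (auto simp: a_def algebra_simps)
  define A1 g1 A2 g2 M where "A1 = \<alpha> * t + b * s" and "g1 = lam * t + g * s"
    and "A2 = \<beta> * t + a * r" and "g2 = g * r - lam * t" and "M = \<mu> * t"
  define D where "D = real CARD('m) + 1 - g2"
  have M: "0 < M"
    using \<mu> t by (simp add: M_def)
  have lin: "\<alpha> * t + \<beta> * t + \<mu> * t - lam * t = real CARD('m) + t / r"
    using \<kappa> by (simp add: algebra_simps)
  have pt: "0 < \<alpha> * t" "0 < \<mu> * t" "0 \<le> lam * t" "0 < g * s" "0 < g * r"
    using \<alpha> \<mu> lam bg s r t by auto
  note exps = bg[unfolded distrib_right left_diff_distrib] as ar lin pt ts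
  \<comment> \<open>Convergence of the integral over y: at the origin, at infinity, and at the
    projection of x. In \<open>c2\<close> likewise for x: at the origin, at infinity, at the
    boundary and at (y,0).\<close>
  have c1: "A1 < real CARD('m)" "real CARD('m) < A1 + M" "0 \<le> g1" "M - g1 < real CARD('m)"
    using exps by (auto simp: A1_def M_def g1_def)
  have c2: "A2 < D" "D < A2 + M" "g2 < 1" "M < D"
    using exps by (auto simp: A2_def M_def g2_def D_def)
  \<comment> \<open>Total homogeneity 0. One \<open>a\<close> serves both identities because of the
    criticality relation, in the form of \<open>\<kappa>\<close> for \<open>h1\<close> and combined
    with t/s + t/r = 1 for \<open>h2\<close>.\<close>
  have h1: "a * s - \<beta> * t + (real CARD('m) - A1 - M + g1) = 0" and h2: "b * r - \<alpha> * t + (D - A2 - M) = 0"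
    using exps by (auto simp: A1_def A2_def D_def M_def g1_def g2_def)
  let ?L = "\<lambda>(x :: (real^'m) \<times> real) (y :: real^'m). norm (x - (y, 0))"
  define G1 where "G1 x y = ennreal (norm x powr (a * s - \<beta> * t) * (norm y powr - A1 * (snd x powr g1 * ?L x y powr - M)))
    * indicator half_space x" for x :: "(real^'m) \<times> real" and y :: "real^'m"
  define G2 where "G2 x y = ennreal (norm x powr - A2 * (norm y powr (b * r - \<alpha> * t) * (snd x powr - g2 * ?L x y powr - M)))
    * indicator half_space x" for x :: "(real^'m) \<times> real" and y :: "real^'m"
  define C1 where "C1 = two_centre_const A1 M (M - min g1 M) (real CARD('m)) * unit_ball_vol (real CARD('m))"
  define C2 where "C2 = two_centre_const A2 M M D * (near_const g2 1 * unit_ball_vol (real CARD('m)))"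
  show thesis
  proof (rule that[of G1 G2 C1 C2])
    show "case_prod G1 \<in> borel_measurable (lborel \<Otimes>\<^sub>M lborel)" "case_prod G2 \<in> borel_measurable (lborel \<Otimes>\<^sub>M lborel)"
      unfolding G1_def G2_def split_beta by measurable
    show "AE y in lborel. AE x in lborel. G x y \<le> ennreal_powr (G1 x y) (1 / (p + 1)) * ennreal_powr (G2 x y) (1 / (q + 1))"
      using AE_lborel_singleton[of "0 :: real^'m"]
    proof eventually_elim
      case (elim y)
      show ?case
      proof (rule AE_I2)
        fix x :: "(real^'m) \<times> real"
        show "G x y \<le> ennreal_powr (G1 x y) (1 / (p + 1)) * ennreal_powr (G2 x y) (1 / (q + 1))"
        proof (cases "0 < snd x")
          case True
          have pos: "0 < norm x" "0 < norm y" "0 < ?L x y"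
            using True elim snd_le_norm_diff[of x y] by auto
          have E: "(a * s - \<beta> * t) * (1 / s) + - A2 * (1 / r) = - \<beta>"
            "- A1 * (1 / s) + (b * r - \<alpha> * t) * (1 / r) = - \<alpha>"
            "g1 * (1 / s) + - g2 * (1 / r) = lam" "- M * (1 / s) + - M * (1 / r) = - \<mu>"
          proof -
            have split: "x * t / s + x * t / r = x" for x
            proof -
              have "x * t / s + x * t / r = x * (t / s + t / r)"
                by (simp add: distrib_left)
              then show ?thesis using ts by simp
            qed
            show "(a * s - \<beta> * t) * (1 / s) + - A2 * (1 / r) = - \<beta>"
              using split[of \<beta>] s r by (simp add: A2_def diff_divide_distrib add_divide_distrib)
            show "- A1 * (1 / s) + (b * r - \<alpha> * t) * (1 / r) = - \<alpha>"
              using split[of \<alpha>] s r by (simp add: A1_def diff_divide_distrib add_divide_distrib)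
            show "g1 * (1 / s) + - g2 * (1 / r) = lam"
              using split[of lam] s r by (simp add: g1_def g2_def diff_divide_distrib add_divide_distrib)
            show "- M * (1 / s) + - M * (1 / r) = - \<mu>"
              using split[of \<mu>] by (simp add: M_def)
          qed
          have "ennreal_powr (G1 x y) (1 / (p + 1)) * ennreal_powr (G2 x y) (1 / (q + 1)) =
              ennreal (norm x powr - \<beta> * (norm y powr - \<alpha> * (snd x powr lam * ?L x y powr - \<mu>)))"
            using True powr_prod4[OF pos(1,2) True pos(3), of "a * s - \<beta> * t" "- A1" g1 "- M" "1 / s" "- A2" "b * r - \<alpha> * t" "- g2" "- M" "1 / r"]
            unfolding E by (simp add: G1_def G2_def ennreal_powr_ennreal s_def r_def flip: ennreal_mult)
          also have "\<dots> = G x y"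
            using True pos by (simp add: G_def half_space_kernel_def singular_weight_eq mult_ac flip: ennreal_mult)
          finally show ?thesis by simp
        qed (simp add: G_def half_space_kernel_def)
      qed
    qed
    show "AE x in lborel. (\<integral>\<^sup>+y. G1 x y \<partial>lborel) \<le> ennreal C1"
    proof (rule AE_I2)
      fix x :: "(real^'m) \<times> real"
      show "(\<integral>\<^sup>+y. G1 x y \<partial>lborel) \<le> ennreal C1"
      proof (cases "0 < snd x")
        case True
        let ?h = "\<lambda>y. ennreal (norm y powr - A1 * (snd x powr g1 * ?L x y powr - M))"
        have "(\<integral>\<^sup>+y. G1 x y \<partial>lborel) = (\<integral>\<^sup>+y. ennreal (norm x powr (a * s - \<beta> * t)) * ?h y \<partial>lborel)"
          using True by (intro nn_integral_cong) (simp add: G1_def flip: ennreal_mult)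
        also have "\<dots> = ennreal (norm x powr (a * s - \<beta> * t)) * (\<integral>\<^sup>+y. ?h y \<partial>lborel)"
          by (rule nn_integral_cmult) measurable
        also have "\<dots> \<le> ennreal (norm x powr (a * s - \<beta> * t)) * ennreal (C1 * norm x powr (real CARD('m) - A1 - M + g1))"
          unfolding C1_def using c1 M True by (intro mult_left_mono nn_integral_boundary_kernel) auto
        also have "\<dots> = ennreal (C1 * norm x powr (a * s - \<beta> * t + (real CARD('m) - A1 - M + g1)))"
          by (subst ennreal_mult'[symmetric]) (simp_all add: powr_add mult_ac)
        also have "\<dots> = ennreal C1"
          unfolding h1 using True by auto
        finally show ?thesis .
      qed (simp add: G1_def)
    qed
    show "AE y in lborel. (\<integral>\<^sup>+x. G2 x y \<partial>lborel) \<le> ennreal C2"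
      using AE_lborel_singleton[of "0 :: real^'m"]
    proof eventually_elim
      case (elim y)
      let ?h = "\<lambda>x. ennreal (norm x powr - A2 * (snd x powr - g2 * ?L x y powr - M)) * indicator half_space x"
      have "(\<integral>\<^sup>+x. G2 x y \<partial>lborel) = (\<integral>\<^sup>+x. ennreal (norm y powr (b * r - \<alpha> * t)) * ?h x \<partial>lborel)"
        by (intro nn_integral_cong) (simp add: G2_def mult_ac flip: ennreal_mult split: split_indicator)
      also have "\<dots> = ennreal (norm y powr (b * r - \<alpha> * t)) * (\<integral>\<^sup>+x. ?h x \<partial>lborel)"
        by (rule nn_integral_cmult) measurable
      also have "\<dots> \<le> ennreal (norm y powr (b * r - \<alpha> * t)) * ennreal (C2 * norm y powr (D - A2 - M))"
        unfolding C2_def D_def using c2 M elim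
        by (intro mult_left_mono nn_integral_half_space_kernel) (auto simp: D_def)
      also have "\<dots> = ennreal (C2 * norm y powr (b * r - \<alpha> * t + (D - A2 - M)))"
        by (subst ennreal_mult'[symmetric]) (simp_all add: powr_add mult_ac)
      also have "\<dots> = ennreal C2"
        unfolding h2 using elim by simp
      finally show ?case .
    qed
  qed
qed

subsection \<open>Moving planes\<close>

lemma tendsto_v_reflect:
  fixes s :: "nat \<Rightarrow> real" and e :: "real^'m"
  assumes s: "s \<longlonglongrightarrow> \<sigma>" and x: "0 < snd x"
  shows "(\<lambda>k. enn2real (v (reflect (e, 0) (s k) x))) \<longlonglongrightarrow> enn2real (v (reflect (e, 0) \<sigma> x))"
proof (rule isCont_tendsto_compose[OF isCont_v])
  show "0 < snd (reflect (e, 0 :: real) \<sigma> x)"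
    using x by (simp add: reflect_half_space)
  show "(\<lambda>k. reflect (e, 0 :: real) (s k) x) \<longlonglongrightarrow> reflect (e, 0) \<sigma> x"
    unfolding reflect_def by (intro tendsto_intros s)
qed

lemma v_less_iff: "v x < v z \<longleftrightarrow> enn2real (v x) < enn2real (v z)"
  using v_less_top[of x] v_less_top[of z] by (cases "v x"; cases "v z") (auto simp: ennreal_less_iff)

lemma v_le_iff: "v x \<le> v z \<longleftrightarrow> enn2real (v x) \<le> enn2real (v z)"
  using v_less_iff[of z x] by (metis not_less)

text \<open>Each point of the open side lies on the corresponding side of \<open>s k\<close> for
  large k, and v is continuous. This gives closedness in the moving plane argument and the passage
  to \<sigma> = 0.\<close>

lemma v_reflect_le_limit:
  assumes s: "s \<longlonglongrightarrow> \<sigma>" and le: "\<And>k x. x \<bullet> (e, 0) < s k \<Longrightarrow> v x \<le> v (reflect (e, 0) (s k) x)"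
    and x: "x \<bullet> (e, 0) < \<sigma>"
  shows "v x \<le> v (reflect (e, 0) \<sigma> x)"
proof (cases "0 < snd x")
  case True
  have "\<forall>\<^sub>F k in sequentially. enn2real (v x) \<le> enn2real (v (reflect (e, 0) (s k) x))"
    using order_tendstoD(1)[OF s x] by eventually_elim (use le in \<open>simp add: v_le_iff\<close>)
  then show ?thesis
    unfolding v_le_iff
    using tendsto_lowerbound[OF tendsto_v_reflect[OF s True]] by simp
qed (simp add: v_outside)

lemma v_reflect_le_superlinear:
  assumes pq: "1 < p * q" and e: "norm e = 1" and \<sigma>: "\<sigma> < 0" and x: "x \<bullet> (e, 0) < \<sigma>"
  shows "v x \<le> v (reflect (e, 0) \<sigma> x)"
proof -
  define P where "P \<sigma> \<longleftrightarrow> (\<forall>x. x \<bullet> (e, 0) < \<sigma> \<longrightarrow> v x \<le> v (reflect (e, 0) \<sigma> x))" for \<sigma>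
  define E where "E \<sigma> = {x. x \<bullet> (e, 0) < \<sigma> \<and> v (reflect (e, 0) \<sigma> x) < v x}" for \<sigma>
  have [measurable]: "E \<sigma> \<in> sets borel" for \<sigma>
    unfolding E_def by measurable
  obtain G1 G2 :: "(real^'m) \<times> real \<Rightarrow> real^'m \<Rightarrow> ennreal" and C1 C2 :: real
    where G: "case_prod G1 \<in> borel_measurable (lborel \<Otimes>\<^sub>M lborel)" "case_prod G2 \<in> borel_measurable (lborel \<Otimes>\<^sub>M lborel)"
    "AE y in lborel. AE x in lborel. G x y \<le> ennreal_powr (G1 x y) (1 / (p + 1)) * ennreal_powr (G2 x y) (1 / (q + 1))"
    "AE x in lborel. (\<integral>\<^sup>+y. G1 x y \<partial>lborel) \<le> ennreal C1" "AE y in lborel. (\<integral>\<^sup>+x. G2 x y \<partial>lborel) \<le> ennreal C2"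
    using Schur_weights[OF pq] by blast
  obtain \<eta> where \<eta>: "0 < \<eta>" and small: "\<And>\<sigma>. \<sigma> \<le> 0 \<Longrightarrow>
      (\<integral>\<^sup>+x. ennreal_powr (v x) (q + 1) * indicator (E \<sigma>) x \<partial>lborel) < ennreal \<eta> \<Longrightarrow> P \<sigma>"
  proof (rule small_reflection_defect[OF pq G])
    fix \<eta> :: real
    assume \<eta>: "0 < \<eta>" and *: "\<And>e \<sigma> x. norm e = 1 \<Longrightarrow> \<sigma> \<le> 0 \<Longrightarrow>
      (\<integral>\<^sup>+x. ennreal_powr (v x) (q + 1) * indicator {x. x \<bullet> (e, 0) < \<sigma> \<and> v (reflect (e, 0) \<sigma> x) < v x} x \<partial>lborel) < ennreal \<eta> \<Longrightarrow>
      x \<bullet> (e, 0) < \<sigma> \<Longrightarrow> v x \<le> v (reflect (e, 0) \<sigma> x)"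
    show thesis
      by (rule that[OF \<eta>]) (use *[OF e] in \<open>simp add: P_def E_def del: inner_Pair\<close>)
  qed
  \<comment> \<open>If almost every point leaves the bad sets, their mass falls below \<eta>.
    Starting the planes at minus infinity and moving them past an admissible position are both
    instances.\<close>
  have ev: "\<forall>\<^sub>F k in sequentially. P (s k)"
    if s: "\<forall>\<^sub>F k in sequentially. s k \<le> 0" and out: "AE x in lborel. \<forall>\<^sub>F k in sequentially. x \<notin> E (s k)" for s :: "nat \<Rightarrow> real"
  proof -
    have "(\<lambda>k. \<integral>\<^sup>+x. ennreal_powr (v x) (q + 1) * indicator (E (s k)) x \<partial>lborel) \<longlonglongrightarrow> 0"
      using v_int out by (intro nn_integral_vanishing) auto
    from order_tendstoD(2)[OF this, of "ennreal \<eta>"] s \<eta> show ?thesis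
      by (auto elim: eventually_elim2 intro: small)
  qed
  define S where "S = {\<sigma>. \<sigma> < 0 \<and> P \<sigma>}"
  have "S \<noteq> {}"
  proof -
    have "\<forall>\<^sub>F k in sequentially. P (- real (Suc k))"
    proof (rule ev)
      show "AE x in lborel. \<forall>\<^sub>F k in sequentially. x \<notin> E (- real (Suc k))"
      proof (rule AE_I2)
        fix x :: "(real^'m) \<times> real"
        have "\<forall>\<^sub>F k in sequentially. - (x \<bullet> (e, 0)) < real k"
          using filterlim_real_sequentially by (simp add: filterlim_at_top_dense)
        then show "\<forall>\<^sub>F k in sequentially. x \<notin> E (- real (Suc k))"
          by eventually_elim (simp add: E_def del: inner_Pair)
      qed
    qed simp
    then obtain k where "P (- real (Suc k))"
      by (auto simp: eventually_sequentially)
    then have "- real (Suc k) \<in> S"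
      by (simp add: S_def)
    then show ?thesis by blast
  qed
  moreover have "openin (top_of_set {..<0}) S"
  proof -
    have "\<forall>\<^sub>F \<sigma>' in nhds \<sigma>. P \<sigma>'" if \<sigma>: "\<sigma> \<in> S" for \<sigma>
    proof -
      have \<sigma>0: "\<sigma> < 0" and P: "P \<sigma>"
        using \<sigma> by (auto simp: S_def)
      have "\<forall>\<^sub>F k in sequentially. P (s k)" if s: "s \<longlonglongrightarrow> \<sigma>" for s
      proof (rule ev)
        show "\<forall>\<^sub>F k in sequentially. s k \<le> 0"
          using order_tendstoD(2)[OF s \<sigma>0] by eventually_elim simp
        have "(e, 0 :: real) \<noteq> 0" using e by (auto simp: zero_prod_def)
        from AE_lborel_hyperplane[OF this, of \<sigma>]
        show "AE x in lborel. \<forall>\<^sub>F k in sequentially. x \<notin> E (s k)"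
        proof eventually_elim
          case (elim x)
          consider "snd x \<le> 0" | "\<sigma> < x \<bullet> (e, 0)" | "x \<bullet> (e, 0) < \<sigma>" "0 < snd x"
            using elim by linarith
          then show ?case
          proof cases
            case 1
            then show ?thesis
              by (simp add: E_def v_outside)
          next
            case 2
            from order_tendstoD(2)[OF s this] show ?thesis
              by eventually_elim (simp add: E_def del: inner_Pair)
          next
            case 3
            \<comment> \<open>The strict inequality at \<sigma> survives small changes of the mirror
              at each fixed point. No uniformity is required, since only the mass of the bad set has
              to become small.\<close>
            have "v x < v (reflect (e, 0) \<sigma> x)"
              using P \<sigma>0 e by (intro v_reflect_strict_mono[OF e _ u_reflect_mono[OF e]] 3) (auto simp: P_def)
            then have "enn2real (v x) < enn2real (v (reflect (e, 0) \<sigma> x))"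
              by (simp add: v_less_iff)
            from order_tendstoD(1)[OF tendsto_v_reflect[OF s 3(2)] this] show ?thesis
              by eventually_elim (simp add: E_def v_less_iff not_less less_imp_le)
          qed
        qed
      qed
      then have "\<forall>\<^sub>F \<sigma>' in at \<sigma>. P \<sigma>'"
        by (intro sequentially_imp_eventually_at) blast
      then show ?thesis
        using P by (auto simp: eventually_at_filter elim: eventually_mono)
    qed
    moreover have "\<forall>\<^sub>F \<sigma>' in nhds \<sigma>. \<sigma>' < 0" if "\<sigma> \<in> S" for \<sigma> :: real
      using that eventually_nhds_in_open[of "{..<0}" \<sigma>] by (simp add: S_def)
    ultimately have "\<forall>\<^sub>F \<sigma>' in nhds \<sigma>. \<sigma>' \<in> S" if "\<sigma> \<in> S" for \<sigma>
      using that by (auto simp: S_def intro: eventually_conj)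
    then have "\<exists>T. open T \<and> \<sigma> \<in> T \<and> T \<subseteq> S" if "\<sigma> \<in> S" for \<sigma>
      using that unfolding eventually_nhds subset_eq by simp
    then have "open S"
      by (subst open_subopen) simp
    then show ?thesis
      by (intro open_openin_trans) (auto simp: S_def)
  qed
  moreover have "closedin (top_of_set {..<0}) S"
    unfolding closedin_limpt
  proof (intro conjI allI impI)
    show "S \<subseteq> {..<0}"
      by (auto simp: S_def)
    fix \<sigma> assume "\<sigma> islimpt S \<and> \<sigma> \<in> {..<0}"
    then obtain s where s: "\<And>k. s k \<in> S" "s \<longlonglongrightarrow> \<sigma>" and "\<sigma> < 0"
      by (auto simp: islimpt_sequential)
    have "P \<sigma>"
      unfolding P_def using s(1) v_reflect_le_limit[OF s(2)] by (auto simp: S_def P_def)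
    then show "\<sigma> \<in> S"
      using \<open>\<sigma> < 0\<close> by (simp add: S_def)
  qed
  ultimately have "S = {..<0}"
    using connected_clopen[of "{..<0::real}"] by (metis connected_Iio)
  then have "\<sigma> \<in> S"
    using \<sigma> by simp
  then have "P \<sigma>"
    by (simp add: S_def)
  then show ?thesis
    using x unfolding P_def by blast
qed

text \<open>Both regimes rely on \<sigma> < 0; the mirror through the origin is approached from
  below.\<close>

lemma v_reflect_le:
  assumes e: "norm e = 1" and \<sigma>: "\<sigma> \<le> 0" and x: "x \<bullet> (e, 0) < \<sigma>"
  shows "v x \<le> v (reflect (e, 0) \<sigma> x)"
proof (rule v_reflect_le_limit[OF _ _ x])
  show "(\<lambda>k. \<sigma> - inverse (real (Suc k))) \<longlonglongrightarrow> \<sigma>"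
    using tendsto_diff[OF tendsto_const LIMSEQ_inverse_real_of_nat, of \<sigma>] by simp
  fix k and z :: "(real^'m) \<times> real"
  assume "z \<bullet> (e, 0) < \<sigma> - inverse (real (Suc k))"
  moreover have "\<sigma> - inverse (real (Suc k)) < 0"
  proof -
    have "0 < inverse (real (Suc k))" by simp
    then show ?thesis using \<sigma> by linarith
  qed
  ultimately show "v z \<le> v (reflect (e, 0) (\<sigma> - inverse (real (Suc k))) z)"
    using v_reflect_le_sublinear[OF _ e] v_reflect_le_superlinear[OF _ e] by (meson not_le)
qed

text \<open>The mirror is the perpendicular bisector of \<open>y\<close> and \<open>z\<close>; the origin is on the side of \<open>y\<close> or on it.\<close>

lemma radially_decreasing:
  assumes yz: "norm y \<le> norm z"
  shows "v (z, t) \<le> v (y, t)" "u z \<le> u y"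
proof -
  have "v (z, t) \<le> v (y, t) \<and> u z \<le> u y"
  proof (cases "y = z")
    case False
    define e where "e = (y - z) /\<^sub>R norm (y - z)"
    define \<sigma> where "\<sigma> = e \<bullet> (y + z) / 2"
    have e: "norm e = 1"
      using False by (simp add: e_def)
    have "e \<bullet> (y + z) = ((norm y)\<^sup>2 - (norm z)\<^sup>2) / norm (y - z)"
    proof -
      have "(y - z) \<bullet> (y + z) = y \<bullet> y + y \<bullet> z - z \<bullet> y - z \<bullet> z"
        by (simp add: inner_diff_left inner_add_right)
      then have "(y - z) \<bullet> (y + z) = (norm y)\<^sup>2 - (norm z)\<^sup>2"
        unfolding power2_norm_eq_inner inner_commute[of z y] by linarith
      then show ?thesis
        by (simp add: e_def divide_inverse mult.commute)
    qed
    also have "\<dots> \<le> 0"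
      using yz by (intro divide_nonpos_nonneg) (auto intro: power_mono)
    finally have \<sigma>: "\<sigma> \<le> 0"
      by (simp add: \<sigma>_def)
    have ed: "e \<bullet> (y - z) = norm (y - z)"
      using False by (simp add: e_def dot_square_norm power2_eq_square)
    have z: "z \<bullet> e - \<sigma> = - norm (y - z) / 2"
      using ed by (simp add: \<sigma>_def inner_add_right inner_diff_right inner_commute field_simps)
    have z': "z \<bullet> e < \<sigma>"
    proof -
      have "0 < norm (y - z)" using False by simp
      then show ?thesis using z by linarith
    qed
    have R: "reflect e \<sigma> z = y"
      unfolding reflect_def z using False by (simp add: e_def)
    have "v (z, t) \<le> v (reflect (e, 0) \<sigma> (z, t))"
      using z' by (intro v_reflect_le e \<sigma>) simp
    moreover have "u z \<le> u (reflect e \<sigma> z)"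
      by (rule u_reflect_mono[OF e \<sigma> v_reflect_le[OF e \<sigma>] z'])
    ultimately show ?thesis
      using R by (simp add: reflect_half_space)
  qed simp
  then show "v (z, t) \<le> v (y, t)" "u z \<le> u y"
    by auto
qed

end

section \<open>Transfer to the system as originally stated\<close>

lemma half_space_kernel_eq_poisson_kernel:
  assumes "0 < snd x"
  shows "half_space_kernel lam \<mu> x y = ennreal (poisson_kernel lam x y \<mu>)"
proof -
  define S where "S = (norm (fst x - y))\<^sup>2 + (snd x)\<^sup>2"
  have "0 \<le> S"
    by (simp add: S_def)
  have "norm (x - (y, 0)) = sqrt S"
    by (simp add: S_def norm_prod_def)
  also have "\<dots> = S powr (1 / 2)"
    using \<open>0 \<le> S\<close> by (rule powr_half_sqrt[symmetric])
  finally have "norm (x - (y, 0)) powr \<mu> = S powr (\<mu> / 2)"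
    by (simp add: powr_powr)
  then show ?thesis
    using assms by (simp add: half_space_kernel_def poisson_kernel_def powr_minus_divide S_def)
qed

theorem theorem1p6:
  fixes n :: nat
    and lam \<alpha> \<beta> \<mu> p0 q0 :: real
    and u :: "real^'m \<Rightarrow> ennreal"
    and v :: "(real^'m) \<times> real \<Rightarrow> ennreal"
  assumes "n \<ge> 3" and "CARD('m) = n - 1"
    and "lam \<ge> 0"
    and "0 < \<alpha>" "\<alpha> < real n"
    and "0 < \<beta>" "\<beta> < real n"
    and "0 < \<mu>" "\<mu> < real n - 2 * lam"
    and "0 < p0" "0 < q0"
    and "in_Lp (p0 + 1) lebesgue u"
    and "in_Lp (q0 + 1) (lebesgue_on half_space) v"
    and "\<And>y. u y > 0"
    and "\<And>x. x \<in> half_space \<Longrightarrow> v x > 0"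
    and "\<And>y. u y = (\<integral>\<^sup>+ x. singular_weight \<beta> x * ennreal (poisson_kernel lam x y \<mu>)
                         * ennreal_powr (v x) q0 * singular_weight \<alpha> y \<partial>lebesgue_on half_space)"
    and "\<And>x. x \<in> half_space \<Longrightarrow>
           v x = (\<integral>\<^sup>+ y. singular_weight \<alpha> y * ennreal (poisson_kernel lam x y \<mu>)
                         * ennreal_powr (u y) p0 * singular_weight \<beta> x \<partial>lebesgue)"
    and "(real n - 1) / real n * (1 / (p0 + 1)) + 1 / (q0 + 1) = (\<alpha> + \<beta> + \<mu> - lam) / real n"
  shows "\<exists>y0 :: real^'m.
           radially_symmetric_about y0 u \<and> monotone_decreasing_about y0 u \<and>
           radially_symmetric_about y0 (boundary_restriction v) \<and>
           monotone_decreasing_about y0 (boundary_restriction v)"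
proof -
  note u_eq = assms(16) and v_eq = assms(17)
  \<comment> \<open>Extension by zero: the integrals over the half space are unchanged, and the
    values of \<open>v\<close> outside, about which nothing is known, disappear.\<close>
  define v0 where "v0 x = v x * indicator half_space x" for x
  let ?K = "half_space_kernel lam \<mu> :: (real^'m) \<times> real \<Rightarrow> real^'m \<Rightarrow> ennreal"
  have outside: "?K x y = 0" if "\<not> 0 < snd x" for x y
    using that by (simp add: half_space_kernel_def)
  \<comment> \<open>\<open>u\<close> is so far only Lebesgue measurable. A Borel version inserted
    into the second equation shows that \<open>v0\<close> is Borel, and then the first equation,
    valid at every point, shows the same for \<open>u\<close> itself.\<close>
  obtain u' where u': "u' \<in> borel_measurable lborel" "AE y in lborel. u y = u' y"
    using assms(12) completion_ex_borel_measurable[of u lborel] by (auto simp: in_Lp_def)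
  have v0_formula: "v0 x = singular_weight \<beta> x * (\<integral>\<^sup>+y. ?K x y * singular_weight \<alpha> y * ennreal_powr (u' y) p0 \<partial>lborel)" for x
  proof (cases "0 < snd x")
    case True
    have "v x = (\<integral>\<^sup>+y. singular_weight \<alpha> y * ennreal (poisson_kernel lam x y \<mu>)
        * ennreal_powr (u y) p0 * singular_weight \<beta> x \<partial>lborel)"
      using v_eq[of x] True by (simp add: nn_integral_completion)
    also have "\<dots> = (\<integral>\<^sup>+y. singular_weight \<beta> x * (?K x y * singular_weight \<alpha> y * ennreal_powr (u' y) p0) \<partial>lborel)"
      by (rule nn_integral_cong_AE, use u'(2) in eventually_elim)
        (simp add: half_space_kernel_eq_poisson_kernel[OF True] mult_ac)
    also have "\<dots> = singular_weight \<beta> x * (\<integral>\<^sup>+y. ?K x y * singular_weight \<alpha> y * ennreal_powr (u' y) p0 \<partial>lborel)"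
      using u'(1) by (intro nn_integral_cmult) auto
    finally show ?thesis
      using True by (simp add: v0_def)
  qed (simp add: v0_def outside)
  have K_meas: "(\<lambda>z. ?K (fst z) (snd z)) \<in> borel_measurable (borel \<Otimes>\<^sub>M borel)"
    using measurable_half_space_kernel[of lam \<mu>] by (simp cong: measurable_cong_sets)
  have v0_meas [measurable]: "v0 \<in> borel_measurable borel"
  proof -
    have "(\<lambda>x. \<integral>\<^sup>+y. ?K x y * singular_weight \<alpha> y * ennreal_powr (u' y) p0 \<partial>lborel) \<in> borel_measurable borel"
      using u'(1) K_meas by (intro lborel.borel_measurable_nn_integral) (auto simp: split_beta cong: measurable_cong_sets)
    then show ?thesis
      unfolding v0_formula[abs_def] by (intro borel_measurable_times_ennreal measurable_singular_weight)
  qed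
  have u_formula: "u y = singular_weight \<alpha> y * (\<integral>\<^sup>+x. ?K x y * singular_weight \<beta> x * ennreal_powr (v0 x) q0 \<partial>lborel)" for y
  proof -
    have "u y = (\<integral>\<^sup>+x. singular_weight \<beta> x * ennreal (poisson_kernel lam x y \<mu>)
        * ennreal_powr (v x) q0 * singular_weight \<alpha> y * indicator half_space x \<partial>lborel)"
      unfolding u_eq[of y] by (simp add: nn_integral_restrict_space nn_integral_completion)
    also have "\<dots> = (\<integral>\<^sup>+x. singular_weight \<alpha> y * (?K x y * singular_weight \<beta> x * ennreal_powr (v0 x) q0) \<partial>lborel)"
    proof (rule nn_integral_cong)
      fix x
      show "singular_weight \<beta> x * ennreal (poisson_kernel lam x y \<mu>) * ennreal_powr (v x) q0 * singular_weight \<alpha> y *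
          indicator half_space x = singular_weight \<alpha> y * (?K x y * singular_weight \<beta> x * ennreal_powr (v0 x) q0)"
        by (cases "0 < snd x") (simp_all add: outside half_space_kernel_eq_poisson_kernel v0_def mult_ac)
    qed
    also have "\<dots> = singular_weight \<alpha> y * (\<integral>\<^sup>+x. ?K x y * singular_weight \<beta> x * ennreal_powr (v0 x) q0 \<partial>lborel)"
      by (rule nn_integral_cmult) measurable
    finally show ?thesis .
  qed
  interpret half_space_system lam \<alpha> \<beta> \<mu> p0 q0 u v0
  proof
    show "u \<in> borel_measurable borel"
    proof -
      have "(\<lambda>y. \<integral>\<^sup>+x. ?K x y * singular_weight \<beta> x * ennreal_powr (v0 x) q0 \<partial>lborel) \<in> borel_measurable borel"
        using measurable_compose[OF measurable_pair_swap' K_meas]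
        by (intro lborel.borel_measurable_nn_integral) (auto simp: split_beta cong: measurable_cong_sets)
      then show ?thesis
        unfolding u_formula[abs_def] by (intro borel_measurable_times_ennreal measurable_singular_weight)
    qed
    show "v0 x = singular_weight \<beta> x * (\<integral>\<^sup>+y. ?K x y * singular_weight \<alpha> y * ennreal_powr (u y) p0 \<partial>lborel)" for x
      unfolding v0_formula[of x]
      by (rule arg_cong[OF nn_integral_cong_AE], use u'(2) in eventually_elim) simp
    show "(\<integral>\<^sup>+y. ennreal_powr (u y) (p0 + 1) \<partial>lborel) < top"
      using assms(12) by (simp add: in_Lp_def nn_integral_completion)
    have "(\<integral>\<^sup>+x. ennreal_powr (v0 x) (q0 + 1) \<partial>lborel) = (\<integral>\<^sup>+x. ennreal_powr (v x) (q0 + 1) * indicator half_space x \<partial>lborel)"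
      by (intro nn_integral_cong) (simp add: v0_def split: split_indicator)
    also have "\<dots> < top"
      using assms(13) by (simp add: in_Lp_def nn_integral_restrict_space nn_integral_completion)
    finally show "(\<integral>\<^sup>+x. ennreal_powr (v0 x) (q0 + 1) \<partial>lborel) < top" .
    have n: "real n = real CARD('m) + 1"
      using assms(1,2) by simp
    have "real CARD('m) / (p0 + 1) + (real CARD('m) + 1) / (q0 + 1) =
        (real n - 1) * (1 / (p0 + 1)) + real n * (1 / (q0 + 1))"
      by (simp add: n)
    also have "\<dots> = real n * ((real n - 1) / real n * (1 / (p0 + 1)) + 1 / (q0 + 1))"
      using assms(1) mult_divide_mult_cancel_left[of "real n" "real n - 1" "p0 + 1"]
      by (simp only: distrib_left) (simp add: distrib_left[of "real n" p0])
    also have "\<dots> = \<alpha> + \<beta> + \<mu> - lam"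
      unfolding assms(18) using assms(1) by simp
    finally show "real CARD('m) / (p0 + 1) + (real CARD('m) + 1) / (q0 + 1) = \<alpha> + \<beta> + \<mu> - lam" .
    show "u y = singular_weight \<alpha> y * (\<integral>\<^sup>+x. ?K x y * singular_weight \<beta> x * ennreal_powr (v0 x) q0 \<partial>lborel)" for y
      by (rule u_formula)
    show "0 < v0 x" if "0 < snd x" for x
      using assms(15)[of x] that by (simp add: v0_def)
    show "0 < u y" for y
      by (rule assms(14))
  qed (use assms(3-11) in simp_all)
  have u_mono: "u z \<le> u y" if "norm y \<le> norm z" for y z
    using radially_decreasing(2)[OF that] .
  have v_mono: "boundary_restriction v z \<le> boundary_restriction v y" if "norm y \<le> norm z" for y z :: "real^'m"
    unfolding boundary_restriction_def
  proof (rule Liminf_mono)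
    have "v (z, t) \<le> v (y, t)" if "0 < t" for t
      using radially_decreasing(1)[OF \<open>norm y \<le> norm z\<close>, of t] that by (simp add: v0_def)
    then show "\<forall>\<^sub>F t in at_right 0. v (z, t) \<le> v (y, t)"
      by (auto simp: eventually_at_right_field intro: exI[of _ 1])
  qed
  have "radially_symmetric_about 0 u" "monotone_decreasing_about 0 u"
    "radially_symmetric_about 0 (boundary_restriction v)" "monotone_decreasing_about 0 (boundary_restriction v)"
    using u_mono v_mono by (auto simp: radially_symmetric_about_def monotone_decreasing_about_def intro!: antisym)
  then show ?thesis
    by blast
qed

end
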